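(* Let $\Gamma$ and $\Gamma'$ be $z$-knotted triangulations. Then: (1) If $F$ is a face of $\Gamma$ with $M_F=D_F$, then for every face $F'$ of $\Gamma'$ and every special homeomorphism $g:\partial F\to\partial F'$ the connected sum $\Gamma\#_g\Gamma'$ is $z$-knotted. (2) Suppose $F$ is a face of $\Gamma$ with $M_F$ the identity. If $F'$ is a face of $\Gamma'$ such that $\Gamma\#_g\Gamma'$ is $z$-knotted for some special homeomorphism $g:\partial F\to\partial F'$, then $M_{F'}$ is $D_{F'}$ or of type (M3). In these cases, $\Gamma\#_g\Gamma'$ is $z$-knotted for every special homeomorphism $g:\partial F\to\partial F'$. (3) If $F$ is a face of $\Gamma$, $F'$ is a face of $\Gamma'$, and each of $M_F,M_{F'}$ is of type (M3) or (M4), then there is a special homeomorphism $g:\partial F\to\partial F'$ such that $\Gamma\#_g\Gamma'$ is $z$-knotted.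
   Context: A triangulation is a connected simple finite graph embedded in a connected closed $2$-dimensional surface such that every face (closure of a component of the complement) is a closed $2$-disc with exactly three edges, every edge lies in exactly two distinct faces, and two distinct faces meet in an edge, a vertex, or not at all. Two distinct edges are adjacent if they share a vertex and lie in a common face. A zigzag is a sequence of edges $(e_i)_{i\in\mathbb N}$ with $e_i,e_{i+1}$ adjacent and the face containing $e_i,e_{i+1}$ distinct from the face containing $e_{i+1},e_{i+2}$, for all $i$; it is periodic and regarded as a cyclic sequence; written as a cyclic sequence of vertices, each passage through an edge has a direction (oriented edge). Its reverse is also a zigzag. A triangulation is $z$-knotted if it has exactly one pair of zigzags $\{Z,Z^{-1}\}$. For a face $F$ with vertices $a,b,c$, $\Omega(F)=\{ab,bc,ca,ac,cb,ba\}$ (oriented edges), $-e$ denotes the reverse of $e$, and $D_F=(ab,bc,ca)(ac,cb,ba)$. The $z$-monodromy $M_F$ of $\Omega(F)$: for $e\in\Omega(F)$ take $e_0$ with $D_F(e_0)=e$ and the zigzag $Z$ containing consecutive oriented edges $e_0,e$; $M_F(e)$ is the first element of $\Omega(F)$ occurring in $Z$ after $e$. Type (M3): $M_F=(-e_1,e_2,e_3)(-e_3,-e_2,e_1)$ where $(e_1,e_2,e_3)$ is one of the cycles of $D_F$. Type (M4): $M_F=(e_1,-e_2)(e_2,-e_1)$ where $(e_1,e_2,e_3)$ is one of the cycles of $D_F$ ($e_3,-e_3$ fixed). For faces $F$ of $\Gamma$ and $F'$ of $\Gamma'$, a special homeomorphism $g:\partial F\to\partial F'$ is a homeomorphism sending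 vertices to vertices; the connected sum $\Gamma\#_g\Gamma'$ is obtained by removing the interiors of $F,F'$ and gluing the boundaries via $g$ (vertices $v$ and $g(v)$ identified, corresponding edges identified); it is a triangulation of the connected sum of the surfaces. *)

theory Defs
  imports "HOL-Analysis.Analysis" "HOL-Combinatorics.Cycles"
begin

definition closed_surface :: "'a topology \<Rightarrow> bool" where
  "closed_surface X \<longleftrightarrow>
     topspace X \<noteq> {} \<and> connected_space X \<and> compact_space X \<and> Hausdorff_space X \<and> second_countable X \<and>
     (\<forall>x\<in>topspace X. \<exists>U. openin X U \<and> x \<in> U \<and>
        subtopology X U homeomorphic_space (euclidean :: complex topology))"

text \<open>An edge is the set of all points of an arc, including its two endpoints; a face is likewise
  a closed set of points. Everything below is recovered from these point sets: the endpoints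
  of an edge \<open>e\<close> are \<open>e \<inter> verts G\<close>, and \<open>e\<close> lies in the face \<open>F\<close> iff \<open>e \<subseteq> F\<close>.\<close>

record 'a embedded_graph =
  surface :: "'a topology"
  verts :: "'a set"
  edges :: "'a set set"

definition embedded_simple_graph :: "'a embedded_graph \<Rightarrow> bool" where
  "embedded_simple_graph G \<longleftrightarrow>
     finite (verts G) \<and> verts G \<subseteq> topspace (surface G) \<and> verts G \<noteq> {} \<and>
     finite (edges G) \<and>
     (\<forall>e\<in>edges G. \<exists>p. embedding_map (top_of_set {0..1::real}) (surface G) p \<and>
        e = p ` {0..1} \<and> e \<inter> verts G = {p 0, p 1}) \<and>
     (\<forall>e\<in>edges G. \<forall>e'\<in>edges G. e \<noteq> e' \<longrightarrow>
        e \<inter> e' \<subseteq> verts G \<and> e \<inter> verts G \<noteq> e' \<inter> verts G)"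

definition connected_graph :: "'a embedded_graph \<Rightarrow> bool" where
  "connected_graph G \<longleftrightarrow>
     (\<forall>u\<in>verts G. \<forall>v\<in>verts G. (u, v) \<in> {(x, y). \<exists>e\<in>edges G. e \<inter> verts G = {x, y}}\<^sup>*)"

definition faces :: "'a embedded_graph \<Rightarrow> 'a set set" where
  "faces G = (\<lambda>C. surface G closure_of C) `
     connected_components_of
       (subtopology (surface G) (topspace (surface G) - (verts G \<union> \<Union>(edges G))))"

text \<open>A disc with exactly three edges: the boundary circle of the disc consists of the edges
  contained in the face, of which there are three.\<close>

definition triangular_disc :: "'a embedded_graph \<Rightarrow> 'a set \<Rightarrow> bool" where
  "triangular_disc G F \<longleftrightarrow>
     (\<exists>h. homeomorphic_map (top_of_set (cball (0::complex) 1)) (subtopology (surface G) F) h \<and>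
        h ` sphere 0 1 = \<Union>{e \<in> edges G. e \<subseteq> F}) \<and>
     card {e \<in> edges G. e \<subseteq> F} = 3"

definition surface_triangulation :: "'a embedded_graph \<Rightarrow> bool" where
  "surface_triangulation G \<longleftrightarrow>
     closed_surface (surface G) \<and> embedded_simple_graph G \<and> connected_graph G \<and>
     (\<forall>F\<in>faces G. triangular_disc G F) \<and>
     (\<forall>e\<in>edges G. card {F \<in> faces G. e \<subseteq> F} = 2) \<and>
     (\<forall>F\<in>faces G. \<forall>F'\<in>faces G. F \<noteq> F' \<longrightarrow>
        F \<inter> F' \<in> edges G \<or> (\<exists>v\<in>verts G. F \<inter> F' = {v}) \<or> F \<inter> F' = {})"

definition adjacent :: "'a embedded_graph \<Rightarrow> 'a set \<Rightarrow> 'a set \<Rightarrow> bool" where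
  "adjacent G e e' \<longleftrightarrow>
     e \<in> edges G \<and> e' \<in> edges G \<and> e \<noteq> e' \<and>
     e \<inter> e' \<inter> verts G \<noteq> {} \<and> (\<exists>F\<in>faces G. e \<subseteq> F \<and> e' \<subseteq> F)"

text \<open>\<open>v\<close> is the sequence of vertices met by the edge sequence \<open>e\<close>: the \<open>i\<close>-th edge is traversed
  from \<open>v i\<close> to \<open>v (i + 1)\<close>.\<close>

definition traverses :: "'a embedded_graph \<Rightarrow> (int \<Rightarrow> 'a set) \<Rightarrow> (int \<Rightarrow> 'a) \<Rightarrow> bool" where
  "traverses G e v \<longleftrightarrow> (\<forall>i. e i \<inter> verts G = {v i, v (i + 1)})"

text \<open>Zigzags of a finite triangulation are periodic, hence extend uniquely to sequences indexed by
  the integers; this makes shifts and reversals available. The last conjunct says that a zigzag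
  is written by its sequence of vertices, so it leaves an edge at the end opposite to the one it
  entered from; without it, the edges around a single vertex would qualify.\<close>

definition zigzag :: "'a embedded_graph \<Rightarrow> (int \<Rightarrow> 'a set) \<Rightarrow> bool" where
  "zigzag G e \<longleftrightarrow>
     (\<forall>i. adjacent G (e i) (e (i + 1))) \<and>
     (\<forall>i. \<forall>F\<in>faces G. \<forall>F'\<in>faces G.
        e i \<subseteq> F \<and> e (i + 1) \<subseteq> F \<and> e (i + 1) \<subseteq> F' \<and> e (i + 2) \<subseteq> F' \<longrightarrow> F \<noteq> F') \<and>
     (\<exists>v. traverses G e v)"

definition cyclic_sequence :: "(int \<Rightarrow> 'b) \<Rightarrow> (int \<Rightarrow> 'b) set" where
  "cyclic_sequence e = range (\<lambda>k i. e (i + k))"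

definition reversed :: "(int \<Rightarrow> 'b) \<Rightarrow> int \<Rightarrow> 'b" where
  "reversed e = (\<lambda>i. e (- i))"

definition z_knotted :: "'a embedded_graph \<Rightarrow> bool" where
  "z_knotted G \<longleftrightarrow>
     (\<exists>e. zigzag G e \<and>
        cyclic_sequence ` {e'. zigzag G e'} = {cyclic_sequence e, cyclic_sequence (reversed e)})"

text \<open>The oriented edge from \<open>u\<close> to \<open>v\<close> is the pair \<open>(u, v)\<close>, and its reverse is its image under
  \<open>prod.swap\<close>. The permutations \<open>D\<^sub>F\<close> and \<open>M\<^sub>F\<close> of \<open>\<Omega>(F)\<close> are extended by the identity to all
  pairs.\<close>

definition oriented_edges :: "'a embedded_graph \<Rightarrow> 'a set \<Rightarrow> ('a \<times> 'a) set" where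
  "oriented_edges G F = {(u, v). u \<in> F \<inter> verts G \<and> v \<in> F \<inter> verts G \<and> u \<noteq> v}"

definition face_rotation :: "'a embedded_graph \<Rightarrow> 'a set \<Rightarrow> 'a \<times> 'a \<Rightarrow> 'a \<times> 'a" where
  "face_rotation G F = (\<lambda>(u, v).
     if (u, v) \<in> oriented_edges G F then (v, THE w. w \<in> F \<inter> verts G \<and> w \<noteq> u \<and> w \<noteq> v) else (u, v))"

definition z_monodromy :: "'a embedded_graph \<Rightarrow> 'a set \<Rightarrow> 'a \<times> 'a \<Rightarrow> 'a \<times> 'a" where
  "z_monodromy G F d =
     (if d \<in> oriented_edges G F then
        (THE d'. \<exists>d0\<in>oriented_edges G F. face_rotation G F d0 = d \<and>
           (\<exists>e v n. zigzag G e \<and> traverses G e v \<and>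
              (v 0, v 1) = d0 \<and> (v 1, v 2) = d \<and>
              n > 1 \<and> (v n, v (n + 1)) = d' \<and> d' \<in> oriented_edges G F \<and>
              (\<forall>j. 1 < j \<and> j < n \<longrightarrow> (v j, v (j + 1)) \<notin> oriented_edges G F)))
      else d)"

definition type_M3 :: "'a embedded_graph \<Rightarrow> 'a set \<Rightarrow> bool" where
  "type_M3 G F \<longleftrightarrow>
     (\<exists>e1\<in>oriented_edges G F. \<exists>e2 e3. e2 = face_rotation G F e1 \<and> e3 = face_rotation G F e2 \<and>
        z_monodromy G F =
          cycle_of_list [prod.swap e1, e2, e3] \<circ> cycle_of_list [prod.swap e3, prod.swap e2, e1])"

definition type_M4 :: "'a embedded_graph \<Rightarrow> 'a set \<Rightarrow> bool" where
  "type_M4 G F \<longleftrightarrow>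
     (\<exists>e1\<in>oriented_edges G F. \<exists>e2. e2 = face_rotation G F e1 \<and>
        z_monodromy G F =
          cycle_of_list [e1, prod.swap e2] \<circ> cycle_of_list [e2, prod.swap e1])"

definition special_homeomorphism ::
  "'a embedded_graph \<Rightarrow> 'a set \<Rightarrow> 'b embedded_graph \<Rightarrow> 'b set \<Rightarrow> ('a \<Rightarrow> 'b) \<Rightarrow> bool" where
  "special_homeomorphism G F G' F' g \<longleftrightarrow>
     homeomorphic_map (subtopology (surface G) (surface G frontier_of F))
       (subtopology (surface G') (surface G' frontier_of F')) g \<and>
     g ` (F \<inter> verts G) \<subseteq> verts G'"

text \<open>The points of the connected sum are represented in the sum type by identifying every point
  \<open>g x\<close> of the second boundary with \<open>Inl x\<close>; \<open>glue\<close> is the projection onto these representatives,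
  and the surface carries the quotient topology of the disjoint union.\<close>

definition minus_interior :: "'a topology \<Rightarrow> 'a set \<Rightarrow> 'a set" where
  "minus_interior X F = topspace X - X interior_of F"

definition glue ::
  "'a embedded_graph \<Rightarrow> 'a set \<Rightarrow> 'b embedded_graph \<Rightarrow> 'b set \<Rightarrow> ('a \<Rightarrow> 'b) \<Rightarrow> 'a + 'b \<Rightarrow> 'a + 'b" where
  "glue G F G' F' g p =
     (case p of
        Inl x \<Rightarrow> Inl x
      | Inr y \<Rightarrow>
          if y \<in> surface G' frontier_of F'
          then Inl (inv_into (surface G frontier_of F) g y) else Inr y)"

definition glued_openin ::
  "'a embedded_graph \<Rightarrow> 'a set \<Rightarrow> 'b embedded_graph \<Rightarrow> 'b set \<Rightarrow> ('a \<Rightarrow> 'b) \<Rightarrow> ('a + 'b) set \<Rightarrow> bool"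
where
  "glued_openin G F G' F' g U \<longleftrightarrow>
     (let A = minus_interior (surface G) F; B = minus_interior (surface G') F' in
        U \<subseteq> glue G F G' F' g ` (A <+> B) \<and>
        openin (subtopology (surface G) A) {x \<in> A. glue G F G' F' g (Inl x) \<in> U} \<and>
        openin (subtopology (surface G') B) {y \<in> B. glue G F G' F' g (Inr y) \<in> U})"

lemma istopology_glued_openin: "istopology (glued_openin G F G' F' g)"
proof -
  define A where "A = minus_interior (surface G) F"
  define B where "B = minus_interior (surface G') F'"
  define q where "q = glue G F G' F' g"
  have eq: "glued_openin G F G' F' g U \<longleftrightarrow>
      U \<subseteq> q ` (A <+> B) \<and>
      openin (subtopology (surface G) A) {x \<in> A. q (Inl x) \<in> U} \<and>
      openin (subtopology (surface G') B) {y \<in> B. q (Inr y) \<in> U}" for U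
    by (simp add: glued_openin_def Let_def A_def B_def q_def)
  have Int: "{x \<in> C. f x \<in> S \<inter> T} = {x \<in> C. f x \<in> S} \<inter> {x \<in> C. f x \<in> T}"
    for C and f :: "'c \<Rightarrow> 'a + 'b" and S T
    by auto
  have Un: "{x \<in> C. f x \<in> \<Union>\<K>} = (\<Union>K\<in>\<K>. {x \<in> C. f x \<in> K})"
    for C and f :: "'c \<Rightarrow> 'a + 'b" and \<K>
    by auto
  show ?thesis
    unfolding istopology_def eq
  proof (intro conjI allI impI)
    fix S T
    assume "S \<subseteq> q ` (A <+> B) \<and>
      openin (subtopology (surface G) A) {x \<in> A. q (Inl x) \<in> S} \<and>
      openin (subtopology (surface G') B) {y \<in> B. q (Inr y) \<in> S}"
      and "T \<subseteq> q ` (A <+> B) \<and>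
      openin (subtopology (surface G) A) {x \<in> A. q (Inl x) \<in> T} \<and>
      openin (subtopology (surface G') B) {y \<in> B. q (Inr y) \<in> T}"
    then show "S \<inter> T \<subseteq> q ` (A <+> B)"
      "openin (subtopology (surface G) A) {x \<in> A. q (Inl x) \<in> S \<inter> T}"
      "openin (subtopology (surface G') B) {y \<in> B. q (Inr y) \<in> S \<inter> T}"
      unfolding Int by blast+
  next
    fix \<K>
    assume "\<forall>K\<in>\<K>. K \<subseteq> q ` (A <+> B) \<and>
      openin (subtopology (surface G) A) {x \<in> A. q (Inl x) \<in> K} \<and>
      openin (subtopology (surface G') B) {y \<in> B. q (Inr y) \<in> K}"
    then show "\<Union>\<K> \<subseteq> q ` (A <+> B)"
      "openin (subtopology (surface G) A) {x \<in> A. q (Inl x) \<in> \<Union>\<K>}"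
      "openin (subtopology (surface G') B) {y \<in> B. q (Inr y) \<in> \<Union>\<K>}"
      unfolding Un by blast+
  qed
qed

definition connected_sum ::
  "'a embedded_graph \<Rightarrow> 'a set \<Rightarrow> 'b embedded_graph \<Rightarrow> 'b set \<Rightarrow> ('a \<Rightarrow> 'b) \<Rightarrow>
   ('a + 'b) embedded_graph" where
  "connected_sum G F G' F' g =
     \<lparr> surface = topology (glued_openin G F G' F' g),
       verts = glue G F G' F' g ` (verts G <+> verts G'),
       edges = (\<lambda>e. glue G F G' F' g ` Inl ` e) ` edges G \<union>
               (\<lambda>e. glue G F G' F' g ` Inr ` e) ` edges G' \<rparr>"

lemma openin_connected_sum:
  "openin (surface (connected_sum G F G' F' g)) = glued_openin G F G' F' g"
  by (simp add: connected_sum_def istopology_glued_openin)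

end

theory Submission
  imports Defs
begin

text \<open>A zigzag is an orbit of the map \<open>(a, b, c) \<mapsto> (b, c, d)\<close> on flags (faces with an ordering of their
  vertices), where \<open>bcd\<close> is the other face at the edge \<open>bc\<close>. If every zigzag passes through \<open>F\<close>, the first
  return map to the six flags of \<open>F\<close> is \<open>D\<^sub>F M\<^sub>F\<close>. In the connected sum a zigzag that reaches
  \<open>\<partial>F\<close> along an oriented edge continues on the other side, so the zigzags of the sum correspond to the
  cycles of \<open>M\<^sub>F M\<^bsub>F'\<^esub>\<close> on six oriented edges. Since \<open>e \<mapsto> - M\<^bsub>F'\<^esub>(e)\<close> is a fixed-point-free involution, there are
  only fifteen candidates for \<open>M\<^bsub>F'\<^esub>\<close>, and all three claims become finite checks. That the faces of the sum
  are the remaining faces of the two triangulations uses invariance of domain: open discs of faces are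
  open in the surface, so that the frontier of a face consists of its three edges.\<close>

section \<open>Reversible dynamics and gluing along a section\<close>

text \<open>A zigzag visits a face along two consecutive edges, so a visit is one flag
  \<open>(a, b, c)\<close>: it comes in by ab and goes out by bc. The monodromy leads from the
  outgoing edge of one visit to the incoming edge of the next. With an oriented edge named by the
  flag that begins with it, the visit that ends with that edge is its \<open>backshift\<close>. This
  is the map \<delta> in \<open>passage\<close> and in the gluing: a path that would enter the
  removed face by bc, at \<open>(b, c, d)\<close>, crosses bc and continues in the other summand as
  if leaving the face from \<open>(d, b, c)\<close>.

  The involution comes from reading zigzags backwards; it has no fixed point because a zigzag never
  runs into its own reversal. Knottedness of the summands enters twice: it makes every zigzag pass
  through the face, and it discards candidates whose first return map is not knotted.

  z-knottedness depends only on the incidence facts collected in \<open>graph_model\<close>. These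
  are derived for each triangulation and for the connected sum, so that one translation into flags
  serves all three.\<close>

definition linked :: "'x set \<Rightarrow> ('x \<Rightarrow> 'x) \<Rightarrow> 'x \<Rightarrow> 'x \<Rightarrow> bool" where
  "linked X \<tau> = equivclp (\<lambda>x y. x \<in> X \<and> y = \<tau> x)"

lemma linked_refl [simp, intro]: "linked X \<tau> x x"
  by (simp add: linked_def)

lemma linked_step: "x \<in> X \<Longrightarrow> linked X \<tau> x (\<tau> x)"
  by (auto simp: linked_def intro: r_into_equivclp)

lemma linked_sym: "linked X \<tau> x y \<Longrightarrow> linked X \<tau> y x"
  unfolding linked_def by (rule equivclp_sym)

lemma linked_trans [trans]: "linked X \<tau> x y \<Longrightarrow> linked X \<tau> y z \<Longrightarrow> linked X \<tau> x z"
  unfolding linked_def by (rule equivclp_trans)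

text \<open>Symmetry of the target relation takes care of backward steps, so only forward steps have
  to be checked. Most comparisons of cycles below go through this.\<close>

lemma linked_map:
  assumes "linked X \<tau> x y"
    and step: "\<And>x. x \<in> X \<Longrightarrow> linked Y \<sigma> (f x) (f (\<tau> x))"
  shows "linked Y \<sigma> (f x) (f y)"
  using assms(1) unfolding linked_def[of X]
proof (induction rule: equivclp_induct)
  case (step y z)
  have "linked Y \<sigma> (f y) (f z)"
    using step.hyps(2) assms(2) linked_sym by metis
  with step.IH show ?case
    by (rule linked_trans)
qed simp

lemma linked_invariant:
  assumes "linked X \<tau> x y" and "\<And>x. x \<in> X \<Longrightarrow> P (\<tau> x) \<longleftrightarrow> P x"
  shows "P x \<longleftrightarrow> P y"
  using assms(1) unfolding linked_def
  by (induction rule: equivclp_induct) (use assms(2) in auto)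

lemma linked_funpow:
  assumes "\<And>x. x \<in> X \<Longrightarrow> \<tau> x \<in> X" "x \<in> X"
  shows "linked X \<tau> x ((\<tau> ^^ n) x) \<and> (\<tau> ^^ n) x \<in> X"
proof (induction n)
  case (Suc n)
  then show ?case
    using assms linked_step[of "(\<tau> ^^ n) x" X \<tau>] by (auto intro: linked_trans)
qed (use assms in auto)

text \<open>The abstract form of having a single zigzag up to reversal. The map \<rho> is a
  parameter because reversal of cycles on the six flags of a glued face is given by another map,
  \<open>turn\<close>.\<close>

definition knotted :: "'x set \<Rightarrow> ('x \<Rightarrow> 'x) \<Rightarrow> ('x \<Rightarrow> 'x) \<Rightarrow> bool" where
  "knotted X \<tau> \<rho> \<longleftrightarrow> (\<exists>x\<in>X. \<forall>y\<in>X. linked X \<tau> x y \<or> linked X \<tau> (\<rho> x) y)"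

text \<open>The axiom \<open>\<tau>_\<rho>\<close> says that \<rho> conjugates \<tau> to its
  inverse. The last two assumptions exclude the two ways in which a path can turn into its own
  reversal: at a state, or between two consecutive states.\<close>

locale reversible =
  fixes X :: "'x set" and \<tau> \<rho> :: "'x \<Rightarrow> 'x"
  assumes finite_X: "finite X"
    and \<tau>_mem: "x \<in> X \<Longrightarrow> \<tau> x \<in> X"
    and \<rho>_mem: "x \<in> X \<Longrightarrow> \<rho> x \<in> X"
    and \<rho>_\<rho> [simp]: "\<rho> (\<rho> x) = x"
    and \<tau>_\<rho>: "x \<in> X \<Longrightarrow> \<tau> (\<rho> (\<tau> x)) = \<rho> x"
    and \<rho>_neq: "x \<in> X \<Longrightarrow> \<rho> x \<noteq> x"
    and \<tau>_neq_\<rho>: "x \<in> X \<Longrightarrow> \<tau> x \<noteq> \<rho> x"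
begin

lemma funpow_mem: "x \<in> X \<Longrightarrow> (\<tau> ^^ n) x \<in> X"
  using linked_funpow[of X \<tau>] \<tau>_mem by blast

lemma linked_funpow': "x \<in> X \<Longrightarrow> linked X \<tau> x ((\<tau> ^^ n) x)"
  using linked_funpow[of X \<tau>] \<tau>_mem by blast

lemma inj_\<tau>: "inj_on \<tau> X"
  by (metis \<rho>_\<rho> \<tau>_\<rho> inj_onI)

text \<open>Each step from a reversed state undoes one forward step, so the stretch is retraced from
  its end.\<close>

lemma funpow_\<rho>:
  assumes "x \<in> X" "k \<le> n"
  shows "(\<tau> ^^ k) (\<rho> ((\<tau> ^^ n) x)) = \<rho> ((\<tau> ^^ (n - k)) x)"
  using assms(2)
proof (induction k)
  case (Suc k)
  then have "n - k = Suc (n - Suc k)"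
    by simp
  then have "(\<tau> ^^ Suc k) (\<rho> ((\<tau> ^^ n) x)) = \<tau> (\<rho> (\<tau> ((\<tau> ^^ (n - Suc k)) x)))"
    using Suc by simp
  then show ?case
    using \<tau>_\<rho> funpow_mem assms(1) by simp
qed simp

lemma linked_\<rho>: "linked X \<tau> x y \<Longrightarrow> linked X \<tau> (\<rho> x) (\<rho> y)"
  by (erule linked_map) (metis \<tau>_\<rho> \<tau>_mem \<rho>_mem linked_step linked_sym)

text \<open>Pigeonhole on the finite X gives two equal iterates, and injectivity of \<tau> cancels
  their common initial steps.\<close>

lemma recurrent:
  assumes "x \<in> X"
  obtains n where "n > 0" "(\<tau> ^^ n) x = x"
proof -
  have "\<not> inj (\<lambda>n. (\<tau> ^^ n) x)"
  proof
    assume "inj (\<lambda>n. (\<tau> ^^ n) x)"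
    then have "infinite (range (\<lambda>n. (\<tau> ^^ n) x))"
      using finite_imageD by blast
    moreover have "range (\<lambda>n. (\<tau> ^^ n) x) \<subseteq> X"
      using funpow_mem assms by auto
    ultimately show False
      using finite_X finite_subset by blast
  qed
  then obtain i j where ij: "i < j" "(\<tau> ^^ i) x = (\<tau> ^^ j) x"
    unfolding inj_def by (metis linorder_neqE_nat)
  have "(\<tau> ^^ (j - i)) x = x"
    using ij(2)[symmetric] ij(1)
  proof (induction i arbitrary: j)
    case (Suc i)
    then obtain j' where j: "j = Suc j'" "i < j'"
      by (metis Suc_lessE)
    then have "(\<tau> ^^ j') x = (\<tau> ^^ i) x"
      using Suc.prems inj_\<tau> funpow_mem assms by (auto dest: inj_onD)
    then show ?case
      using Suc.IH[of j'] j by simp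
  qed simp
  with that ij(1) show ?thesis
    by (meson zero_less_diff)
qed

text \<open>At the midpoint of a stretch joining \<open>x\<close> to its reversal, reversing would fix a state or
  agree with one step.\<close>

lemma funpow_neq_\<rho>:
  assumes "x \<in> X"
  shows "(\<tau> ^^ n) x \<noteq> \<rho> x"
proof
  assume eq: "(\<tau> ^^ n) x = \<rho> x"
  define k where "k = n div 2"
  define w where "w = (\<tau> ^^ k) x"
  have w: "w \<in> X"
    using funpow_mem assms w_def by blast
  have "n - k = k \<or> n - k = Suc k"
    unfolding k_def by presburger
  moreover have "w = \<rho> ((\<tau> ^^ (n - k)) x)"
    using funpow_\<rho>[OF assms, of k n] eq unfolding k_def w_def by simp
  ultimately have "w = \<rho> w \<or> w = \<rho> (\<tau> w)"
    unfolding w_def by (metis funpow.simps(2) comp_apply)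
  then show False
    using w \<rho>_neq \<tau>_neq_\<rho> by (metis \<rho>_\<rho>)
qed

end

text \<open>In the application Y consists of the six flags of one face. The axiom
  \<open>\<delta>_\<rho>\<close> makes \<rho> after \<delta> an involution on Y,
  \<open>\<tau>_Y\<close> reflects that a zigzag changes the face at every step, and
  \<open>meets_Y\<close> is what z-knottedness of the triangulation provides.\<close>

locale reversible_section = reversible +
  fixes Y :: "'a set" and \<delta> :: "'a \<Rightarrow> 'a"
  assumes Y_subset: "Y \<subseteq> X"
    and \<rho>_Y: "y \<in> Y \<Longrightarrow> \<rho> y \<in> Y"
    and \<delta>_Y: "y \<in> Y \<Longrightarrow> \<delta> y \<in> Y"
    and \<delta>_\<rho>: "y \<in> Y \<Longrightarrow> \<delta> (\<rho> (\<delta> y)) = \<rho> y"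
    and \<tau>_Y: "y \<in> Y \<Longrightarrow> \<tau> y \<notin> Y"
    and meets_Y: "x \<in> X \<Longrightarrow> \<exists>y\<in>Y. linked X \<tau> x y"
begin

text \<open>The count starts at 0, so \<open>hit\<close> fixes Y pointwise and the first return map
  is \<open>hit\<close> after \<tau>.\<close>

definition hit :: "'a \<Rightarrow> 'a" where
  "hit x = (\<tau> ^^ (LEAST n. (\<tau> ^^ n) x \<in> Y)) x"

text \<open>The axiom \<open>meets_Y\<close> only places a state of Y somewhere on the cycle of x,
  possibly behind x; recurrence carries x forward round the cycle to it.\<close>

lemma reaches_Y:
  assumes "x \<in> X"
  shows "\<exists>n. (\<tau> ^^ n) x \<in> Y"
proof -
  define P where "P x \<longleftrightarrow> (\<exists>n. (\<tau> ^^ n) x \<in> Y)" for x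
  have "P (\<tau> x) \<longleftrightarrow> P x" if x: "x \<in> X" for x
  proof
    assume "P (\<tau> x)"
    then obtain n where "(\<tau> ^^ Suc n) x \<in> Y"
      unfolding P_def funpow_Suc_right comp_apply by blast
    then show "P x"
      unfolding P_def by blast
  next
    assume "P x"
    then obtain n where n: "(\<tau> ^^ n) x \<in> Y"
      unfolding P_def by blast
    \<comment> \<open>If n = 0, then x itself lies in Y, which says nothing yet about the path from
      \<tau> x; one full round replaces 0 by a positive exponent.\<close>
    obtain m where "m > 0" "(\<tau> ^^ m) x = x"
      using recurrent[OF x] .
    with n have "\<exists>n>0. (\<tau> ^^ n) x \<in> Y"
      by (cases n) auto
    then obtain k where "(\<tau> ^^ Suc k) x \<in> Y"
      by (metis Suc_pred)
    then show "P (\<tau> x)"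
      unfolding P_def funpow_Suc_right comp_apply by blast
  qed
  moreover obtain y where "y \<in> Y" "linked X \<tau> x y"
    using meets_Y[OF assms] by blast
  moreover have "P y"
    unfolding P_def using \<open>y \<in> Y\<close> by (metis funpow_0)
  ultimately show ?thesis
    using linked_invariant[of X \<tau> x y P] P_def by blast
qed

lemma hitE:
  assumes "x \<in> X"
  obtains n where "hit x = (\<tau> ^^ n) x" "(\<tau> ^^ n) x \<in> Y" "\<And>k. k < n \<Longrightarrow> (\<tau> ^^ k) x \<notin> Y"
proof -
  define n where "n = (LEAST n. (\<tau> ^^ n) x \<in> Y)"
  show ?thesis
    by (rule that[of n]; use LeastI_ex[OF reaches_Y[OF assms]] in \<open>simp add: hit_def n_def\<close>)
      (metis not_less_Least)
qed

lemma hit_eqI: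
  assumes "(\<tau> ^^ n) x \<in> Y" "\<And>k. k < n \<Longrightarrow> (\<tau> ^^ k) x \<notin> Y"
  shows "hit x = (\<tau> ^^ n) x"
proof -
  have "(LEAST n. (\<tau> ^^ n) x \<in> Y) = n"
    using assms by (intro Least_equality) (auto simp: not_less[symmetric])
  then show ?thesis
    by (simp add: hit_def)
qed

lemma hit_mem: "x \<in> X \<Longrightarrow> hit x \<in> Y"
  by (metis hitE)

lemma hit_Y [simp]: "y \<in> Y \<Longrightarrow> hit y = y"
  using hit_eqI[of 0 y] by simp

lemma hit_\<tau>:
  assumes "x \<in> X" "x \<notin> Y"
  shows "hit (\<tau> x) = hit x"
proof -
  obtain n where n: "hit (\<tau> x) = (\<tau> ^^ n) (\<tau> x)" "(\<tau> ^^ n) (\<tau> x) \<in> Y"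
    "\<And>k. k < n \<Longrightarrow> (\<tau> ^^ k) (\<tau> x) \<notin> Y"
    using hitE \<tau>_mem assms by metis
  have "hit x = (\<tau> ^^ Suc n) x"
  proof (rule hit_eqI)
    show "(\<tau> ^^ Suc n) x \<in> Y"
      using n by (simp add: funpow_swap1)
    show "(\<tau> ^^ k) x \<notin> Y" if "k < Suc n" for k
      using that assms n(3) by (cases k) (auto simp: funpow_swap1)
  qed
  then show ?thesis
    using n by (simp add: funpow_swap1)
qed

lemma linked_hit: "x \<in> X \<Longrightarrow> linked X \<tau> x (hit x)"
  by (metis hitE linked_funpow')

text \<open>The stretch from y to its next visit, read backwards, leads from the reversed next visit
  to the reversed y. Since Y is closed under \<rho>, it meets Y no earlier.\<close>

lemma return_reversal:
  assumes "y \<in> Y"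
  shows "hit (\<tau> (\<rho> (hit (\<tau> y)))) = \<rho> y"
proof -
  have y: "y \<in> X" using assms Y_subset by blast
  obtain n where n: "hit (\<tau> y) = (\<tau> ^^ n) (\<tau> y)" "(\<tau> ^^ n) (\<tau> y) \<in> Y"
    "\<And>k. k < n \<Longrightarrow> (\<tau> ^^ k) (\<tau> y) \<notin> Y"
    using hitE \<tau>_mem y by metis
  have eq: "(\<tau> ^^ k) (\<tau> (\<rho> (hit (\<tau> y)))) = \<rho> ((\<tau> ^^ (n - k)) y)" if "k \<le> n" for k
    using funpow_\<rho>[OF y, of "Suc k" "Suc n"] that n(1) by (simp add: funpow_swap1)
  have "hit (\<tau> (\<rho> (hit (\<tau> y)))) = (\<tau> ^^ n) (\<tau> (\<rho> (hit (\<tau> y))))"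
  proof (rule hit_eqI)
    show "(\<tau> ^^ n) (\<tau> (\<rho> (hit (\<tau> y)))) \<in> Y"
      using eq[of n] \<rho>_Y assms by simp
    show "(\<tau> ^^ k) (\<tau> (\<rho> (hit (\<tau> y)))) \<notin> Y" if "k < n" for k
    proof -
      obtain l where l: "n - k = Suc l" "l < n"
        using \<open>k < n\<close> by (metis Suc_diff_Suc diff_less_Suc less_Suc_eq_le order_less_le_trans Suc_le_eq)
      have "(\<tau> ^^ (n - k)) y \<notin> Y"
        using n(3)[of l] l by (simp add: funpow_swap1)
      then show ?thesis
        using eq[of k] that \<rho>_Y by (metis \<rho>_\<rho> less_imp_le)
    qed
  qed
  then show ?thesis
    using eq[of n] by simp
qed

lemma return_neq_\<rho>:
  assumes "y \<in> Y"
  shows "hit (\<tau> y) \<noteq> \<rho> y"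
proof -
  have y: "y \<in> X" using assms Y_subset by blast
  obtain n where "hit (\<tau> y) = (\<tau> ^^ n) (\<tau> y)"
    using hitE \<tau>_mem y by metis
  then have "hit (\<tau> y) = (\<tau> ^^ Suc n) y"
    by (simp add: funpow_swap1)
  then show ?thesis
    using funpow_neq_\<rho>[OF y] by metis
qed

text \<open>This is the z-monodromy, with y written for its first oriented edge: \<delta> y is the
  visit that ends with this edge, and the next visit begins with its image.\<close>

definition passage :: "'a \<Rightarrow> 'a" where
  "passage y = hit (\<tau> (\<delta> y))"

text \<open>On flags this sends \<open>(a, b, c)\<close> to \<open>(b, a, c)\<close>, so it reverses
  the first oriented edge.\<close>

definition flip :: "'a \<Rightarrow> 'a" where
  "flip y = \<rho> (\<delta> y)"

lemma \<delta>_flip: "y \<in> Y \<Longrightarrow> \<delta> (flip y) = \<rho> y"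
  by (simp add: flip_def \<delta>_\<rho>)

lemma flip_flip: "y \<in> Y \<Longrightarrow> flip (flip y) = y"
  using \<delta>_\<rho> by (simp add: flip_def)

lemma flip_mem: "y \<in> Y \<Longrightarrow> flip y \<in> Y"
  by (simp add: flip_def \<rho>_Y \<delta>_Y)

lemma passage_mem: "y \<in> Y \<Longrightarrow> passage y \<in> Y"
  unfolding passage_def using Y_subset \<delta>_Y hit_mem \<tau>_mem by blast

text \<open>Reading the zigzag backwards leads from the reversed image of an oriented edge to the
  reversed edge itself, that is, M(-M(e)) = -e.\<close>

lemma flip_passage_flip_passage:
  assumes "y \<in> Y"
  shows "flip (passage (flip (passage y))) = y"
proof -
  have "passage (flip (passage y)) = \<rho> (\<delta> y)"
    using return_reversal[OF \<delta>_Y[OF assms]] \<delta>_flip[OF passage_mem[OF assms]]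
    by (simp add: passage_def)
  then show ?thesis
    using flip_flip assms by (simp add: flip_def)
qed

text \<open>A fixed point would mean that the path from \<delta> y returns to Y at its own
  reversal.\<close>

lemma flip_passage_neq:
  assumes "y \<in> Y"
  shows "flip (passage y) \<noteq> y"
  using return_neq_\<rho>[OF \<delta>_Y[OF assms]] flip_flip[OF passage_mem[OF assms]] passage_def flip_def
  by metis

text \<open>The map \<open>hit\<close> collapses the stretch before each visit to that visit, so a
  step off Y becomes trivial and a step from Y becomes one return.\<close>

lemma linked_return:
  assumes "linked X \<tau> x y"
  shows "linked Y (\<lambda>y. hit (\<tau> y)) (hit x) (hit y)"
  using assms
proof (rule linked_map)
  fix x assume x: "x \<in> X"
  show "linked Y (\<lambda>y. hit (\<tau> y)) (hit x) (hit (\<tau> x))"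
  proof (cases "x \<in> Y")
    case True
    then show ?thesis
      using linked_step[of x Y "\<lambda>y. hit (\<tau> y)"] by simp
  next
    case False
    then show ?thesis
      using hit_\<tau> x by simp
  qed
qed

text \<open>This is the condition that knottedness of a triangulation imposes on the monodromy of a
  face; it serves as a premise of the finite checks.\<close>

lemma knotted_return:
  assumes "knotted X \<tau> \<rho>"
  shows "knotted Y (\<lambda>y. hit (\<tau> y)) \<rho>"
proof -
  let ?R = "\<lambda>y. hit (\<tau> y)"
  obtain x where x: "x \<in> X" "\<And>y. y \<in> X \<Longrightarrow> linked X \<tau> x y \<or> linked X \<tau> (\<rho> x) y"
    using assms unfolding knotted_def by blast
  have "linked Y ?R (hit x) y \<or> linked Y ?R (\<rho> (hit x)) y" if y: "y \<in> Y" for y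
  proof -
    have "linked X \<tau> (\<rho> (hit x)) (\<rho> x)"
      by (simp add: linked_\<rho> linked_hit linked_sym x(1))
    then have "linked Y ?R (\<rho> (hit x)) (hit (\<rho> x))"
      using linked_return \<rho>_Y hit_mem hit_Y x(1) by metis
    then show ?thesis
      using x(2)[of y] linked_return linked_trans y Y_subset hit_Y by (metis subsetD)
  qed
  then show ?thesis
    unfolding knotted_def using hit_mem x(1) by blast
qed

end

section \<open>Gluing two systems along a common section\<close>

locale glued_sections =
  A: reversible_section X1 \<tau>1 \<rho> Y \<delta> + B: reversible_section X2 \<tau>2 \<rho> Y \<delta>
  for X1 X2 :: "'x set" and \<tau>1 \<tau>2 \<rho> :: "'x \<Rightarrow> 'x" and Y :: "'x set" and \<delta> :: "'x \<Rightarrow> 'x" +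
  fixes \<tau> :: "'x \<Rightarrow> 'x"
  assumes disjoint: "X1 \<inter> X2 = Y"
    and step1: "x \<in> X1 - Y \<Longrightarrow> \<tau> x = (if \<tau>1 x \<in> Y then \<tau>2 (\<delta> (\<tau>1 x)) else \<tau>1 x)"
    and step2: "x \<in> X2 - Y \<Longrightarrow> \<tau> x = (if \<tau>2 x \<in> Y then \<tau>1 (\<delta> (\<tau>2 x)) else \<tau>2 x)"
begin

abbreviation "X \<equiv> (X1 \<union> X2) - Y"
abbreviation "M \<equiv> \<lambda>y. A.passage (B.passage y)"

text \<open>The state of Y at which the path through x next leaves X1 for X2. A path in X2 has to
  cross X1 once before, hence the extra \<open>A.passage\<close>.\<close>

definition crossing :: "'x \<Rightarrow> 'x" where
  "crossing x = (if x \<in> X1 then A.hit x else A.passage (B.hit x))"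

lemma crossing_1: "x \<in> X1 - Y \<Longrightarrow> crossing x = A.hit x"
  by (simp add: crossing_def)

lemma crossing_2: "x \<in> X2 - Y \<Longrightarrow> crossing x = A.passage (B.hit x)"
  using disjoint by (auto simp: crossing_def)

lemma crossing_mem: "x \<in> X \<Longrightarrow> crossing x \<in> Y"
  by (auto simp: A.hit_mem A.passage_mem B.hit_mem crossing_def)

lemma enter2: "y \<in> Y \<Longrightarrow> \<tau>2 (\<delta> y) \<in> X2 - Y"
  using B.Y_subset B.\<delta>_Y B.\<tau>_Y B.\<tau>_mem by blast

lemma enter1: "y \<in> Y \<Longrightarrow> \<tau>1 (\<delta> y) \<in> X1 - Y"
  using A.Y_subset A.\<delta>_Y A.\<tau>_Y A.\<tau>_mem by blast

lemma crossing_enter2: "y \<in> Y \<Longrightarrow> crossing (\<tau>2 (\<delta> y)) = M y"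
  using crossing_2 enter2 B.passage_def by simp

text \<open>Only a step out of X1 moves the crossing, by one application of M; a step out of X2 is
  already anticipated by the \<open>A.passage\<close> in \<open>crossing\<close>.\<close>

lemma linked_crossing:
  assumes "linked X \<tau> x y"
  shows "linked Y M (crossing x) (crossing y)"
  using assms
proof (rule linked_map)
  fix x assume "x \<in> X"
  then consider "x \<in> X1 - Y" "\<tau>1 x \<in> Y" | "x \<in> X1 - Y" "\<tau>1 x \<notin> Y"
    | "x \<in> X2 - Y" "\<tau>2 x \<in> Y" | "x \<in> X2 - Y" "\<tau>2 x \<notin> Y"
    by blast
  then show "linked Y M (crossing x) (crossing (\<tau> x))"
  proof cases
    case 1
    then have "crossing x = \<tau>1 x"
      using A.hit_\<tau>[of x] crossing_1 by simp
    moreover have "crossing (\<tau> x) = M (\<tau>1 x)"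
      using 1 step1 crossing_enter2 by simp
    ultimately show ?thesis
      using linked_step[OF 1(2), of M] by simp
  next
    case 2
    then have "\<tau>1 x \<in> X1 - Y"
      using A.\<tau>_mem by simp
    then show ?thesis
      using 2 step1 crossing_1 A.hit_\<tau>[of x] by simp
  next
    case 3
    then have "crossing x = A.passage (\<tau>2 x)"
      using B.hit_\<tau>[of x] crossing_2 by simp
    moreover have "crossing (\<tau> x) = A.passage (\<tau>2 x)"
      using 3 step2 crossing_1 enter1 by (simp add: A.passage_def)
    ultimately show ?thesis
      by simp
  next
    case 4
    then have "\<tau>2 x \<in> X2 - Y"
      using B.\<tau>_mem by simp
    then show ?thesis
      using 4 step2 crossing_2 B.hit_\<tau>[of x] by simp
  qed
qed

text \<open>The glued map agrees with \<tau>1 up to the step that would enter Y; that last step is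
  the one redirected into X2.\<close>

lemma linked_until_exit1:
  assumes "x \<in> X1 - Y"
  shows "linked X \<tau> x (\<tau>2 (\<delta> (A.hit x)))"
proof -
  obtain n where n: "A.hit x = (\<tau>1 ^^ n) x" "(\<tau>1 ^^ n) x \<in> Y" "\<And>k. k < n \<Longrightarrow> (\<tau>1 ^^ k) x \<notin> Y"
    using A.hitE assms by blast
  have "n > 0"
    using n assms by (cases n) auto
  have "linked X \<tau> x ((\<tau>1 ^^ k) x)" if "k < n" for k
    using that
  proof (induction k)
    case (Suc k)
    have "(\<tau>1 ^^ k) x \<in> X1 - Y"
      using n(3) A.funpow_mem assms Suc.prems by auto
    then have "linked X \<tau> ((\<tau>1 ^^ k) x) ((\<tau>1 ^^ Suc k) x)"
      using step1[of "(\<tau>1 ^^ k) x"] n(3)[OF Suc.prems] linked_step[of "(\<tau>1 ^^ k) x" X \<tau>]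
      by simp
    then show ?case
      using Suc linked_trans by (metis Suc_lessD)
  qed simp
  then have "linked X \<tau> x ((\<tau>1 ^^ (n - 1)) x)"
    using \<open>n > 0\<close> by simp
  moreover have "(\<tau>1 ^^ (n - 1)) x \<in> X1 - Y"
    using n(3) A.funpow_mem assms \<open>n > 0\<close> by simp
  moreover have "\<tau>1 ((\<tau>1 ^^ (n - 1)) x) = A.hit x"
    using n(1) \<open>n > 0\<close> by (metis Suc_pred' comp_apply funpow.simps(2))
  ultimately show ?thesis
    using step1 n(1,2) linked_step[of "(\<tau>1 ^^ (n - 1)) x" X \<tau>] linked_trans
    by (smt (verit, ccfv_SIG) Diff_iff UnCI)
qed

end

lemma (in glued_sections) swap_sides: "glued_sections X2 X1 \<tau>2 \<tau>1 \<rho> Y \<delta> \<tau>"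
  by unfold_locales (use disjoint step1 step2 in auto)

context glued_sections
begin

lemma linked_until_exit2:
  assumes "x \<in> X2 - Y"
  shows "linked X \<tau> x (\<tau>1 (\<delta> (B.hit x)))"
proof -
  interpret S: glued_sections X2 X1 \<tau>2 \<tau>1 \<rho> Y \<delta> \<tau>
    by (rule swap_sides)
  show ?thesis
    using S.linked_until_exit1[OF assms] by (simp add: Un_commute)
qed

lemma linked_enter2_crossing:
  assumes "x \<in> X"
  shows "linked X \<tau> x (\<tau>2 (\<delta> (crossing x)))"
proof (cases "x \<in> X1")
  case True
  then show ?thesis
    using linked_until_exit1 assms crossing_1 by simp
next
  case False
  then have x: "x \<in> X2 - Y" using assms by blast
  have "B.hit x \<in> Y"
    using B.hit_mem x by simp
  then have "linked X \<tau> (\<tau>1 (\<delta> (B.hit x))) (\<tau>2 (\<delta> (crossing x)))"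
    using linked_until_exit1[OF enter1] crossing_2[OF x] by (simp add: A.passage_def)
  then show ?thesis
    using linked_until_exit2[OF x] linked_trans by metis
qed

text \<open>A path that enters X2 at y leaves it at \<open>B.passage y\<close>; the reversed path
  enters X2 by the reversed exit edge. So \<open>turn\<close> is what reversal becomes on the states
  of Y.\<close>

definition turn :: "'x \<Rightarrow> 'x" where
  "turn y = B.flip (B.passage y)"

lemma turn_mem: "y \<in> Y \<Longrightarrow> turn y \<in> Y"
  by (simp add: turn_def B.flip_mem B.passage_mem)

lemma linked_enter2:
  assumes "linked Y M y z" "y \<in> Y"
  shows "linked X \<tau> (\<tau>2 (\<delta> y)) (\<tau>2 (\<delta> z))"
  using assms(1)
proof (rule linked_map)
  fix y assume "y \<in> Y"
  then show "linked X \<tau> (\<tau>2 (\<delta> y)) (\<tau>2 (\<delta> (M y)))"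
    using linked_enter2_crossing[of "\<tau>2 (\<delta> y)"] enter2 crossing_enter2 by auto
qed

text \<open>Following the path backwards from its last state before leaving \<open>X2\<close>.\<close>

lemma linked_\<rho>_enter2:
  assumes "y \<in> Y"
  shows "linked X \<tau> (\<tau>2 (\<delta> (turn y))) (\<rho> (\<tau>2 (\<delta> y)))"
proof -
  let ?x = "\<tau>2 (\<delta> y)"
  have x: "?x \<in> X2 - Y"
    by (rule enter2[OF assms])
  obtain n where n: "B.hit ?x = (\<tau>2 ^^ n) ?x" "(\<tau>2 ^^ n) ?x \<in> Y" "\<And>k. k < n \<Longrightarrow> (\<tau>2 ^^ k) ?x \<notin> Y"
    using B.hitE x by blast
  have "n > 0"
    using n x by (cases n) auto
  have "\<delta> (turn y) = \<rho> (B.hit ?x)"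
    unfolding turn_def using B.\<delta>_flip[OF B.passage_mem[OF assms]] by (simp add: B.passage_def)
  then have start: "(\<tau>2 ^^ k) (\<tau>2 (\<delta> (turn y))) = \<rho> ((\<tau>2 ^^ (n - Suc k)) ?x)" if "k < n" for k
    using B.funpow_\<rho>[of ?x "Suc k" n] that x n(1) by (simp add: funpow_swap1)
  let ?z = "\<tau>2 (\<delta> (turn y))"
  have notin: "(\<tau>2 ^^ k) ?z \<in> X2 - Y" if "k < n" for k
    using start[OF that] n(3)[of "n - Suc k"] that B.\<rho>_Y B.funpow_mem enter2 turn_mem assms
    by (metis B.\<rho>_\<rho> Diff_iff diff_less zero_less_Suc \<open>0 < n\<close>)
  have "linked X \<tau> ?z ((\<tau>2 ^^ k) ?z)" if "k < n" for k
    using that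
  proof (induction k)
    case (Suc k)
    have k: "(\<tau>2 ^^ k) ?z \<in> X2 - Y"
      using notin Suc.prems Suc_lessD by blast
    then have "\<tau> ((\<tau>2 ^^ k) ?z) = (\<tau>2 ^^ Suc k) ?z"
      using step2[OF k] notin[OF Suc.prems] by simp
    moreover have "(\<tau>2 ^^ k) ?z \<in> X"
      using k by blast
    ultimately have "linked X \<tau> ((\<tau>2 ^^ k) ?z) ((\<tau>2 ^^ Suc k) ?z)"
      using linked_step[of "(\<tau>2 ^^ k) ?z" X \<tau>] by (simp only:)
    then show ?case
      by (rule linked_trans[OF Suc.IH[OF Suc_lessD[OF Suc.prems]]])
  qed simp
  from this[of "n - 1"] show ?thesis
    using start[of "n - 1"] \<open>n > 0\<close> by simp
qed

lemma \<rho>_X: "x \<in> X \<Longrightarrow> \<rho> x \<in> X"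
  using A.\<rho>_Y A.\<rho>_mem B.\<rho>_mem by (metis A.\<rho>_\<rho> Diff_iff UnE UnI1 UnI2)

text \<open>Every state of the sum is linked to one that has just entered X2, so cycles of the sum
  and cycles of M match. Reversal exchanges entrances and exits of X2, which is why \<rho> is
  replaced by \<open>turn\<close>.\<close>

theorem knotted_glued_iff:
  assumes rev: "\<And>x. x \<in> X \<Longrightarrow> \<tau> (\<rho> (\<tau> x)) = \<rho> x" "\<And>x. x \<in> X \<Longrightarrow> \<tau> x \<in> X"
  shows "knotted X \<tau> \<rho> \<longleftrightarrow> knotted Y M turn"
proof
  assume "knotted X \<tau> \<rho>"
  then obtain x where x: "x \<in> X" "\<And>y. y \<in> X \<Longrightarrow> linked X \<tau> x y \<or> linked X \<tau> (\<rho> x) y"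
    unfolding knotted_def by blast
  let ?y = "crossing x"
  have y: "?y \<in> Y"
    using crossing_mem x(1) by blast
  have link_rev: "linked X \<tau> (\<rho> u) (\<rho> v)" if "linked X \<tau> u v" for u v
    using that by (rule linked_map) (metis rev \<rho>_X linked_step linked_sym)
  have "linked X \<tau> (\<rho> x) (\<tau>2 (\<delta> (turn ?y)))"
    using link_rev[OF linked_enter2_crossing[OF x(1)]] linked_\<rho>_enter2[OF y] linked_sym linked_trans
    by metis
  \<comment> \<open>The crossing of the state entering X2 at \<open>turn ?y\<close> is already one
    application of M further; the next line steps back along the cycle.\<close>
  then have "linked Y M (crossing (\<rho> x)) (M (turn ?y))"
    using linked_crossing crossing_enter2[OF turn_mem[OF y]] by fastforce
  then have 1: "linked Y M (turn ?y) (crossing (\<rho> x))"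
    by (rule linked_trans[OF linked_step[OF turn_mem[OF y]] linked_sym])
  have "linked Y M ?y z \<or> linked Y M (turn ?y) z" if z: "z \<in> Y" for z
  proof -
    \<comment> \<open>Likewise the state entering X2 at z has crossing \<open>M z\<close>, which
      lies on the cycle of z.\<close>
    have "linked Y M ?y (M z) \<or> linked Y M (crossing (\<rho> x)) (M z)"
      using x(2)[of "\<tau>2 (\<delta> z)"] enter2[OF z] linked_crossing[of _ "\<tau>2 (\<delta> z)"]
        crossing_enter2[OF z] by auto
    then show ?thesis
      using linked_trans[OF 1, of "M z"] linked_sym[OF linked_step[OF z, of M]]
        linked_trans[of Y M _ "M z" z] by blast
  qed
  then show "knotted Y M turn"
    unfolding knotted_def using y by blast
next
  assume "knotted Y M turn"
  then obtain y where y: "y \<in> Y" "\<And>z. z \<in> Y \<Longrightarrow> linked Y M y z \<or> linked Y M (turn y) z"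
    unfolding knotted_def by blast
  let ?x = "\<tau>2 (\<delta> y)"
  have "linked X \<tau> ?x u \<or> linked X \<tau> (\<rho> ?x) u" if u: "u \<in> X" for u
  proof -
    have "linked X \<tau> ?x (\<tau>2 (\<delta> (crossing u))) \<or> linked X \<tau> (\<tau>2 (\<delta> (turn y))) (\<tau>2 (\<delta> (crossing u)))"
      using y(2)[OF crossing_mem[OF u]] linked_enter2 turn_mem y(1) by blast
    then show ?thesis
      using linked_\<rho>_enter2[OF y(1)] linked_enter2_crossing[OF u] linked_sym linked_trans by metis
  qed
  moreover have "?x \<in> X"
    using enter2[OF y(1)] by blast
  ultimately show "knotted X \<tau> \<rho>"
    unfolding knotted_def by blast
qed

end

section \<open>Triangle complexes\<close>
definition flags :: "'v set set \<Rightarrow> ('v \<times> 'v \<times> 'v) set" where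
  "flags T = {(a, b, c). a \<noteq> b \<and> b \<noteq> c \<and> a \<noteq> c \<and> {a, b, c} \<in> T}"

text \<open>The uniqueness clause expresses that each edge of a triangle lies in exactly two
  triangles.\<close>

definition triangle_complex :: "'v set set \<Rightarrow> bool" where
  "triangle_complex T \<longleftrightarrow> finite T \<and> (\<forall>t\<in>T. card t = 3) \<and>
     (\<forall>a b c. (a, b, c) \<in> flags T \<longrightarrow> (\<exists>!d. d \<noteq> a \<and> (b, c, d) \<in> flags T))"

definition advance :: "'v set set \<Rightarrow> 'v \<times> 'v \<times> 'v \<Rightarrow> 'v \<times> 'v \<times> 'v" where
  "advance T = (\<lambda>(a, b, c). (b, c, THE d. d \<noteq> a \<and> (b, c, d) \<in> flags T))"

definition reverse :: "'v \<times> 'v \<times> 'v \<Rightarrow> 'v \<times> 'v \<times> 'v" where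
  "reverse = (\<lambda>(a, b, c). (c, b, a))"

text \<open>The instance of \<delta>: the flag of the same triangle that ends with the oriented edge
  ab with which \<open>(a, b, c)\<close> begins.\<close>

definition backshift :: "'v \<times> 'v \<times> 'v \<Rightarrow> 'v \<times> 'v \<times> 'v" where
  "backshift = (\<lambda>(a, b, c). (c, a, b))"

lemma reverse_simp [simp]: "reverse (a, b, c) = (c, b, a)"
  by (simp add: reverse_def)

lemma backshift_simp [simp]: "backshift (a, b, c) = (c, a, b)"
  by (simp add: backshift_def)

lemma flags_iff: "(a, b, c) \<in> flags T \<longleftrightarrow> a \<noteq> b \<and> b \<noteq> c \<and> a \<noteq> c \<and> {a, b, c} \<in> T"
  by (simp add: flags_def)

lemma flags_permute:
  assumes "(a, b, c) \<in> flags T"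
  shows "(b, c, a) \<in> flags T" "(c, a, b) \<in> flags T" "(c, b, a) \<in> flags T"
    "(b, a, c) \<in> flags T" "(a, c, b) \<in> flags T"
  using assms by (auto simp: flags_iff insert_commute)

lemma reverse_mem: "x \<in> flags T \<Longrightarrow> reverse x \<in> flags T"
  by (cases x) (auto intro: flags_permute)

lemma backshift_mem: "x \<in> flags T \<Longrightarrow> backshift x \<in> flags T"
  by (cases x) (auto intro: flags_permute)

lemma finite_flags:
  assumes "triangle_complex T"
  shows "finite (flags T)"
proof -
  have "finite (\<Union>T)"
    using assms unfolding triangle_complex_def by (metis card.infinite finite_Union zero_neq_numeral)
  moreover have "flags T \<subseteq> \<Union>T \<times> \<Union>T \<times> \<Union>T"
    by (auto simp: flags_def)
  ultimately show ?thesis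
    by (meson finite_SigmaI finite_subset)
qed

lemma advance_ex1:
  "triangle_complex T \<Longrightarrow> (a, b, c) \<in> flags T \<Longrightarrow> \<exists>!d. d \<noteq> a \<and> (b, c, d) \<in> flags T"
  by (simp add: triangle_complex_def)

lemma advanceE:
  assumes "triangle_complex T" "(a, b, c) \<in> flags T"
  obtains d where "advance T (a, b, c) = (b, c, d)" "d \<noteq> a" "(b, c, d) \<in> flags T"
  using theI'[OF advance_ex1[OF assms]] by (auto simp: advance_def)

lemma advance_eqI:
  assumes "triangle_complex T" "(a, b, c) \<in> flags T" "d \<noteq> a" "(b, c, d) \<in> flags T"
  shows "advance T (a, b, c) = (b, c, d)"
  using the1_equality[OF advance_ex1[OF assms(1,2)]] assms(3,4) by (simp add: advance_def)

lemma advance_mem: "triangle_complex T \<Longrightarrow> x \<in> flags T \<Longrightarrow> advance T x \<in> flags T"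
  by (metis advanceE prod_cases3)

lemma advance_not_same_triangle:
  assumes "triangle_complex T" "(a, b, c) \<in> flags T"
  shows "advance T (a, b, c) \<notin> flags {{a, b, c}}"
proof -
  obtain d where "advance T (a, b, c) = (b, c, d)" "d \<noteq> a" "(b, c, d) \<in> flags T"
    using advanceE[OF assms] .
  then show ?thesis
    using assms(2) by (auto simp: flags_iff)
qed

lemma reversible_flags:
  assumes T: "triangle_complex T"
  shows "reversible (flags T) (advance T) reverse"
proof
  show "finite (flags T)"
    by (rule finite_flags[OF T])
next
  fix x :: "'a \<times> 'a \<times> 'a"
  obtain a b c where x: "x = (a, b, c)"
    by (metis prod_cases3)
  show "reverse (reverse x) = x"
    by (simp add: x)
  assume mem: "x \<in> flags T"
  show "advance T x \<in> flags T" "reverse x \<in> flags T"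
    by (simp_all add: mem advance_mem[OF T] reverse_mem)
  obtain d where d: "advance T (a, b, c) = (b, c, d)" "d \<noteq> a" "(b, c, d) \<in> flags T"
    using advanceE T mem x by metis
  have "advance T (d, c, b) = (c, b, a)"
    using d mem x by (intro advance_eqI[OF T]) (auto intro: flags_permute)
  then show "advance T (reverse (advance T x)) = reverse x"
    using d by (simp add: x)
  show "reverse x \<noteq> x"
    using mem by (simp add: x flags_iff)
  show "advance T x \<noteq> reverse x"
    using mem d by (simp add: x flags_iff)
qed

lemma flags_singleton_iff:
  assumes "(a, b, c) \<in> flags {t}"
  shows "x \<in> flags {t} \<longleftrightarrow>
    x \<in> {(a, b, c), (b, c, a), (c, a, b), (b, a, c), (c, b, a), (a, c, b)}"
proof
  assume x: "x \<in> flags {t}"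
  obtain p q r where pqr: "x = (p, q, r)"
    by (metis prod_cases3)
  have "p \<in> {a, b, c}" "q \<in> {a, b, c}" "r \<in> {a, b, c}" "p \<noteq> q" "q \<noteq> r" "p \<noteq> r"
    using x assms pqr by (auto simp: flags_iff simp del: insert_iff)
  then show "x \<in> {(a, b, c), (b, c, a), (c, a, b), (b, a, c), (c, b, a), (a, c, b)}"
    unfolding pqr by (elim insertE emptyE) simp_all
qed (use assms flags_permute[OF assms] in auto)

text \<open>Knottedness yields \<open>meets_Y\<close>: one cycle and its reversal contain all flags,
  and the flags of t are closed under reversal.\<close>

lemma reversible_section_flags:
  assumes T: "triangle_complex T" and t: "t \<in> T"
    and knot: "knotted (flags T) (advance T) reverse"
  shows "reversible_section (flags T) (advance T) reverse (flags {t}) backshift"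
proof -
  interpret reversible "flags T" "advance T" reverse
    by (rule reversible_flags[OF T])
  have sub: "flags {t} \<subseteq> flags T"
    using t by (auto simp: flags_def)
  show ?thesis
  proof
    fix y assume y: "y \<in> flags {t}"
    obtain a b c where abc: "y = (a, b, c)"
      by (metis prod_cases3)
    show "reverse y \<in> flags {t}" "backshift y \<in> flags {t}"
      using y by (simp_all add: reverse_mem backshift_mem)
    show "backshift (reverse (backshift y)) = reverse y"
      by (simp add: abc)
    show "advance T y \<notin> flags {t}"
      using advance_not_same_triangle[OF T, of a b c] y abc sub t by (auto simp: flags_iff)
  next
    fix x assume x: "x \<in> flags T"
    obtain z where z: "\<And>y. y \<in> flags T \<Longrightarrow>
        linked (flags T) (advance T) z y \<or> linked (flags T) (advance T) (reverse z) y"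
      using knot unfolding knotted_def by blast
    have "card t = 3"
      using T t by (simp add: triangle_complex_def)
    then obtain a b c where "t = {a, b, c}" "a \<noteq> b" "a \<noteq> c" "b \<noteq> c"
      by (auto simp: card_3_iff)
    then have y: "(a, b, c) \<in> flags {t}"
      by (simp add: flags_iff)
    have ry: "reverse (a, b, c) \<in> flags {t}"
      using y reverse_mem by blast
    have rev: "linked (flags T) (advance T) (reverse u) v \<longleftrightarrow> linked (flags T) (advance T) u (reverse v)"
      for u v
      using linked_\<rho> \<rho>_\<rho> by metis
    show "\<exists>y\<in>flags {t}. linked (flags T) (advance T) x y"
      \<comment> \<open>Both x and the chosen flag of t lie on the cycle of z or on that of its
        reversal; if they lie on different ones, the reversed flag of t is on the cycle of
        x.\<close>
      using z[OF x] z[of "(a, b, c)"] y ry sub rev linked_sym linked_trans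
      by (smt (verit, ccfv_threshold) \<rho>_\<rho> subsetD)
  qed (use sub in auto)
qed

abbreviation monodromy :: "'v set set \<Rightarrow> 'v set \<Rightarrow> 'v \<times> 'v \<times> 'v \<Rightarrow> 'v \<times> 'v \<times> 'v" where
  "monodromy T t \<equiv> reversible_section.passage (advance T) (flags {t}) backshift"

section \<open>Connected sums of triangle complexes\<close>

locale glued_complexes =
  fixes T1 T2 :: "'v set set" and t :: "'v set"
  assumes T1: "triangle_complex T1" and T2: "triangle_complex T2"
    and common: "T1 \<inter> T2 = {t}" and common_vertices: "\<Union>T1 \<inter> \<Union>T2 = t"
begin

abbreviation "T \<equiv> (T1 \<union> T2) - {t}"

lemma flags_Un: "flags T = (flags T1 \<union> flags T2) - flags {t}"
  by (auto simp: flags_def)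

lemma flags_Int: "flags T1 \<inter> flags T2 = flags {t}"
proof (rule set_eqI)
  fix x :: "'v \<times> 'v \<times> 'v"
  obtain a b c where x: "x = (a, b, c)"
    by (metis prod_cases3)
  have "{a, b, c} \<in> T1 \<and> {a, b, c} \<in> T2 \<longleftrightarrow> {a, b, c} = t"
    using common by (metis Int_iff singleton_iff)
  then show "x \<in> flags T1 \<inter> flags T2 \<longleftrightarrow> x \<in> flags {t}"
    unfolding x Int_iff flags_iff by (metis singleton_iff)
qed

lemma swap: "glued_complexes T2 T1 t"
  by unfold_locales (use T1 T2 common common_vertices in auto)

text \<open>If the neighbour of abc across bc is the removed triangle t, then its replacement is the
  triangle of T2 on the far side of bc; \<open>backshift\<close> presents t as the flag
  \<open>(d, b, c)\<close> from which T2 steps across bc. Existence and uniqueness are obtained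
  along with the value, so that \<open>complex_sum\<close> and \<open>advance_sum\<close> both
  follow.\<close>

lemma advance_sum_step:
  assumes "(a, b, c) \<in> flags T1 - flags {t}"
  shows "\<exists>e. e \<noteq> a \<and> (b, c, e) \<in> flags T \<and> (\<forall>d. d \<noteq> a \<longrightarrow> (b, c, d) \<in> flags T \<longrightarrow> d = e) \<and>
    (if advance T1 (a, b, c) \<in> flags {t} then advance T2 (backshift (advance T1 (a, b, c)))
       else advance T1 (a, b, c)) = (b, c, e)"
proof -
  obtain d where d: "advance T1 (a, b, c) = (b, c, d)" "d \<noteq> a" "(b, c, d) \<in> flags T1"
    using advanceE[OF T1 DiffD1[OF assms]] .
  have uniq1: "d' = d" if "d' \<noteq> a" "(b, c, d') \<in> flags T1" for d'
    using advance_eqI[OF T1 _ that] d assms by auto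
  \<comment> \<open>Otherwise a would be a vertex of both complexes, hence of t, and abc would be t
    itself.\<close>
  have a: "a \<notin> \<Union>T2" if "b \<in> t" "c \<in> t"
  proof
    assume "a \<in> \<Union>T2"
    then have "a \<in> t"
      using assms common_vertices by (auto simp: flags_iff)
    moreover have "card t = 3"
      using T1 common by (auto simp: triangle_complex_def)
    ultimately have "t = {a, b, c}"
      using that assms card_subset_eq[of t "{a, b, c}"]
      by (auto simp: flags_iff card_insert_if card_ge_0_finite)
    then show False
      using assms by (auto simp: flags_iff)
  qed
  have t_of_both: "b \<in> t \<and> c \<in> t" if "(b, c, d') \<in> flags T2" for d'
    using that assms common_vertices by (auto simp: flags_iff)
  \<comment> \<open>An edge bc of t has only the two triangles abc and t in T1.\<close>
  have tri_t: "(b, c, d) \<in> flags {t}" if bc: "b \<in> t" "c \<in> t"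
  proof -
    have "card t = 3"
      using T1 common by (auto simp: triangle_complex_def)
    then obtain w where w: "t = {b, c, w}" "w \<noteq> b" "w \<noteq> c"
      using bc assms by (auto simp: card_3_iff flags_iff)
    have "t \<in> T1"
      using common by blast
    then have "(b, c, w) \<in> flags T1"
      using w assms by (auto simp: flags_iff)
    moreover have "w \<noteq> a"
      using a[OF bc] w common by auto
    ultimately show ?thesis
      using uniq1 w by (auto simp: flags_iff d)
  qed
  show ?thesis
  proof (cases "(b, c, d) \<in> flags {t}")
    case False
    have uniq: "d' = d" if "d' \<noteq> a" "(b, c, d') \<in> flags T" for d'
    proof (rule uniq1[OF that(1)])
      have "(b, c, d') \<notin> flags T2"
        using t_of_both tri_t False by blast
      then show "(b, c, d') \<in> flags T1"
        using that(2) flags_Un by blast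
    qed
    have "(b, c, d) \<in> flags T"
      using d(3) False flags_Un by blast
    moreover have "(if advance T1 (a, b, c) \<in> flags {t} then advance T2 (backshift (advance T1 (a, b, c)))
       else advance T1 (a, b, c)) = (b, c, d)"
      by (simp only: d(1) False if_False)
    ultimately show ?thesis
      using d(2) uniq by blast
  next
    case True
    then have "(b, c, d) \<in> flags T2"
      using flags_Int by blast
    then have dbc: "(d, b, c) \<in> flags T2"
      by (rule flags_permute)
    obtain e where e: "advance T2 (d, b, c) = (b, c, e)" "e \<noteq> d" "(b, c, e) \<in> flags T2"
      using advanceE[OF T2 dbc] .
    have "(b, c, e) \<notin> flags {t}"
    proof
      assume "(b, c, e) \<in> flags {t}"
      then have "{b, c, e} = {b, c, d}" "e \<noteq> b" "e \<noteq> c"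
        using True by (auto simp: flags_iff simp del: insert_iff)
      then show False
        using e(2) by blast
    qed
    then have mem: "(b, c, e) \<in> flags T"
      using e(3) flags_Un by blast
    have neq: "e \<noteq> a"
    proof
      assume "e = a"
      moreover have "e \<in> \<Union>T2"
        using e(3) unfolding flags_iff by blast
      moreover have "b \<in> t" "c \<in> t"
        using t_of_both e(3) by blast+
      ultimately show False
        using a by blast
    qed
    have uniq: "d' = e" if "d' \<noteq> a" "(b, c, d') \<in> flags T" for d'
    proof -
      have "d' \<noteq> d"
        using that(2) True flags_Un by blast
      then have "(b, c, d') \<in> flags T2"
        using that uniq1 flags_Un by blast
      then show ?thesis
        using advance_eqI[OF T2 dbc \<open>d' \<noteq> d\<close>] e(1) by simp
    qed
    have "(if advance T1 (a, b, c) \<in> flags {t} then advance T2 (backshift (advance T1 (a, b, c)))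
       else advance T1 (a, b, c)) = (b, c, e)"
      by (simp only: d(1) e(1) True if_True backshift_simp)
    then show ?thesis
      using mem neq uniq by blast
  qed
qed

lemma complex_sum: "triangle_complex T"
proof -
  interpret S: glued_complexes T2 T1 t
    by (rule swap)
  have S: "(T2 \<union> T1) - {t} = T"
    by blast
  have "\<exists>!d. d \<noteq> a \<and> (b, c, d) \<in> flags T" if "(a, b, c) \<in> flags T" for a b c
  proof -
    consider "(a, b, c) \<in> flags T1 - flags {t}" | "(a, b, c) \<in> flags T2 - flags {t}"
      using \<open>(a, b, c) \<in> flags T\<close> flags_Un by blast
    then show ?thesis
      by cases (use advance_sum_step S.advance_sum_step[unfolded S] in metis)+
  qed
  then show ?thesis
    using T1 T2 unfolding triangle_complex_def by blast
qed

lemma advance_sum: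
  assumes "x \<in> flags T1 - flags {t}"
  shows "advance T x = (if advance T1 x \<in> flags {t} then advance T2 (backshift (advance T1 x))
    else advance T1 x)"
proof -
  obtain a b c where x: "x = (a, b, c)"
    by (metis prod_cases3)
  obtain e where e: "e \<noteq> a" "(b, c, e) \<in> flags T"
    "(if advance T1 x \<in> flags {t} then advance T2 (backshift (advance T1 x))
       else advance T1 x) = (b, c, e)"
    using advance_sum_step assms unfolding x by blast
  have "(a, b, c) \<in> flags T"
    using assms flags_Un x by blast
  from advance_eqI[OF complex_sum this e(1,2)] e(3) show ?thesis
    by (simp only: x)
qed

lemma glued_sections_flags:
  assumes "knotted (flags T1) (advance T1) reverse" "knotted (flags T2) (advance T2) reverse"
  shows "glued_sections (flags T1) (flags T2) (advance T1) (advance T2) reverse (flags {t})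
    backshift (advance T)"
proof -
  interpret S: glued_complexes T2 T1 t
    by (rule swap)
  interpret A: reversible_section "flags T1" "advance T1" reverse "flags {t}" backshift
    using reversible_section_flags[OF T1 _ assms(1)] common by blast
  interpret B: reversible_section "flags T2" "advance T2" reverse "flags {t}" backshift
    using reversible_section_flags[OF T2 _ assms(2)] common by blast
  show ?thesis
  proof unfold_locales
    show "flags T1 \<inter> flags T2 = flags {t}"
      by (rule flags_Int)
  next
    fix x assume "x \<in> flags T1 - flags {t}"
    then show "advance T x = (if advance T1 x \<in> flags {t} then advance T2 (backshift (advance T1 x))
      else advance T1 x)"
      by (rule advance_sum)
  next
    fix x assume "x \<in> flags T2 - flags {t}"
    then show "advance T x = (if advance T2 x \<in> flags {t} then advance T1 (backshift (advance T2 x))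
      else advance T2 x)"
      using S.advance_sum by (simp add: Un_commute)
  qed
qed

theorem knotted_sum_iff:
  assumes "knotted (flags T1) (advance T1) reverse" "knotted (flags T2) (advance T2) reverse"
  shows "knotted (flags T) (advance T) reverse \<longleftrightarrow>
    knotted (flags {t}) (\<lambda>y. monodromy T1 t (monodromy T2 t y))
      (\<lambda>y. reverse (backshift (monodromy T2 t y)))"
proof -
  interpret G: glued_sections "flags T1" "flags T2" "advance T1" "advance T2" reverse "flags {t}"
    backshift "advance T"
    by (rule glued_sections_flags[OF assms])
  interpret R: reversible "flags T" "advance T" reverse
    by (rule reversible_flags[OF complex_sum])
  have "knotted (flags T) (advance T) reverse \<longleftrightarrow> knotted (flags {t}) G.M G.turn"
    using G.knotted_glued_iff R.\<tau>_\<rho> R.\<tau>_mem unfolding flags_Un by blast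
  moreover have "G.turn = (\<lambda>y. reverse (backshift (monodromy T2 t y)))"
    by (rule ext) (simp add: G.turn_def G.B.flip_def)
  ultimately show ?thesis
    by simp
qed

end

section \<open>Six flags\<close>

text \<open>The flag \<open>(a, b, c)\<close> stands for its first oriented edge \<open>ab\<close>: the numbers 0, 1, 2 are the
  oriented edges of one cycle of the face, and \<open>i + 3\<close> is the reverse of \<open>i\<close>.\<close>

definition flag_of :: "'v \<times> 'v \<times> 'v \<Rightarrow> nat \<Rightarrow> 'v \<times> 'v \<times> 'v" where
  "flag_of = (\<lambda>(a, b, c) i. [(a, b, c), (b, c, a), (c, a, b), (b, a, c), (c, b, a), (a, c, b)] ! i)"

definition acts_as :: "'v \<times> 'v \<times> 'v \<Rightarrow> ('v \<times> 'v \<times> 'v \<Rightarrow> 'v \<times> 'v \<times> 'v) \<Rightarrow> nat list \<Rightarrow> bool" where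
  "acts_as y m L \<longleftrightarrow> (\<forall>i<6. m (flag_of y i) = flag_of y (L ! i))"

text \<open>With e1 = 0, e2 = 1, e3 = 2 and negation exchanging i and i + 3, the lists are images of
  0, ..., 5: \<open>rot6\<close> is (0,1,2)(5,4,3), the rotation of the face, \<open>M3_6\<close> is
  (3,1,2)(5,4,0), and \<open>M4_6\<close> is (0,4)(1,3).\<close>

definition neg6 :: "nat list" where "neg6 = [3, 4, 5, 0, 1, 2]"
definition rot6 :: "nat list" where "rot6 = [1, 2, 0, 5, 3, 4]"
definition id6 :: "nat list" where "id6 = [0, 1, 2, 3, 4, 5]"
definition M3_6 :: "nat list" where "M3_6 = [5, 2, 3, 1, 0, 4]"
definition M4_6 :: "nat list" where "M4_6 = [4, 3, 2, 1, 0, 5]"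

definition comp6 :: "nat list \<Rightarrow> nat list \<Rightarrow> nat list" where
  "comp6 K L = map (\<lambda>i. K ! (L ! i)) [0..<6]"

definition orbit6 :: "nat list \<Rightarrow> nat \<Rightarrow> nat list" where
  "orbit6 L x = [x, L ! x, L ! (L ! x), L ! (L ! (L ! x)), L ! (L ! (L ! (L ! x))),
    L ! (L ! (L ! (L ! (L ! x))))]"

text \<open>The second clause closes each list of iterates under forward and backward steps, which
  identifies it with a class of \<open>linked\<close>. Both clauses can be evaluated.\<close>

definition perm6 :: "nat list \<Rightarrow> bool" where
  "perm6 L \<longleftrightarrow> list_all (\<lambda>x. L ! x < 6) [0..<6] \<and>
     list_all (\<lambda>x. list_all (\<lambda>y. (L ! y \<in> set (orbit6 L x)) = (y \<in> set (orbit6 L x))) [0..<6]) [0..<6]"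

definition knotted6 :: "nat list \<Rightarrow> nat list \<Rightarrow> bool" where
  "knotted6 L r \<longleftrightarrow> list_ex (\<lambda>x. list_all (\<lambda>y. y \<in> set (orbit6 L x) \<or> y \<in> set (orbit6 L (r ! x)))
     [0..<6]) [0..<6]"

lemma linked_perm6:
  assumes "perm6 L" "x < 6" "y < 6"
  shows "linked {..<6} (\<lambda>i. L ! i) x y \<longleftrightarrow> y \<in> set (orbit6 L x)"
proof
  have bound: "\<And>x. x < 6 \<Longrightarrow> L ! x < 6"
    and inv: "\<And>x y. x < 6 \<Longrightarrow> y < 6 \<Longrightarrow> L ! y \<in> set (orbit6 L x) \<longleftrightarrow> y \<in> set (orbit6 L x)"
    using assms(1) by (auto simp: perm6_def list_all_iff)
  {
    assume "linked {..<6} (\<lambda>i. L ! i) x y"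
    then have "x \<in> set (orbit6 L x) \<longleftrightarrow> y \<in> set (orbit6 L x)"
      by (rule linked_invariant) (use inv assms in auto)
    then show "y \<in> set (orbit6 L x)"
      by (simp add: orbit6_def)
  }
  assume "y \<in> set (orbit6 L x)"
  moreover have "linked {..<6} (\<lambda>i. L ! i) x (L ! z)" if "linked {..<6} (\<lambda>i. L ! i) x z" "z < 6" for z
    using that linked_step[of z "{..<6}" "\<lambda>i. L ! i"] linked_trans by fastforce
  ultimately show "linked {..<6} (\<lambda>i. L ! i) x y"
    using bound assms(2) by (auto simp: orbit6_def)
qed

lemma knotted_transfer:
  assumes bij: "bij_betw f A B"
    and N: "\<And>i. i \<in> A \<Longrightarrow> N' i \<in> A" "\<And>i. i \<in> A \<Longrightarrow> N (f i) = f (N' i)"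
    and r: "\<And>i. i \<in> A \<Longrightarrow> r' i \<in> A" "\<And>i. i \<in> A \<Longrightarrow> r (f i) = f (r' i)"
  shows "knotted B N r \<longleftrightarrow> knotted A N' r'"
proof -
  have eq: "linked B N (f x) (f y) \<longleftrightarrow> linked A N' x y" if x: "x \<in> A" and y: "y \<in> A" for x y
  proof
    assume "linked A N' x y"
    then show "linked B N (f x) (f y)"
      by (rule linked_map) (metis N(2) bij bij_betw_apply linked_step)
  next
    define h where "h = inv_into A f"
    have h: "h (f i) = i" if "i \<in> A" for i
      using bij that by (simp add: h_def bij_betw_def)
    assume "linked B N (f x) (f y)"
    then have "linked A N' (h (f x)) (h (f y))"
    proof (rule linked_map)
      fix z assume "z \<in> B"
      then obtain i where i: "i \<in> A" "z = f i"
        using bij by (auto simp: bij_betw_def)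
      then show "linked A N' (h z) (h (N z))"
        using N h linked_step by metis
    qed
    then show "linked A N' x y"
      using h x y by simp
  qed
  have B: "B = f ` A"
    using bij by (simp add: bij_betw_def)
  show ?thesis
    using eq r unfolding knotted_def B by simp
qed

lemma less6_cases: "i < 6 \<longleftrightarrow> i = 0 \<or> i = 1 \<or> i = 2 \<or> i = 3 \<or> i = 4 \<or> i = (5::nat)"
  by auto

lemma flag_of_simps [simp]:
  "flag_of (a, b, c) 0 = (a, b, c)" "flag_of (a, b, c) 1 = (b, c, a)"
  "flag_of (a, b, c) (Suc 0) = (b, c, a)"
  "flag_of (a, b, c) 2 = (c, a, b)" "flag_of (a, b, c) 3 = (b, a, c)"
  "flag_of (a, b, c) 4 = (c, b, a)" "flag_of (a, b, c) 5 = (a, c, b)"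
  by (simp_all add: flag_of_def)

lemma bij_betw_flag_of:
  assumes "y \<in> flags {t}"
  shows "bij_betw (flag_of y) {..<6} (flags {t})"
proof -
  obtain a b c where y: "y = (a, b, c)"
    by (metis prod_cases3)
  have eq: "{..<6} = {0, 1, 2, 3, 4, 5::nat}"
    by auto
  have abc: "(a, b, c) \<in> flags {t}"
    using assms y by simp
  have "flag_of y ` {..<6} = {(a, b, c), (b, c, a), (c, a, b), (b, a, c), (c, b, a), (a, c, b)}"
    unfolding eq y by (simp only: image_insert image_empty flag_of_simps)
  also have "\<dots> = flags {t}"
    by (rule set_eqI) (simp only: flags_singleton_iff[OF abc])
  finally have "flag_of y ` {..<6} = flags {t}" .
  moreover have "a \<noteq> b" "b \<noteq> c" "a \<noteq> c"
    using abc unfolding flags_iff by blast+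
  then have "inj_on (flag_of y) {..<6}"
    unfolding eq y by simp
  ultimately show ?thesis
    by (simp add: bij_betw_def)
qed

lemma knotted_iff_knotted6:
  assumes "y \<in> flags {t}" "perm6 L" "\<And>i. i < 6 \<Longrightarrow> r' ! i < 6"
    and "\<And>i. i < 6 \<Longrightarrow> N (flag_of y i) = flag_of y (L ! i)"
    and "\<And>i. i < 6 \<Longrightarrow> r (flag_of y i) = flag_of y (r' ! i)"
  shows "knotted (flags {t}) N r \<longleftrightarrow> knotted6 L r'"
proof -
  have "knotted (flags {t}) N r \<longleftrightarrow> knotted {..<6} (\<lambda>i. L ! i) (\<lambda>i. r' ! i)"
    by (rule knotted_transfer[OF bij_betw_flag_of[OF assms(1)]])
      (use assms in \<open>auto simp: perm6_def list_all_iff\<close>)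
  also have "\<dots> \<longleftrightarrow> knotted6 L r'"
    using linked_perm6[OF assms(2)] assms(3)
    unfolding knotted_def knotted6_def list_all_iff list_ex_iff set_upt lessThan_atLeast0 by simp
  finally show ?thesis .
qed

lemma flag_of_neg: "i < 6 \<Longrightarrow> reverse (backshift (flag_of y i)) = flag_of y (neg6 ! i)"
  by (cases y) (auto simp: less6_cases neg6_def)

lemma comp6_nth: "i < 6 \<Longrightarrow> comp6 K L ! i = K ! (L ! i)"
  by (simp add: comp6_def)

section \<open>Enumeration of the possible monodromies\<close>

definition valid6 :: "nat list \<Rightarrow> bool" where
  "valid6 xs \<longleftrightarrow> list_all (\<lambda>i. xs ! i \<noteq> i \<and> (xs ! i < length xs \<longrightarrow> xs ! (xs ! i) = i)) [0..<length xs]"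

text \<open>Images are assigned index by index and pruned by \<open>valid6\<close>, which constrains
  an image only once it lies within the prefix. At length 6 the fifteen fixed-point-free involutions
  remain.\<close>

primrec matchings6 :: "nat \<Rightarrow> nat list list" where
  "matchings6 0 = [[]]"
| "matchings6 (Suc k) = filter valid6 (concat (map (\<lambda>xs. map (\<lambda>v. xs @ [v]) [0..<6]) (matchings6 k)))"

lemma matching_mem:
  fixes r :: "nat \<Rightarrow> nat"
  assumes "\<And>i. i < 6 \<Longrightarrow> r i < 6" "\<And>i. i < 6 \<Longrightarrow> r i \<noteq> i" "\<And>i. i < 6 \<Longrightarrow> r (r i) = i"
  shows "k \<le> 6 \<Longrightarrow> map r [0..<k] \<in> set (matchings6 k)"
proof (induction k)
  case (Suc k)
  have "valid6 (map r [0..<Suc k])"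
    unfolding valid6_def list_all_iff using assms Suc.prems by (auto simp del: upt_Suc)
  moreover have "map r [0..<Suc k] = map r [0..<k] @ [r k]"
    by simp
  ultimately show ?case
    using Suc assms(1)[of k] by (auto simp del: upt_Suc intro!: bexI[of _ "map r [0..<k]"])
qed simp

text \<open>The involution r stands for the negated monodromy, so \<open>comp6 neg6 r\<close> is the
  monodromy itself. The composites are the first return map and the maps of the sums with a rotation
  and with the identity.\<close>

lemma matchings6_perm:
  "list_all (\<lambda>r. let L = comp6 neg6 r in
     perm6 L \<and> perm6 (comp6 L rot6) \<and> perm6 (comp6 rot6 L) \<and> perm6 (comp6 id6 L)) (matchings6 6)"
  by code_simp

text \<open>The premise is knottedness of the second triangulation, read on its face:
  \<open>comp6 L rot6\<close> is the first return map and \<open>comp6 neg6 rot6\<close> the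
  reversal of flags.\<close>

lemma matchings6_rot:
  "list_all (\<lambda>r. let L = comp6 neg6 r in
     knotted6 (comp6 L rot6) (comp6 neg6 rot6) \<longrightarrow> knotted6 (comp6 rot6 L) (comp6 neg6 L)) (matchings6 6)"
  by code_simp

text \<open>The last two lists are \<open>M3_6\<close> with e1 moved round its cycle, to ca and to
  bc. Replacing e1 by -e1 and the cycle by the opposite one gives the same permutation, so these are
  all the permutations of type (M3).\<close>

lemma matchings6_id:
  "list_all (\<lambda>r. let L = comp6 neg6 r in
     knotted6 (comp6 L rot6) (comp6 neg6 rot6) \<longrightarrow> knotted6 (comp6 id6 L) (comp6 neg6 L) \<longrightarrow>
       L \<in> set [rot6, M3_6, [1,5,4,2,3,0], [4,3,0,5,2,1]]) (matchings6 6)"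
  by code_simp

text \<open>The list s gives the old index of each new flag, and K is L conjugated by this
  renumbering.\<close>

lemma acts_as_relabel:
  assumes "acts_as y m L" "\<And>i. i < 6 \<Longrightarrow> flag_of y' i = flag_of y (s ! i)"
    and "list_all (\<lambda>i. s ! i < 6 \<and> K ! i < 6 \<and> L ! (s ! i) = s ! (K ! i)) [0..<6]"
  shows "acts_as y' m K"
  using assms unfolding acts_as_def list_all_iff by auto

text \<open>Exchanging b and c interchanges the two directions round the face; index i becomes 5 -
  i.\<close>

lemma flag_of_swap: "i < 6 \<Longrightarrow> flag_of (a, b, c) i = flag_of (a, c, b) ([5, 4, 3, 2, 1, 0] ! i)"
  by (auto simp: less6_cases)

lemma flag_of_mem: "y \<in> flags {t} \<Longrightarrow> i < 6 \<Longrightarrow> flag_of y i \<in> flags {t}"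
  using bij_betw_flag_of[of y t] by (auto simp: bij_betw_def)

lemma acts_as_matching:
  assumes y: "y \<in> flags {t}"
    and m: "\<And>x. x \<in> flags {t} \<Longrightarrow> m x \<in> flags {t}"
    and flip: "\<And>x. x \<in> flags {t} \<Longrightarrow> reverse (backshift (m x)) \<noteq> x"
      "\<And>x. x \<in> flags {t} \<Longrightarrow> reverse (backshift (m (reverse (backshift (m x))))) = x"
  obtains r where "r \<in> set (matchings6 6)" "acts_as y m (comp6 neg6 r)"
proof -
  define r where "r i = inv_into {..<6} (flag_of y) (reverse (backshift (m (flag_of y i))))" for i
  have flag_r: "flag_of y (r i) = reverse (backshift (m (flag_of y i)))" and r6: "r i < 6" if "i < 6" for i
  proof -
    have "reverse (backshift (m (flag_of y i))) \<in> flag_of y ` {..<6}"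
      using that bij_betw_flag_of[OF y] flag_of_mem[OF y] m
      by (simp add: bij_betw_def backshift_mem reverse_mem)
    then show "flag_of y (r i) = reverse (backshift (m (flag_of y i)))" "r i < 6"
      unfolding r_def by (rule f_inv_into_f, metis inv_into_into lessThan_iff)
  qed
  have inj: "i = j" if "flag_of y i = flag_of y j" "i < 6" "j < 6" for i j
    using bij_betw_flag_of[OF y] that by (auto simp: bij_betw_def inj_on_def)
  have "map r [0..<6] \<in> set (matchings6 6)"
  proof (rule matching_mem)
    fix i :: nat assume i: "i < 6"
    show "r i < 6"
      by (rule r6[OF i])
    show "r i \<noteq> i"
      using flag_r[OF i] flip(1)[OF flag_of_mem[OF y i]] by metis
    show "r (r i) = i"
      using flag_r[OF i] flag_r[OF r6[OF i]] flip(2)[OF flag_of_mem[OF y i]] inj r6 i by metis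
  qed simp
  \<comment> \<open>Negating once more recovers m from its involution.\<close>
  moreover have "m (flag_of y i) = flag_of y (neg6 ! r i)" if i: "i < 6" for i
  proof -
    have "reverse (backshift (flag_of y (r i))) = m (flag_of y i)"
      using flag_r[OF i] by (cases "m (flag_of y i)") simp
    then show ?thesis
      using flag_of_neg[OF r6[OF i]] by metis
  qed
  then have "acts_as y m (comp6 neg6 (map r [0..<6]))"
    by (simp add: acts_as_def comp6_nth)
  ultimately show thesis
    by (rule that)
qed

lemma acts_as_knotted:
  assumes T: "triangle_complex T" and t: "t \<in> T" and K: "knotted (flags T) (advance T) reverse"
    and y: "y \<in> flags {t}"
  obtains r where "r \<in> set (matchings6 6)" "acts_as y (monodromy T t) (comp6 neg6 r)"
    "knotted6 (comp6 (comp6 neg6 r) rot6) (comp6 neg6 rot6)"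
proof -
  interpret reversible_section "flags T" "advance T" reverse "flags {t}" backshift
    by (rule reversible_section_flags[OF T t K])
  obtain r where r: "r \<in> set (matchings6 6)" "acts_as y passage (comp6 neg6 r)"
    using acts_as_matching[OF y, of passage] passage_mem flip_passage_neq flip_passage_flip_passage
    unfolding flip_def by metis
  have "knotted (flags {t}) (\<lambda>y. hit (advance T y)) reverse \<longleftrightarrow>
      knotted6 (comp6 (comp6 neg6 r) rot6) (comp6 neg6 rot6)"
  proof (rule knotted_iff_knotted6[OF y])
    show "perm6 (comp6 (comp6 neg6 r) rot6)"
      using matchings6_perm r(1) by (auto simp: list_all_iff Let_def)
    fix i :: nat assume i: "i < 6"
    then have i': "rot6 ! i < 6"
      by (auto simp: less6_cases rot6_def)
    show "comp6 neg6 rot6 ! i < 6"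
      using i by (auto simp: less6_cases rot6_def neg6_def comp6_nth)
    \<comment> \<open>Since \<open>backshift\<close> undoes the rotation, the first return map is
      the monodromy applied after \<open>rot6\<close>.\<close>
    have "backshift (flag_of y (rot6 ! i)) = flag_of y i"
      using i by (cases y) (auto simp: less6_cases rot6_def)
    then have "hit (advance T (flag_of y i)) = passage (flag_of y (rot6 ! i))"
      unfolding passage_def by metis
    then show "hit (advance T (flag_of y i)) = flag_of y (comp6 (comp6 neg6 r) rot6 ! i)"
      using r(2) i i' by (simp add: acts_as_def comp6_nth)
    show "reverse (flag_of y i) = flag_of y (comp6 neg6 rot6 ! i)"
      using i by (cases y) (auto simp: less6_cases rot6_def neg6_def comp6_nth)
  qed
  then show thesis
    using that r knotted_return[OF K] by blast
qed

lemma matchings6_bound: "list_all (\<lambda>r. list_all (\<lambda>i. comp6 neg6 r ! i < 6) [0..<6]) (matchings6 6)"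
  by code_simp

section \<open>The finite checks for the connected sum\<close>

context glued_complexes
begin

context
  assumes K1: "knotted (flags T1) (advance T1) reverse" and K2: "knotted (flags T2) (advance T2) reverse"
begin

lemma knotted_sum_iff6:
  assumes y: "y \<in> flags {t}" and L1: "acts_as y (monodromy T1 t) L1" and L2: "acts_as y (monodromy T2 t) L2"
    and "perm6 (comp6 L1 L2)" and L2_bound: "list_all (\<lambda>i. L2 ! i < 6) [0..<6]"
  shows "knotted (flags T) (advance T) reverse \<longleftrightarrow> knotted6 (comp6 L1 L2) (comp6 neg6 L2)"
  unfolding knotted_sum_iff[OF K1 K2]
proof (rule knotted_iff_knotted6[OF y])
  fix i :: nat assume i: "i < 6"
  then have i': "L2 ! i < 6"
    using L2_bound by (simp add: list_all_iff)
  then show "comp6 neg6 L2 ! i < 6"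
    using i by (auto simp: comp6_nth less6_cases neg6_def)
  show "monodromy T1 t (monodromy T2 t (flag_of y i)) = flag_of y (comp6 L1 L2 ! i)"
    using L1 L2 i i' by (simp add: acts_as_def comp6_nth)
  show "reverse (backshift (monodromy T2 t (flag_of y i))) = flag_of y (comp6 neg6 L2 ! i)"
    using L2 i i' flag_of_neg by (simp add: acts_as_def comp6_nth)
qed fact

lemma second_monodromy:
  assumes "y \<in> flags {t}"
  obtains r where "r \<in> set (matchings6 6)" "acts_as y (monodromy T2 t) (comp6 neg6 r)"
    "knotted6 (comp6 (comp6 neg6 r) rot6) (comp6 neg6 rot6)"
  using acts_as_knotted[OF T2 _ K2 assms] common by blast

lemma knotted_sum_rotation:
  assumes y: "y \<in> flags {t}" and L1: "acts_as y (monodromy T1 t) rot6"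
  shows "knotted (flags T) (advance T) reverse"
proof -
  obtain r where r: "r \<in> set (matchings6 6)" "acts_as y (monodromy T2 t) (comp6 neg6 r)"
    "knotted6 (comp6 (comp6 neg6 r) rot6) (comp6 neg6 rot6)"
    using second_monodromy[OF y] .
  have "perm6 (comp6 rot6 (comp6 neg6 r))"
    using matchings6_perm r(1) by (auto simp: list_all_iff Let_def)
  moreover have "list_all (\<lambda>i. comp6 neg6 r ! i < 6) [0..<6]"
    using matchings6_bound r(1) by (simp add: list_all_iff)
  moreover have "knotted6 (comp6 rot6 (comp6 neg6 r)) (comp6 neg6 (comp6 neg6 r))"
    using matchings6_rot r(1,3) by (auto simp: list_all_iff Let_def)
  ultimately show ?thesis
    using knotted_sum_iff6[OF y L1 r(2)] by blast
qed

lemma knotted_sum_identity: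
  assumes y: "y \<in> flags {t}" and L1: "acts_as y (monodromy T1 t) id6"
    and K: "knotted (flags T) (advance T) reverse"
  shows "acts_as y (monodromy T2 t) rot6 \<or> (\<exists>y'\<in>flags {t}. acts_as y' (monodromy T2 t) M3_6)"
proof -
  obtain a b c where abc: "y = (a, b, c)"
    by (metis prod_cases3)
  obtain r where r: "r \<in> set (matchings6 6)" "acts_as y (monodromy T2 t) (comp6 neg6 r)"
    "knotted6 (comp6 (comp6 neg6 r) rot6) (comp6 neg6 rot6)"
    using second_monodromy[OF y] .
  have "perm6 (comp6 id6 (comp6 neg6 r))"
    using matchings6_perm r(1) by (auto simp: list_all_iff Let_def)
  moreover have "list_all (\<lambda>i. comp6 neg6 r ! i < 6) [0..<6]"
    using matchings6_bound r(1) by (simp add: list_all_iff)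
  ultimately have "knotted6 (comp6 id6 (comp6 neg6 r)) (comp6 neg6 (comp6 neg6 r))"
    using knotted_sum_iff6[OF y L1 r(2)] K by blast
  then consider "comp6 neg6 r = rot6" | "comp6 neg6 r = M3_6" | "comp6 neg6 r = [1,5,4,2,3,0]"
    | "comp6 neg6 r = [4,3,0,5,2,1]"
    using matchings6_id r(1,3) by (auto simp: list_all_iff Let_def)
  then show ?thesis
  proof cases
    case 1
    then show ?thesis using r(2) by simp
  next
    case 2
    then show ?thesis using r(2) y by auto
  next
    case 3
    \<comment> \<open>Here e1 is ca. The renumbering lists the positions of the flags of
      \<open>(c, a, b)\<close> among those of \<open>(a, b, c)\<close>; the remaining case is
      treated likewise with e1 = bc.\<close>
    have "acts_as (c, a, b) (monodromy T2 t) M3_6"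
    proof (rule acts_as_relabel[OF r(2)])
      show "flag_of (c, a, b) i = flag_of y ([2, 0, 1, 5, 3, 4] ! i)" if "i < 6" for i
        using that by (auto simp: less6_cases abc)
      show "list_all (\<lambda>i. [2, 0, 1, 5, 3, 4] ! i < (6::nat) \<and> M3_6 ! i < 6 \<and>
          comp6 neg6 r ! ([2, 0, 1, 5, 3, 4] ! i) = [2, 0, 1, 5, 3, 4] ! (M3_6 ! i)) [0..<6]"
        unfolding 3 by code_simp
    qed
    then show ?thesis
      using y abc flags_permute by metis
  next
    case 4
    have "acts_as (b, c, a) (monodromy T2 t) M3_6"
    proof (rule acts_as_relabel[OF r(2)])
      show "flag_of (b, c, a) i = flag_of y ([1, 2, 0, 4, 5, 3] ! i)" if "i < 6" for i
        using that by (auto simp: less6_cases abc)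
      show "list_all (\<lambda>i. [1, 2, 0, 4, 5, 3] ! i < (6::nat) \<and> M3_6 ! i < 6 \<and>
          comp6 neg6 r ! ([1, 2, 0, 4, 5, 3] ! i) = [1, 2, 0, 4, 5, 3] ! (M3_6 ! i)) [0..<6]"
        unfolding 4 by code_simp
    qed
    then show ?thesis
      using y abc flags_permute by metis
  qed
qed

text \<open>Both monodromies are in normal form for the same flag, that is, the gluing matches their
  distinguished labels.\<close>

lemma knotted_sum_aligned:
  assumes y: "y \<in> flags {t}" "acts_as y (monodromy T1 t) L1" "acts_as y (monodromy T2 t) L2"
    and L: "(L1, L2) \<in> {(id6, rot6), (id6, M3_6), (M3_6, M3_6)}"
  shows "knotted (flags T) (advance T) reverse"
proof -
  have "list_all (\<lambda>(L1, L2). perm6 (comp6 L1 L2) \<and> list_all (\<lambda>i. L2 ! i < 6) [0..<6] \<and>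
      knotted6 (comp6 L1 L2) (comp6 neg6 L2)) [(id6, rot6), (id6, M3_6), (M3_6, M3_6)]"
    by code_simp
  then have "perm6 (comp6 L1 L2)" "list_all (\<lambda>i. L2 ! i < 6) [0..<6]" "knotted6 (comp6 L1 L2) (comp6 neg6 L2)"
    using L unfolding list_all_iff by auto
  then show ?thesis
    using knotted_sum_iff6[OF y] by blast
qed

text \<open>Aligned labels fail for these pairs: \<open>M4_6\<close> is its own inverse, and the
  composites of \<open>M3_6\<close> with \<open>M4_6\<close> have only cycles of length at most 2,
  two of which cannot cover six flags. Hence the second normal form is taken with b and c
  exchanged.\<close>

lemma knotted_sum_swapped:
  assumes y: "(a, b, c) \<in> flags {t}" and L1: "acts_as (a, b, c) (monodromy T1 t) L1"
    and L2: "acts_as (a, c, b) (monodromy T2 t) L2"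
    and L: "(L1, L2) \<in> {(M3_6, M4_6), (M4_6, M3_6), (M4_6, M4_6)}"
  shows "knotted (flags T) (advance T) reverse"
proof -
  define s :: "nat list" where "s = [5, 4, 3, 2, 1, 0]"
  \<comment> \<open>The second monodromy renumbered for \<open>(a, b, c)\<close>; s is its own
    inverse.\<close>
  define K where "K = comp6 s (comp6 L2 s)"
  have all: "list_all (\<lambda>(L1, L2). let K = comp6 s (comp6 L2 s) in
      list_all (\<lambda>i. s ! i < 6 \<and> K ! i < 6 \<and> L2 ! (s ! i) = s ! (K ! i)) [0..<6] \<and>
      perm6 (comp6 L1 K) \<and> knotted6 (comp6 L1 K) (comp6 neg6 K))
    [(M3_6, M4_6), (M4_6, M3_6), (M4_6, M4_6)]"
    unfolding s_def by code_simp
  then have K: "list_all (\<lambda>i. s ! i < 6 \<and> K ! i < 6 \<and> L2 ! (s ! i) = s ! (K ! i)) [0..<6]"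
    "perm6 (comp6 L1 K)" "knotted6 (comp6 L1 K) (comp6 neg6 K)"
    using L unfolding list_all_iff K_def Let_def by auto
  have "acts_as (a, b, c) (monodromy T2 t) K"
    by (rule acts_as_relabel[OF L2 _ K(1)]) (simp add: s_def flag_of_swap)
  moreover have "list_all (\<lambda>i. K ! i < 6) [0..<6]"
    using K(1) by (simp add: list_all_iff)
  ultimately show ?thesis
    using knotted_sum_iff6[OF y L1] K(2,3) by blast
qed

end

end

section \<open>Zigzags as orbits of flags\<close>
text \<open>Negative times are obtained by running forward from the reversed state and reversing the
  result.\<close>

lemma (in reversible) ex_orbit:
  assumes "x \<in> X"
  shows "\<exists>s :: int \<Rightarrow> 'x. s 0 = x \<and> (\<forall>i. s i \<in> X \<and> s (i + 1) = \<tau> (s i))"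
proof -
  define s where "s i = (if i \<ge> 0 then (\<tau> ^^ nat i) x else \<rho> ((\<tau> ^^ nat (- i)) (\<rho> x)))" for i :: int
  have "s 0 = x"
    by (simp add: s_def)
  moreover have "s i \<in> X" for i
    using assms by (auto simp: s_def intro: funpow_mem \<rho>_mem)
  moreover have "s (i + 1) = \<tau> (s i)" for i
  proof (cases "i \<ge> 0")
    case True
    then have "nat (i + 1) = Suc (nat i)"
      by simp
    with True show ?thesis
      by (simp add: s_def)
  next
    case False
    then obtain n where i: "i = - int (Suc n)"
      by (cases i) auto
    \<comment> \<open>For n = 0 the left side is s 0, from the other branch of the definition; both
      branches agree there because \<rho> is an involution.\<close>
    have "s (i + 1) = \<rho> ((\<tau> ^^ n) (\<rho> x))"
      by (cases "n = 0") (auto simp: s_def i)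
    moreover have "s i = \<rho> (\<tau> ((\<tau> ^^ n) (\<rho> x)))"
      by (simp add: s_def i nat_add_distrib del: of_nat_Suc)
    ultimately show ?thesis
      using \<tau>_\<rho> funpow_mem \<rho>_mem[OF assms] by metis
  qed
  ultimately show ?thesis
    by blast
qed

text \<open>By injectivity of \<tau>, the range of a two-sided orbit is closed under predecessors as
  well as successors.\<close>

lemma (in reversible) linked_orbit_iff:
  assumes s: "\<And>i. s i \<in> X" "\<And>i :: int. s (i + 1) = \<tau> (s i)" and y: "y \<in> X"
  shows "linked X \<tau> (s i) y \<longleftrightarrow> (\<exists>j. s j = y)"
proof
  assume "linked X \<tau> (s i) y"
  then have "s i \<in> X \<and> (\<exists>j. s j = s i) \<longleftrightarrow> y \<in> X \<and> (\<exists>j. s j = y)"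
  proof (rule linked_invariant)
    fix x assume x: "x \<in> X"
    have "(\<exists>j. s j = \<tau> x) \<longleftrightarrow> (\<exists>j. s j = x)"
    proof
      assume "\<exists>j. s j = \<tau> x"
      then obtain j where "s (j - 1 + 1) = \<tau> x"
        by auto
      then have "s (j - 1) = x"
        using s inj_\<tau> x by (metis inj_onD)
      then show "\<exists>j. s j = x" ..
    qed (metis s(2))
    then show "\<tau> x \<in> X \<and> (\<exists>j. s j = \<tau> x) \<longleftrightarrow> x \<in> X \<and> (\<exists>j. s j = x)"
      using x \<tau>_mem by blast
  qed
  then show "\<exists>j. s j = y"
    using s(1) by blast
next
  have up: "linked X \<tau> (s i) (s (i + int n))" for i n
  proof (induction n)
    case (Suc n)
    have "linked X \<tau> (s (i + int n)) (s (i + int n + 1))"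
      using linked_step[OF s(1)] s(2) by metis
    with Suc linked_trans show ?case
      by (metis add.commute add.left_commute of_nat_Suc)
  qed simp
  assume "\<exists>j. s j = y"
  then obtain j where j: "s j = y" ..
  show "linked X \<tau> (s i) y"
  proof (cases "i \<le> j")
    case True
    then show ?thesis
      using up[of i "nat (j - i)"] j by simp
  next
    case False
    then show ?thesis
      using linked_sym[OF up[of j "nat (i - j)"]] j by simp
  qed
qed

lemma (in reversible) orbit_unique:
  assumes s: "\<And>i. s i \<in> X" "\<And>i :: int. s (i + 1) = \<tau> (s i)"
    and s': "\<And>i. s' i \<in> X" "\<And>i. s' (i + 1) = \<tau> (s' i)" and eq: "s k = s' l"
  shows "s (k + i) = s' (l + i)"
proof (induction i rule: int_induct[of _ 0])
  case base
  show ?case using eq by simp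
next
  case (step1 i)
  then show ?case
    using s(2) s'(2) by (metis add.assoc)
next
  case (step2 i)
  have "\<tau> (s (k + (i - 1))) = \<tau> (s' (l + (i - 1)))"
    using step2 s(2)[of "k + (i - 1)"] s'(2)[of "l + (i - 1)"] by (simp add: algebra_simps)
  then show ?case
    using inj_\<tau> s(1) s'(1) by (metis inj_onD)
qed

text \<open>The incidence facts that zigzags and monodromies depend on. The labelling l allows the
  vertices of two graphs to be compared inside one type, so that two summands can be glued as
  complexes.\<close>

locale graph_model =
  fixes G :: "'a embedded_graph" and l :: "'a \<Rightarrow> 'v"
  assumes inj_l: "inj_on l (verts G)"
    and edge_ends: "e \<in> edges G \<Longrightarrow> \<exists>a b. a \<noteq> b \<and> e \<inter> verts G = {a, b}"
    and simple_edges: "e \<in> edges G \<Longrightarrow> e' \<in> edges G \<Longrightarrow> e \<inter> verts G = e' \<inter> verts G \<Longrightarrow> e = e'"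
    and face_card: "F \<in> faces G \<Longrightarrow> card (F \<inter> verts G) = 3"
    and face_edge: "F \<in> faces G \<Longrightarrow> a \<in> F \<inter> verts G \<Longrightarrow> b \<in> F \<inter> verts G \<Longrightarrow> a \<noteq> b \<Longrightarrow>
      \<exists>e\<in>edges G. e \<inter> verts G = {a, b}"
    and simple_faces: "F \<in> faces G \<Longrightarrow> F' \<in> faces G \<Longrightarrow> F \<inter> verts G = F' \<inter> verts G \<Longrightarrow> F = F'"
    and incidence: "e \<in> edges G \<Longrightarrow> F \<in> faces G \<Longrightarrow> e \<subseteq> F \<longleftrightarrow> e \<inter> verts G \<subseteq> F"
    and complex: "triangle_complex ((\<lambda>F. l ` (F \<inter> verts G)) ` faces G)"
begin

abbreviation "T \<equiv> (\<lambda>F. l ` (F \<inter> verts G)) ` faces G"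

sublocale reversible "flags T" "advance T" reverse
  by (rule reversible_flags[OF complex])

definition flag :: "(int \<Rightarrow> 'a) \<Rightarrow> int \<Rightarrow> 'v \<times> 'v \<times> 'v" where
  "flag v i = (l (v i), l (v (i + 1)), l (v (i + 2)))"

definition walk :: "(int \<Rightarrow> 'a) \<Rightarrow> bool" where
  "walk v \<longleftrightarrow> (\<forall>i. v i \<in> verts G \<and> flag v i \<in> flags T \<and> flag v (i + 1) = advance T (flag v i))"

definition along :: "(int \<Rightarrow> 'a set) \<Rightarrow> (int \<Rightarrow> 'a) \<Rightarrow> bool" where
  "along e v \<longleftrightarrow> (\<forall>i. e i \<in> edges G \<and> e i \<inter> verts G = {v i, v (i + 1)})"

lemma along_ends: "along e v \<Longrightarrow> e i \<inter> verts G = {v i, v (i + 1)}"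
  by (simp add: along_def)

lemma l_eq_iff: "a \<in> verts G \<Longrightarrow> b \<in> verts G \<Longrightarrow> l a = l b \<longleftrightarrow> a = b"
  using inj_l by (auto dest: inj_onD)

lemma flags_T_iff:
  assumes "a \<in> verts G" "b \<in> verts G" "c \<in> verts G"
  shows "(l a, l b, l c) \<in> flags T \<longleftrightarrow>
    a \<noteq> b \<and> b \<noteq> c \<and> a \<noteq> c \<and> (\<exists>F\<in>faces G. F \<inter> verts G = {a, b, c})"
proof -
  have "l ` {a, b, c} = l ` (F \<inter> verts G) \<longleftrightarrow> {a, b, c} = F \<inter> verts G" for F
    by (rule inj_on_image_eq_iff[OF inj_l]) (use assms in auto)
  then have "{l a, l b, l c} \<in> T \<longleftrightarrow> (\<exists>F\<in>faces G. F \<inter> verts G = {a, b, c})"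
    unfolding image_iff by (simp only: image_insert image_empty) metis
  then show ?thesis
    using assms by (simp only: flags_iff l_eq_iff)
qed

lemma face_with:
  assumes "F \<in> faces G" "a \<in> F" "b \<in> F" "c \<in> F" "a \<in> verts G" "b \<in> verts G" "c \<in> verts G"
    "a \<noteq> b" "b \<noteq> c" "a \<noteq> c"
  shows "F \<inter> verts G = {a, b, c}"
proof -
  have "finite (F \<inter> verts G)"
    using face_card[OF assms(1)] by (metis card.infinite zero_neq_numeral)
  moreover have "card {a, b, c} = 3"
    using assms by simp
  ultimately show ?thesis
    using card_subset_eq[of "F \<inter> verts G" "{a, b, c}"] face_card[OF assms(1)] assms by auto
qed

text \<open>Distinct edges ab and bc have a and c distinct because the graph is simple; a common
  face then has exactly the vertices a, b, c.\<close>

lemma adjacent_iff: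
  assumes e: "e \<in> edges G" "e \<inter> verts G = {a, b}" and e': "e' \<in> edges G" "e' \<inter> verts G = {b, c}"
  shows "adjacent G e e' \<longleftrightarrow> (l a, l b, l c) \<in> flags T"
    and "F \<in> faces G \<Longrightarrow> (l a, l b, l c) \<in> flags T \<Longrightarrow> e \<subseteq> F \<and> e' \<subseteq> F \<longleftrightarrow> F \<inter> verts G = {a, b, c}"
proof -
  have ab: "a \<noteq> b" "b \<noteq> c"
    using edge_ends[OF e(1)] edge_ends[OF e'(1)] e(2) e'(2) by (auto simp: doubleton_eq_iff)
  have V: "a \<in> verts G" "b \<in> verts G" "c \<in> verts G"
    using e e' by auto
  have sub: "e \<subseteq> F \<longleftrightarrow> a \<in> F \<and> b \<in> F" "e' \<subseteq> F \<longleftrightarrow> b \<in> F \<and> c \<in> F" if "F \<in> faces G" for F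
    using incidence[OF e(1) that] incidence[OF e'(1) that] e(2) e'(2) by auto
  show *: "e \<subseteq> F \<and> e' \<subseteq> F \<longleftrightarrow> F \<inter> verts G = {a, b, c}"
    if "F \<in> faces G" "(l a, l b, l c) \<in> flags T" for F
    using sub[OF that(1)] face_with[OF that(1) _ _ _ V] flags_T_iff[OF V] that(2) by blast
  show "adjacent G e e' \<longleftrightarrow> (l a, l b, l c) \<in> flags T"
  proof
    assume adj: "adjacent G e e'"
    then have "a \<noteq> c"
      using e e' unfolding adjacent_def by (metis insert_commute simple_edges)
    obtain F where F: "F \<in> faces G" "e \<subseteq> F" "e' \<subseteq> F"
      using adj unfolding adjacent_def by blast
    then have "a \<in> F" "b \<in> F" "c \<in> F"
      using sub[OF F(1)] by simp_all
    then have "F \<inter> verts G = {a, b, c}"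
      using face_with[OF F(1) _ _ _ V ab \<open>a \<noteq> c\<close>] by simp
    then show "(l a, l b, l c) \<in> flags T"
      unfolding flags_T_iff[OF V] using ab F(1) \<open>a \<noteq> c\<close> by (intro conjI bexI[of _ F])
  next
    assume fl: "(l a, l b, l c) \<in> flags T"
    then obtain F where F: "F \<in> faces G" "F \<inter> verts G = {a, b, c}" "a \<noteq> c"
      using flags_T_iff[OF V] by blast
    then have "e \<subseteq> F \<and> e' \<subseteq> F"
      using * fl by blast
    moreover have "e \<noteq> e'"
      using e(2) e'(2) ab F(3) by (auto simp: doubleton_eq_iff)
    moreover have "e \<inter> e' \<inter> verts G \<noteq> {}"
      using e(2) e'(2) by auto
    ultimately show "adjacent G e e'"
      unfolding adjacent_def using e(1) e'(1) F(1) by blast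
  qed
qed

text \<open>That consecutive faces differ means exactly that the fourth of four consecutive vertices
  differs from the first, which is the choice made by \<open>advance\<close>.\<close>

lemma zigzag_along_iff: "zigzag G e \<and> traverses G e v \<longleftrightarrow> along e v \<and> walk v"
proof
  assume z: "zigzag G e \<and> traverses G e v"
  then have al: "e i \<in> edges G" "e i \<inter> verts G = {v i, v (i + 1)}" for i
    by (auto simp: zigzag_def adjacent_def traverses_def)
  have al': "e (i + 1) \<inter> verts G = {v (i + 1), v (i + 2)}" for i
    using al(2)[of "i + 1"] by (simp add: add.assoc)
  have V: "v i \<in> verts G" for i
    using al(2)[of i] by auto
  have fl: "flag v i \<in> flags T" for i
    unfolding flag_def using z adjacent_iff(1)[OF al[of i] al(1)[of "i + 1"] al'] unfolding zigzag_def by blast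
  have "flag v (i + 1) = advance T (flag v i)" for i
  proof -
    have fl1: "(l (v (i + 1)), l (v (i + 2)), l (v (i + 3))) \<in> flags T"
      using fl[of "i + 1"] by (simp add: flag_def add.assoc)
    \<comment> \<open>If the first vertex came back here, the face of the first two edges would
      contain the ends of the third edge, hence that edge.\<close>
    have "l (v (i + 3)) \<noteq> l (v i)"
    proof
      assume "l (v (i + 3)) = l (v i)"
      then have eq: "v (i + 3) = v i"
        using l_eq_iff V by blast
      obtain F where F: "F \<in> faces G" "F \<inter> verts G = {v i, v (i + 1), v (i + 2)}"
        using fl[of i] flags_T_iff[OF V V V] unfolding flag_def by blast
      have "e i \<subseteq> F \<and> e (i + 1) \<subseteq> F"
        using adjacent_iff(2)[OF al[of i] al(1)[of "i + 1"] al' F(1)] fl[of i] F(2)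
        unfolding flag_def by blast
      moreover have "e (i + 2) \<subseteq> F"
      proof -
        have "e (i + 2) \<inter> verts G = {v (i + 2), v (i + 3)}"
          using al(2)[of "i + 2"] by (simp add: add.assoc)
        then show ?thesis
          using incidence[OF al(1)[of "i + 2"] F(1)] F(2) eq by blast
      qed
      ultimately show False
        using z F(1) unfolding zigzag_def by blast
    qed
    then have "advance T (flag v i) = (l (v (i + 1)), l (v (i + 2)), l (v (i + 3)))"
      unfolding flag_def using advance_eqI[OF complex _ _ fl1] fl[of i] unfolding flag_def by blast
    then show ?thesis
      by (simp add: flag_def add.assoc)
  qed
  then show "along e v \<and> walk v"
    using al fl V by (simp add: along_def walk_def)
next
  assume w: "along e v \<and> walk v"
  then have al: "e i \<in> edges G" "e i \<inter> verts G = {v i, v (i + 1)}" for i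
    by (auto simp: along_def)
  have al': "e (i + 1) \<inter> verts G = {v (i + 1), v (i + 2)}" for i
    using al(2)[of "i + 1"] by (simp add: add.assoc)
  have V: "v i \<in> verts G" and fl: "flag v i \<in> flags T" and adv: "flag v (i + 1) = advance T (flag v i)" for i
    using w by (auto simp: walk_def)
  have "adjacent G (e i) (e (i + 1))" for i
    using adjacent_iff(1)[OF al[of i] al(1)[of "i + 1"] al'] fl[of i] unfolding flag_def by blast
  moreover have "F \<noteq> F'" if F: "F \<in> faces G" "F' \<in> faces G"
    "e i \<subseteq> F \<and> e (i + 1) \<subseteq> F \<and> e (i + 1) \<subseteq> F' \<and> e (i + 2) \<subseteq> F'" for i F F'
  proof
    assume eq: "F = F'"
    have 1: "F \<inter> verts G = {v i, v (i + 1), v (i + 2)}"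
      using adjacent_iff(2)[OF al[of i] al(1)[of "i + 1"] al' F(1)] fl[of i] F(3)
      unfolding flag_def by blast
    obtain d where d: "advance T (flag v i) = (l (v (i + 1)), l (v (i + 2)), d)" "d \<noteq> l (v i)"
      "(l (v (i + 1)), l (v (i + 2)), d) \<in> flags T"
      using advanceE[OF complex fl[of i, unfolded flag_def]] unfolding flag_def by blast
    have d3: "d = l (v (i + 3))"
      using d(1) adv[of i] by (simp add: flag_def add.assoc)
    have "v (i + 3) \<in> F"
      using F(3) eq al(2)[of "i + 2"] by (auto simp: add.assoc)
    then have "v (i + 3) \<in> {v i, v (i + 1), v (i + 2)}"
      using 1 V by blast
    then show False
      using d d3 by (auto simp: flags_iff)
  qed
  moreover have "traverses G e v"
    using al by (simp add: traverses_def)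
  ultimately show "zigzag G e \<and> traverses G e v"
    unfolding zigzag_def by blast
qed

lemma zigzagE:
  assumes "zigzag G e"
  obtains v where "along e v" "walk v"
proof -
  obtain v where "traverses G e v"
    using assms unfolding zigzag_def by blast
  then show thesis
    using zigzag_along_iff[of e v] assms that[of v] by blast
qed

lemma ex_walk:
  assumes f: "f \<in> flags T"
  obtains e v where "along e v" "walk v" "flag v 0 = f"
proof -
  obtain s where s: "s 0 = f" "\<And>i :: int. s i \<in> flags T" "\<And>i. s (i + 1) = advance T (s i)"
    using ex_orbit[OF f] by blast
  define p where "p i = fst (s i)" for i
  have adv: "fst (advance T x) = fst (snd x)" "fst (snd (advance T x)) = snd (snd x)" for x
    by (simp_all add: advance_def case_prod_beta)
  have sp: "s i = (p i, p (i + 1), p (i + 2))" for i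
    using s(3)[of i] s(3)[of "i + 1"] adv by (simp add: p_def prod_eq_iff add.assoc)
  have "p i \<in> l ` verts G" for i
    using s(2)[of i] unfolding sp flags_iff by blast
  then obtain v where v: "\<And>i. v i \<in> verts G" "\<And>i. l (v i) = p i"
    unfolding image_iff by metis
  have fl: "flag v i = s i" for i
    by (simp add: flag_def v sp)
  have "\<exists>e\<in>edges G. e \<inter> verts G = {v i, v (i + 1)}" for i
  proof -
    have "flag v i \<in> flags T"
      using s(2) fl by simp
    then obtain F where F: "F \<in> faces G" "v i \<noteq> v (i + 1)" "F \<inter> verts G = {v i, v (i + 1), v (i + 2)}"
      unfolding flag_def using flags_T_iff[OF v(1) v(1) v(1)] by blast
    have "v i \<in> F \<inter> verts G" "v (i + 1) \<in> F \<inter> verts G"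
      unfolding F(3) by simp_all
    then show ?thesis
      using face_edge F(1,2) by blast
  qed
  then obtain e where "along e v"
    unfolding along_def by metis
  moreover have "walk v"
    unfolding walk_def using v(1) s fl by simp
  ultimately show thesis
    using that fl s(1) by metis
qed

lemma walk_flag: "walk v \<Longrightarrow> flag v i \<in> flags T" "walk v \<Longrightarrow> flag v (i + 1) = advance T (flag v i)"
  "walk v \<Longrightarrow> v i \<in> verts G"
  by (simp_all add: walk_def)

lemma walk_shift:
  assumes "walk v"
  shows "walk (\<lambda>i. v (i + k))"
proof -
  have fl: "flag (\<lambda>i. v (i + k)) i = flag v (i + k)" for i
    by (simp add: flag_def algebra_simps)
  have "flag v (i + 1 + k) = advance T (flag v (i + k))" for i
    using walk_flag(2)[OF assms, of "i + k"] by (simp add: algebra_simps)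
  then show ?thesis
    unfolding walk_def fl using walk_flag(1,3)[OF assms] by blast
qed

lemma along_shift: "along e v \<Longrightarrow> along (\<lambda>i. e (i + k)) (\<lambda>i. v (i + k))"
  unfolding along_def by (simp add: algebra_simps)

lemma along_unique: "along e v \<Longrightarrow> along e' v \<Longrightarrow> e = e'"
  unfolding along_def by (intro ext) (metis simple_edges)

text \<open>Along a walk, vertices two places apart are distinct, so v i is the only common end of
  the edges at i - 1 and i.\<close>

lemma along_unique_vertices:
  assumes "along e v" "along e v'" "walk v" "walk v'"
  shows "v = v'"
proof
  fix i
  have e: "e i \<inter> verts G = {v i, v (i + 1)}" "e (i - 1) \<inter> verts G = {v (i - 1), v i}"
    "e i \<inter> verts G = {v' i, v' (i + 1)}" "e (i - 1) \<inter> verts G = {v' (i - 1), v' i}"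
    using along_ends[OF assms(1), of i] along_ends[OF assms(1), of "i - 1"]
      along_ends[OF assms(2), of i] along_ends[OF assms(2), of "i - 1"] by simp_all
  have "flag v (i - 1) \<in> flags T" "flag v' (i - 1) \<in> flags T"
    using assms(3,4) walk_flag by blast+
  then have "v (i - 1) \<noteq> v (i + 1)" "v' (i - 1) \<noteq> v' (i + 1)"
    by (auto simp: flag_def flags_iff algebra_simps)
  then have "{v i} = {v i, v (i + 1)} \<inter> {v (i - 1), v i}" "{v' i} = {v' i, v' (i + 1)} \<inter> {v' (i - 1), v' i}"
    by auto
  then have "{v i} = {v' i}"
    unfolding e[symmetric] by metis
  then show "v i = v' i"
    by simp
qed

lemma walk_eqI:
  assumes "walk v" "walk v'" "flag v k = flag v' m"
  shows "v (k + i) = v' (m + i)"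
proof -
  have "flag v (k + i) = flag v' (m + i)"
    by (rule orbit_unique) (use assms walk_flag in auto)
  then have "l (v (k + i)) = l (v' (m + i))"
    by (simp add: flag_def)
  then show ?thesis
    using l_eq_iff walk_flag(3) assms by blast
qed

text \<open>The edge at -i joins v (-i) to v (1 - i) and is now traversed from the latter; hence the
  index 1 - i for vertices and -1 - i for flags.\<close>

lemma reverse_walk:
  assumes "along e v" "walk v"
  shows "along (reversed e) (\<lambda>i. v (1 - i))" "walk (\<lambda>i. v (1 - i))"
    "flag (\<lambda>i. v (1 - i)) i = reverse (flag v (- 1 - i))"
proof -
  show "along (reversed e) (\<lambda>i. v (1 - i))"
    using assms(1) unfolding along_def reversed_def by (auto simp: insert_commute algebra_simps)
  show fl: "flag (\<lambda>i. v (1 - i)) i = reverse (flag v (- 1 - i))" for i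
    by (simp add: flag_def algebra_simps)
  show "walk (\<lambda>i. v (1 - i))"
    unfolding walk_def fl
  proof (intro allI conjI)
    fix i
    show "v (1 - i) \<in> verts G" "reverse (flag v (- 1 - i)) \<in> flags T"
      using assms(2) walk_flag reverse_mem by blast+
    have "flag v (- 1 - i) = advance T (flag v (- 1 - (i + 1)))"
      using walk_flag(2)[OF assms(2), of "- 1 - (i + 1)"] by (simp add: algebra_simps)
    then show "reverse (flag v (- 1 - (i + 1))) = advance T (reverse (flag v (- 1 - i)))"
      using \<tau>_\<rho> walk_flag(1)[OF assms(2)] by metis
  qed
qed

lemma linked_flag_iff:
  assumes "walk v" "f \<in> flags T"
  shows "linked (flags T) (advance T) (flag v i) f \<longleftrightarrow> (\<exists>j. flag v j = f)"
  using linked_orbit_iff[of "flag v" f i] walk_flag[OF assms(1)] assms(2) by blast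

lemma cyclic_sequence_eq_iff:
  "cyclic_sequence e = cyclic_sequence e' \<longleftrightarrow> (\<exists>k. e' = (\<lambda>i. e (i + k)))" (is "_ \<longleftrightarrow> ?R")
proof
  assume "cyclic_sequence e = cyclic_sequence e'"
  moreover have "e' \<in> cyclic_sequence e'"
    unfolding cyclic_sequence_def by (rule range_eqI[of _ _ 0]) simp
  ultimately show ?R
    unfolding cyclic_sequence_def by blast
next
  assume ?R
  then obtain k where k: "e' = (\<lambda>i. e (i + k))" ..
  have "(\<lambda>i. e (i + j)) \<in> cyclic_sequence e'" for j
    unfolding cyclic_sequence_def k by (rule range_eqI[of _ _ "j - k"]) (simp add: algebra_simps)
  moreover have "(\<lambda>i. e' (i + j)) \<in> cyclic_sequence e" for j
    unfolding cyclic_sequence_def k by (rule range_eqI[of _ _ "k + j"]) (simp add: algebra_simps)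
  ultimately show "cyclic_sequence e = cyclic_sequence e'"
    unfolding cyclic_sequence_def by blast
qed

text \<open>Edges and vertices of a walk determine each other, and one common flag determines the
  walk up to a shift.\<close>

lemma same_cyclic_iff:
  assumes "along e v" "walk v" "along e' v'" "walk v'"
  shows "cyclic_sequence e = cyclic_sequence e' \<longleftrightarrow> linked (flags T) (advance T) (flag v i) (flag v' j)"
  unfolding cyclic_sequence_eq_iff linked_flag_iff[OF assms(2) walk_flag(1)[OF assms(4)]]
proof
  assume "\<exists>k. e' = (\<lambda>i. e (i + k))"
  then obtain k where "e' = (\<lambda>i. e (i + k))" ..
  then have "along e' (\<lambda>i. v (i + k))"
    using along_shift[OF assms(1)] by blast
  then have "v' = (\<lambda>i. v (i + k))"
    using along_unique_vertices assms walk_shift by blast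
  then have "flag v (j + k) = flag v' j"
    by (simp add: flag_def algebra_simps)
  then show "\<exists>k. flag v k = flag v' j" ..
next
  assume "\<exists>k. flag v k = flag v' j"
  then obtain k where k: "flag v k = flag v' j" ..
  have "v' = (\<lambda>i. v (i + (k - j)))"
  proof
    fix i
    show "v' i = v (i + (k - j))"
      using walk_eqI[OF assms(2,4) k, of "i - j"] by (simp add: algebra_simps)
  qed
  then have "e' = (\<lambda>i. e (i + (k - j)))"
    using along_shift[OF assms(1), of "k - j"] assms(3) along_unique by metis
  then show "\<exists>k. e' = (\<lambda>i. e (i + k))" ..
qed

theorem z_knotted_iff: "z_knotted G \<longleftrightarrow> knotted (flags T) (advance T) reverse"
proof
  assume "z_knotted G"
  then obtain e where e: "zigzag G e"
    "cyclic_sequence ` {e'. zigzag G e'} = {cyclic_sequence e, cyclic_sequence (reversed e)}"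
    unfolding z_knotted_def by blast
  obtain v where v: "along e v" "walk v"
    using zigzagE[OF e(1)] .
  \<comment> \<open>The index -1 is chosen because the reversed walk has at 0 the reversal of the
    flag at -1.\<close>
  have "linked (flags T) (advance T) (flag v (-1)) f \<or> linked (flags T) (advance T) (reverse (flag v (-1))) f"
    if f: "f \<in> flags T" for f
  proof -
    obtain e' v' where v': "along e' v'" "walk v'" "flag v' 0 = f"
      using ex_walk[OF f] .
    then have "zigzag G e'"
      using zigzag_along_iff by blast
    then consider "cyclic_sequence e = cyclic_sequence e'" | "cyclic_sequence (reversed e) = cyclic_sequence e'"
      using e(2) by blast
    then show ?thesis
    proof cases
      case 1
      then show ?thesis
        using same_cyclic_iff[OF v v'(1,2), of "-1" 0] v'(3) by simp
    next
      case 2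
      then show ?thesis
        using same_cyclic_iff[OF reverse_walk(1,2)[OF v] v'(1,2), of 0 0] v'(3) reverse_walk(3)[OF v, of 0]
        by simp
    qed
  qed
  then show "knotted (flags T) (advance T) reverse"
    unfolding knotted_def using walk_flag(1)[OF v(2)] by blast
next
  assume "knotted (flags T) (advance T) reverse"
  then obtain f where f: "f \<in> flags T" "\<And>f'. f' \<in> flags T \<Longrightarrow>
      linked (flags T) (advance T) f f' \<or> linked (flags T) (advance T) (reverse f) f'"
    unfolding knotted_def by blast
  obtain e0 v0 where v0: "along e0 v0" "walk v0" "flag v0 0 = f"
    using ex_walk[OF f(1)] .
  \<comment> \<open>Shifted by one so that f becomes the flag at -1 and its reversal the flag of the
    reversed walk at 0.\<close>
  define e v where "e = (\<lambda>i. e0 (i + 1))" and "v = (\<lambda>i. v0 (i + 1))"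
  have v: "along e v" "walk v" "flag v (-1) = f"
    using along_shift[OF v0(1)] walk_shift[OF v0(2)] v0(3) by (auto simp: e_def v_def flag_def)
  have z: "zigzag G e" "zigzag G (reversed e)"
    using v reverse_walk(1,2)[OF v(1,2)] zigzag_along_iff by blast+
  have "cyclic_sequence e' \<in> {cyclic_sequence e, cyclic_sequence (reversed e)}" if z': "zigzag G e'" for e'
  proof -
    obtain v' where v': "along e' v'" "walk v'"
      using zigzagE[OF z'] .
    consider "linked (flags T) (advance T) (flag v (-1)) (flag v' 0)"
      | "linked (flags T) (advance T) (flag (\<lambda>i. v (1 - i)) 0) (flag v' 0)"
      using f(2)[OF walk_flag(1)[OF v'(2), of 0]] v(3) reverse_walk(3)[OF v(1,2), of 0] by auto
    then show ?thesis
      using same_cyclic_iff[OF v(1,2) v'] same_cyclic_iff[OF reverse_walk(1,2)[OF v(1,2)] v'] by cases auto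
  qed
  then have "cyclic_sequence ` {e'. zigzag G e'} = {cyclic_sequence e, cyclic_sequence (reversed e)}"
    using z by auto
  then show "z_knotted G"
    unfolding z_knotted_def using z(1) by blast
qed

section \<open>The z-monodromy expressed by flags\<close>

lemma face_rotation_eq:
  assumes "F \<inter> verts G = {a, b, c}" "a \<noteq> b" "b \<noteq> c" "a \<noteq> c"
  shows "face_rotation G F (a, b) = (b, c)"
proof -
  have "(THE w. w \<in> F \<inter> verts G \<and> w \<noteq> a \<and> w \<noteq> b) = c"
    unfolding assms(1) using assms(2-4) by (intro the_equality) auto
  moreover have "(a, b) \<in> oriented_edges G F"
    unfolding oriented_edges_def assms(1) using assms(2) by simp
  ultimately show ?thesis
    by (simp add: face_rotation_def)
qed

lemma oriented_edgeE:
  assumes F: "F \<in> faces G" and pq: "(p, q) \<in> oriented_edges G F"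
  obtains r where "F \<inter> verts G = {p, q, r}" "p \<noteq> q" "q \<noteq> r" "p \<noteq> r"
proof -
  have pq: "p \<in> F \<inter> verts G" "q \<in> F \<inter> verts G" "p \<noteq> q"
    using pq by (auto simp: oriented_edges_def)
  have "card (F \<inter> verts G - {p, q}) = 1"
    using face_card[OF F] pq by (simp add: card_Diff_subset)
  then obtain r where "F \<inter> verts G - {p, q} = {r}"
    by (auto simp: card_1_singleton_iff)
  then have "F \<inter> verts G = {p, q, r}" "q \<noteq> r" "p \<noteq> r"
    using pq by auto
  with pq(3) that show thesis
    by blast
qed

lemma flags_singleton_face:
  assumes "a \<in> verts G" "b \<in> verts G" "c \<in> verts G"
  shows "(l a, l b, l c) \<in> flags {l ` (F \<inter> verts G)} \<longleftrightarrow>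
    a \<noteq> b \<and> b \<noteq> c \<and> a \<noteq> c \<and> F \<inter> verts G = {a, b, c}"
proof -
  have "l ` {a, b, c} = l ` (F \<inter> verts G) \<longleftrightarrow> {a, b, c} = F \<inter> verts G"
    by (rule inj_on_image_eq_iff[OF inj_l]) (use assms in auto)
  then have "{l a, l b, l c} \<in> {l ` (F \<inter> verts G)} \<longleftrightarrow> F \<inter> verts G = {a, b, c}"
    by (simp only: image_insert image_empty singleton_iff) metis
  then show ?thesis
    using assms by (simp only: flags_iff l_eq_iff)
qed

text \<open>An oriented edge of a zigzag ends one flag and begins the next; these lie in the two
  faces at that edge, and F must be one of them.\<close>

lemma oriented_edge_flag:
  assumes "walk v" "F \<in> faces G" "(v j, v (j + 1)) \<in> oriented_edges G F"
  shows "flag v j \<in> flags {l ` (F \<inter> verts G)} \<or> flag v (j - 1) \<in> flags {l ` (F \<inter> verts G)}"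
proof -
  note V = walk_flag(3)[OF assms(1)]
  obtain r where r: "F \<inter> verts G = {v j, v (j + 1), r}" "v j \<noteq> v (j + 1)" "v (j + 1) \<noteq> r" "v j \<noteq> r"
    using oriented_edgeE[OF assms(2,3)] .
  have rV: "r \<in> verts G"
    using r(1) by auto
  have prev: "flag v (j - 1) = (l (v (j - 1)), l (v j), l (v (j + 1)))"
    by (simp add: flag_def algebra_simps)
  show ?thesis
  proof (cases "r = v (j - 1)")
    case True
    then have "F \<inter> verts G = {v (j - 1), v j, v (j + 1)}"
      using r(1) by auto
    then show ?thesis
      unfolding prev flags_singleton_face[OF V V V] using r True by auto
  next
    case False
    have "(l (v j), l (v (j + 1)), l r) \<in> flags T"
      unfolding flags_T_iff[OF V V rV] using r assms(2) by blast
    moreover have "l r \<noteq> l (v (j - 1))"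
      using False l_eq_iff V rV by blast
    ultimately have "advance T (flag v (j - 1)) = (l (v j), l (v (j + 1)), l r)"
      unfolding prev using walk_flag(1)[OF assms(1), of "j - 1"] unfolding prev
      by (intro advance_eqI[OF complex]) auto
    then have "flag v j = (l (v j), l (v (j + 1)), l r)"
      using walk_flag(2)[OF assms(1), of "j - 1"] by simp
    moreover have "(l (v j), l (v (j + 1)), l r) \<in> flags {l ` (F \<inter> verts G)}"
      unfolding flags_singleton_face[OF V V rV] using r by blast
    ultimately show ?thesis
      by simp
  qed
qed

text \<open>\<open>z_monodromy\<close> waits for an oriented edge of F, \<open>passage\<close> for a
  flag of F. By \<open>oriented_edge_flag\<close>, the first such edge after a visit is the first
  edge of the next visit, so both stop at the same place.\<close>

lemma z_monodromy_eq:
  assumes K: "knotted (flags T) (advance T) reverse" and F: "F \<in> faces G"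
    and abc: "F \<inter> verts G = {a, b, c}" "a \<noteq> b" "b \<noteq> c" "a \<noteq> c"
  obtains p q r where "F \<inter> verts G = {p, q, r}" "p \<noteq> q" "q \<noteq> r" "p \<noteq> r"
    "monodromy T (l ` (F \<inter> verts G)) (l a, l b, l c) = (l p, l q, l r)"
    "z_monodromy G F (a, b) = (p, q)"
proof -
  let ?Y = "flags {l ` (F \<inter> verts G)}"
  interpret S: reversible_section "flags T" "advance T" reverse ?Y backshift
    by (rule reversible_section_flags[OF complex _ K]) (use F in blast)
  have V: "a \<in> verts G" "b \<in> verts G" "c \<in> verts G"
    using abc(1) by auto
  have "F \<inter> verts G = {c, a, b}"
    using abc(1) by auto
  then have start: "(l c, l a, l b) \<in> ?Y"
    unfolding flags_singleton_face[OF V(3,1,2)] using abc by blast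
  then have start': "(l c, l a, l b) \<in> flags T"
    using S.Y_subset by blast
  obtain e v where v: "along e v" "walk v" "flag v 0 = (l c, l a, l b)"
    using ex_walk[OF start'] .
  note vV = walk_flag(3)[OF v(2)]
  have v012: "v 0 = c" "v 1 = a" "v 2 = b"
    using v(3) vV V l_eq_iff unfolding flag_def by auto
  have funpow: "(advance T ^^ k) (advance T (l c, l a, l b)) = flag v (int k + 1)" for k
  proof (induction k)
    case 0
    show ?case using walk_flag(2)[OF v(2), of 0] v(3) by simp
  next
    case (Suc k)
    show ?case using walk_flag(2)[OF v(2), of "int k + 1"] Suc by (simp add: add.commute)
  qed
  \<comment> \<open>\<open>hit\<close> counts from the flag at index 1, so the next visit begins at
    index n + 1.\<close>
  obtain n where n: "S.hit (advance T (l c, l a, l b)) = flag v (int n + 1)" "flag v (int n + 1) \<in> ?Y"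
    "\<And>k. k < n \<Longrightarrow> flag v (int k + 1) \<notin> ?Y"
    using S.hitE[OF advance_mem[OF complex start']] unfolding funpow by blast
  define N where "N = int n + 1"
  have first: "flag v j \<notin> ?Y" if "1 \<le> j" "j < N" for j
    using n(3)[of "nat (j - 1)"] that unfolding N_def by simp
  \<comment> \<open>The flag after a visit lies in another face, so N > 1, as required of n in
    \<open>z_monodromy\<close>.\<close>
  have "flag v 1 \<notin> ?Y"
    using S.\<tau>_Y[OF start] walk_flag(2)[OF v(2), of 0] v(3) by simp
  then have N: "N > 1"
    using n(2) unfolding N_def by (cases n) auto
  have FN: "v N \<noteq> v (N + 1)" "v (N + 1) \<noteq> v (N + 2)" "v N \<noteq> v (N + 2)"
    "F \<inter> verts G = {v N, v (N + 1), v (N + 2)}"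
    using n(2) unfolding N_def[symmetric] flag_def flags_singleton_face[OF vV vV vV] by blast+
  have notin: "(v j, v (j + 1)) \<notin> oriented_edges G F" if "1 < j" "j < N" for j
    using oriented_edge_flag[OF v(2) F, of j] first[of j] first[of "j - 1"] that by force
  have edge_N: "(v N, v (N + 1)) \<in> oriented_edges G F"
    unfolding oriented_edges_def using FN by auto
  have ca: "(c, a) \<in> oriented_edges G F" "(a, b) \<in> oriented_edges G F"
    unfolding oriented_edges_def abc(1) using abc by auto
  have rot_ca: "face_rotation G F (c, a) = (a, b)"
    by (rule face_rotation_eq) (use abc in auto)
  have zig: "zigzag G e" "traverses G e v"
    using zigzag_along_iff v by blast+
  define P where "P d' \<longleftrightarrow> (\<exists>d0\<in>oriented_edges G F. face_rotation G F d0 = (a, b) \<and>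
           (\<exists>e v n. zigzag G e \<and> traverses G e v \<and>
              (v 0, v 1) = d0 \<and> (v 1, v 2) = (a, b) \<and>
              n > 1 \<and> (v n, v (n + 1)) = d' \<and> d' \<in> oriented_edges G F \<and>
              (\<forall>j. 1 < j \<and> j < n \<longrightarrow> (v j, v (j + 1)) \<notin> oriented_edges G F)))" for d'
  have "P (v N, v (N + 1))"
    unfolding P_def
    by (rule bexI[OF _ ca(1)], intro conjI exI[of _ e] exI[of _ v] exI[of _ N])
      (use zig rot_ca N edge_N notin v012 in auto)
  \<comment> \<open>Only \<open>(c, a)\<close> is rotated to \<open>(a, b)\<close>, so every witness
    starts with c, a, b and its walk is v; both indices are then the first return.\<close>
  moreover have "d' = (v N, v (N + 1))" if P: "P d'" for d'
  proof -
    obtain d0 e' v' n' where d0: "d0 \<in> oriented_edges G F" "face_rotation G F d0 = (a, b)"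
      and z': "zigzag G e'" "traverses G e' v'" "(v' 0, v' 1) = d0" "(v' 1, v' 2) = (a, b)"
      and n': "n' > 1" "(v' n', v' (n' + 1)) = d'" "d' \<in> oriented_edges G F"
        "\<And>j. 1 < j \<Longrightarrow> j < n' \<Longrightarrow> (v' j, v' (j + 1)) \<notin> oriented_edges G F"
      using P unfolding P_def by blast
    obtain r where "F \<inter> verts G = {v' 0, v' 1, r}" "v' 0 \<noteq> v' 1" "v' 1 \<noteq> r" "v' 0 \<noteq> r"
      using oriented_edgeE[OF F d0(1)[folded z'(3)]] .
    moreover from this have "r = b"
      using face_rotation_eq[of F "v' 0" "v' 1" r] d0(2) z'(3) by simp
    moreover have "v' 1 = a"
      using z'(4) by simp
    moreover have "v' 0 \<in> {a, b, c}"
      using calculation abc(1) by blast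
    ultimately have "v' 0 = c"
      by auto
    then have "flag v' 0 = flag v 0"
      using z'(4) v(3) unfolding flag_def by simp
    moreover have "walk v'"
      using zigzag_along_iff z'(1,2) by blast
    ultimately have eq: "v' i = v i" for i
      using walk_eqI[of v' v 0 0 i] v(2) by simp
    have "\<not> n' < N"
      using notin[of n'] n' eq by auto
    moreover have "\<not> N < n'"
      using n'(4)[of N] N edge_N eq by auto
    ultimately have "n' = N"
      by simp
    then show ?thesis
      using n'(2) eq by simp
  qed
  ultimately have "(THE d'. P d') = (v N, v (N + 1))"
    by (rule the_equality)
  then have "z_monodromy G F (a, b) = (v N, v (N + 1))"
    unfolding z_monodromy_def P_def if_P[OF ca(2)] .
  moreover have "S.passage (l a, l b, l c) = (l (v N), l (v (N + 1)), l (v (N + 2)))"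
    unfolding S.passage_def backshift_simp n(1) flag_def N_def[symmetric] by simp
  ultimately show thesis
    using that[of "v N" "v (N + 1)" "v (N + 2)"] FN by blast
qed

end

section \<open>Types of faces as permutations of six indices\<close>

definition side :: "'v \<times> 'v \<times> 'v \<Rightarrow> nat \<Rightarrow> 'v \<times> 'v" where
  "side y i = (fst (flag_of y i), fst (snd (flag_of y i)))"

definition face_acts_as :: "'a embedded_graph \<Rightarrow> 'a set \<Rightarrow> 'a \<times> 'a \<times> 'a \<Rightarrow> nat list \<Rightarrow> bool" where
  "face_acts_as G F y L \<longleftrightarrow> (\<forall>i<6. z_monodromy G F (side y i) = side y (L ! i))"

lemma side_simps [simp]:
  "side (a, b, c) 0 = (a, b)" "side (a, b, c) 1 = (b, c)"
  "side (a, b, c) (Suc 0) = (b, c)"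
  "side (a, b, c) 2 = (c, a)" "side (a, b, c) 3 = (b, a)"
  "side (a, b, c) 4 = (c, b)" "side (a, b, c) 5 = (a, c)"
  by (simp_all add: side_def)

lemma side_inj:
  assumes "a \<noteq> b" "b \<noteq> c" "a \<noteq> c" "i < 6" "j < 6" "side (a, b, c) i = side (a, b, c) j"
  shows "i = j"
  using assms unfolding less6_cases by (elim disjE) simp_all

locale labelled_face =
  fixes G :: "'a embedded_graph" and F :: "'a set" and a b c :: 'a
  assumes abc: "F \<inter> verts G = {a, b, c}" and ab: "a \<noteq> b" and bc: "b \<noteq> c" and ac: "a \<noteq> c"
begin

lemma oriented_edges_eq: "oriented_edges G F = {(a, b), (b, c), (c, a), (b, a), (c, b), (a, c)}"
  unfolding oriented_edges_def abc using ab bc ac by auto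

lemma oriented_edge_cases: "d \<in> oriented_edges G F \<longleftrightarrow> (\<exists>i<6. d = side (a, b, c) i)"
proof -
  have "(\<exists>i<6. d = side (a, b, c) i) \<longleftrightarrow> d \<in> side (a, b, c) ` {..<6}"
    by blast
  also have "{..<6} = {0, 1, 2, 3, 4, 5::nat}"
    by auto
  finally show ?thesis
    unfolding oriented_edges_eq image_insert image_empty side_simps by (simp only:)
qed

lemma z_monodromy_eqI:
  assumes L: "face_acts_as G F (a, b, c) L" and f: "\<And>i. i < 6 \<Longrightarrow> f (side (a, b, c) i) = side (a, b, c) (L ! i)"
    and out: "\<And>d. d \<notin> oriented_edges G F \<Longrightarrow> f d = d"
  shows "z_monodromy G F = f"
proof
  fix d
  show "z_monodromy G F d = f d"
  proof (cases "d \<in> oriented_edges G F")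
    case True
    then obtain i where "i < 6" "d = side (a, b, c) i"
      using oriented_edge_cases by blast
    then show ?thesis
      using L f by (simp add: face_acts_as_def)
  next
    case False
    then show ?thesis
      using out by (simp add: z_monodromy_def)
  qed
qed

lemma face_rotation_edge: "i < 6 \<Longrightarrow> face_rotation G F (side (a, b, c) i) = side (a, b, c) (rot6 ! i)"
proof -
  have the: "(THE w. w \<in> {a, b, c} \<and> w \<noteq> x \<and> w \<noteq> y) = z" if "{a, b, c} = {x, y, z}" "x \<noteq> z" "y \<noteq> z" for x y z
    unfolding that(1) using that(2,3) by (intro the_equality) auto
  have "face_rotation G F (x, y) = (y, z)" if "{a, b, c} = {x, y, z}" "x \<noteq> z" "y \<noteq> z" "x \<noteq> y" for x y z
    using the[OF that(1-3)] that unfolding face_rotation_def oriented_edges_def abc by auto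
  note * = this
  have "face_rotation G F (a, b) = (b, c)" "face_rotation G F (b, c) = (c, a)" "face_rotation G F (c, a) = (a, b)"
    "face_rotation G F (b, a) = (a, c)" "face_rotation G F (a, c) = (c, b)" "face_rotation G F (c, b) = (b, a)"
    by (rule *; use ab bc ac in auto)+
  then show "i < 6 \<Longrightarrow> ?thesis"
    by (auto simp: less6_cases rot6_def)
qed

lemma face_rotation_iff: "z_monodromy G F = face_rotation G F \<longleftrightarrow> face_acts_as G F (a, b, c) rot6"
proof
  assume "z_monodromy G F = face_rotation G F"
  then show "face_acts_as G F (a, b, c) rot6"
    using face_rotation_edge by (simp add: face_acts_as_def)
next
  assume "face_acts_as G F (a, b, c) rot6"
  then show "z_monodromy G F = face_rotation G F"
    by (rule z_monodromy_eqI[OF _ face_rotation_edge]) (auto simp: face_rotation_def)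
qed

lemma face_acts_as_id: "z_monodromy G F = id \<Longrightarrow> face_acts_as G F (a, b, c) id6"
  by (auto simp: face_acts_as_def less6_cases id6_def)

lemma M3_edge:
  assumes "i < 6"
  shows "(cycle_of_list [(b, a), (b, c), (c, a)] \<circ> cycle_of_list [(a, c), (c, b), (a, b)]) (side (a, b, c) i)
    = side (a, b, c) (M3_6 ! i)"
  using assms ab bc ac by (auto simp: less6_cases M3_6_def transpose_def)

lemma M4_edge:
  assumes "i < 6"
  shows "(cycle_of_list [(a, b), (c, b)] \<circ> cycle_of_list [(b, c), (b, a)]) (side (a, b, c) i)
    = side (a, b, c) (M4_6 ! i)"
  using assms ab bc ac by (auto simp: less6_cases M4_6_def transpose_def)

lemma rotations: "face_rotation G F (a, b) = (b, c)" "face_rotation G F (b, c) = (c, a)"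
  using face_rotation_edge[of 0] face_rotation_edge[of 1] by (simp_all add: rot6_def)

lemma type_M3I:
  assumes "face_acts_as G F (a, b, c) M3_6"
  shows "type_M3 G F"
proof -
  have "z_monodromy G F = cycle_of_list [(b, a), (b, c), (c, a)] \<circ> cycle_of_list [(a, c), (c, b), (a, b)]"
  proof (rule z_monodromy_eqI[OF assms M3_edge])
    fix d assume "d \<notin> oriented_edges G F"
    then show "(cycle_of_list [(b, a), (b, c), (c, a)] \<circ> cycle_of_list [(a, c), (c, b), (a, b)]) d = d"
      unfolding oriented_edges_eq by (auto simp: transpose_def)
  qed
  then show ?thesis
    unfolding type_M3_def by (intro bexI[of _ "(a, b)"]) (auto simp: rotations oriented_edges_eq)
qed

end

context graph_model
begin

lemma labelled_faceI:
  assumes "F \<in> faces G" "(a, b) \<in> oriented_edges G F"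
  obtains c where "labelled_face G F a b c"
  using oriented_edgeE[OF assms] unfolding labelled_face_def by metis

lemma type_M3E:
  assumes "F \<in> faces G" "type_M3 G F"
  obtains a b c where "labelled_face G F a b c" "face_acts_as G F (a, b, c) M3_6"
proof -
  obtain a b where ab: "(a, b) \<in> oriented_edges G F"
    and M: "\<And>e2 e3. e2 = face_rotation G F (a, b) \<Longrightarrow> e3 = face_rotation G F e2 \<Longrightarrow> z_monodromy G F =
          cycle_of_list [prod.swap (a, b), e2, e3] \<circ> cycle_of_list [prod.swap e3, prod.swap e2, (a, b)]"
    using assms(2) unfolding type_M3_def by auto
  obtain c where c: "labelled_face G F a b c"
    using labelled_faceI[OF assms(1) ab] .
  interpret labelled_face G F a b c by (rule c)
  have "z_monodromy G F = cycle_of_list [(b, a), (b, c), (c, a)] \<circ> cycle_of_list [(a, c), (c, b), (a, b)]"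
    using M[OF refl refl] unfolding rotations by simp
  then have "face_acts_as G F (a, b, c) M3_6"
    unfolding face_acts_as_def using M3_edge by simp
  with c that show thesis by blast
qed

lemma type_M4E:
  assumes "F \<in> faces G" "type_M4 G F"
  obtains a b c where "labelled_face G F a b c" "face_acts_as G F (a, b, c) M4_6"
proof -
  obtain a b where ab: "(a, b) \<in> oriented_edges G F"
    and M: "\<And>e2. e2 = face_rotation G F (a, b) \<Longrightarrow> z_monodromy G F =
          cycle_of_list [(a, b), prod.swap e2] \<circ> cycle_of_list [e2, prod.swap (a, b)]"
    using assms(2) unfolding type_M4_def by auto
  obtain c where c: "labelled_face G F a b c"
    using labelled_faceI[OF assms(1) ab] .
  interpret labelled_face G F a b c by (rule c)
  have "z_monodromy G F = cycle_of_list [(a, b), (c, b)] \<circ> cycle_of_list [(b, c), (b, a)]"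
    using M[OF refl] unfolding rotations by simp
  then have "face_acts_as G F (a, b, c) M4_6"
    unfolding face_acts_as_def using M4_edge by simp
  with c that show thesis by blast
qed

text \<open>By \<open>z_monodromy_eq\<close> one triple p, q, r describes the value of both maps, so
  the values carry the same index.\<close>

lemma face_acts_as_iff:
  assumes K: "knotted (flags T) (advance T) reverse" and F: "F \<in> faces G"
    and face: "labelled_face G F a b c" and L: "list_all (\<lambda>i. L ! i < 6) [0..<6]"
  shows "face_acts_as G F (a, b, c) L \<longleftrightarrow>
    acts_as (l a, l b, l c) (monodromy T (l ` (F \<inter> verts G))) L"
proof -
  interpret labelled_face G F a b c by (rule face)
  have V: "a \<in> verts G" "b \<in> verts G" "c \<in> verts G"
    using abc by auto
  have fl: "(a, b, c) \<in> flags {F \<inter> verts G}"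
    unfolding flags_iff abc using ab bc ac by simp
  have lab: "flag_of (l a, l b, l c) i = (l x, l y, l z)" if "flag_of (a, b, c) i = (x, y, z)" "i < 6" for i x y z
    using that(2,1) by (auto simp: less6_cases)
  have inj: "i = j" if "flag_of (l a, l b, l c) i = flag_of (l a, l b, l c) j" "i < 6" "j < 6" for i j
  proof -
    have "(l a, l b, l c) \<in> flags {l ` (F \<inter> verts G)}"
      unfolding flags_singleton_face[OF V] using abc ab bc ac by blast
    from bij_betw_flag_of[OF this] show ?thesis
      using that by (auto simp: bij_betw_def inj_on_def)
  qed
  have "z_monodromy G F (side (a, b, c) i) = side (a, b, c) (L ! i) \<longleftrightarrow>
    monodromy T (l ` (F \<inter> verts G)) (flag_of (l a, l b, l c) i) = flag_of (l a, l b, l c) (L ! i)" if i: "i < 6" for i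
  proof -
    obtain x y z where xyz: "flag_of (a, b, c) i = (x, y, z)"
      by (metis prod_cases3)
    then have "(x, y, z) \<in> flags {F \<inter> verts G}"
      using flag_of_mem[OF fl i] by simp
    then have "F \<inter> verts G = {x, y, z}" "x \<noteq> y" "y \<noteq> z" "x \<noteq> z"
      unfolding flags_iff by blast+
    then obtain p q r where pqr: "F \<inter> verts G = {p, q, r}" "p \<noteq> q" "q \<noteq> r" "p \<noteq> r"
      "monodromy T (l ` (F \<inter> verts G)) (l x, l y, l z) = (l p, l q, l r)"
      "z_monodromy G F (x, y) = (p, q)"
      using z_monodromy_eq[OF K F] by metis
    have "(p, q, r) \<in> flags {F \<inter> verts G}"
      unfolding flags_iff using pqr by blast
    then obtain j where j: "j < 6" "flag_of (a, b, c) j = (p, q, r)"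
      using bij_betw_flag_of[OF fl] unfolding bij_betw_def by (metis imageE lessThan_iff)
    have "L ! i < 6"
      using L i by (simp add: list_all_iff)
    have "z_monodromy G F (side (a, b, c) i) = side (a, b, c) j"
      using pqr(6) j xyz by (simp add: side_def)
    moreover have "monodromy T (l ` (F \<inter> verts G)) (flag_of (l a, l b, l c) i) = flag_of (l a, l b, l c) j"
      using lab[OF xyz i] lab[OF j(2,1)] pqr(5) by simp
    ultimately show ?thesis
      using side_inj[OF ab bc ac j(1) \<open>L ! i < 6\<close>] inj[OF _ j(1) \<open>L ! i < 6\<close>] by auto
  qed
  then show ?thesis
    by (simp add: face_acts_as_def acts_as_def)
qed

end

section \<open>Triangulations of closed surfaces\<close>
text \<open>The exponential parametrization starting at w maps the open interval from 0 to 2 pi onto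
  this set.\<close>

lemma connected_punctured_circle:
  fixes w :: complex
  assumes "norm w = 1"
  shows "connected (sphere 0 1 - {w})"
proof -
  have "sphere 0 1 - {w} = (\<lambda>t. w * exp (\<i> * of_real t)) ` {0<..<2 * pi}"
  proof (intro equalityI subsetI)
    fix z assume z: "z \<in> sphere 0 1 - {w}"
    define t where "t = Arg2pi (z / w)"
    have zw: "z / w = exp (\<i> * of_real t)"
      using Arg2pi[of "z / w"] z assms by (simp add: t_def norm_divide is_Arg_def)
    have w: "w \<noteq> 0"
      using assms by auto
    have "t \<noteq> 0"
      using zw z w by auto
    then have "t \<in> {0<..<2 * pi}"
      using Arg2pi[of "z / w"] by (simp add: t_def less_le)
    moreover have "z = w * exp (\<i> * of_real t)"
      using zw w by (simp add: field_simps)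
    ultimately show "z \<in> (\<lambda>t. w * exp (\<i> * of_real t)) ` {0<..<2 * pi}"
      by blast
  next
    fix z assume "z \<in> (\<lambda>t. w * exp (\<i> * of_real t)) ` {0<..<2 * pi}"
    then obtain t where t: "0 < t" "t < 2 * pi" "z = w * exp (\<i> * of_real t)"
      by auto
    have "exp (\<i> * of_real t) \<noteq> 1"
    proof
      assume "exp (\<i> * of_real t) = 1"
      then obtain n :: int where n: "t = of_int (2 * n) * pi"
        unfolding exp_eq_1 by auto
      have "0 < n" "n < 1"
        using t(1,2) unfolding n by (simp_all add: zero_less_mult_iff)
      then show False by simp
    qed
    moreover have "norm z = 1"
      using assms t(3) by (simp add: norm_mult)
    ultimately show "z \<in> sphere 0 1 - {w}"
      using t(3) assms by auto
  qed
  moreover have "connected ((\<lambda>t. w * exp (\<i> * of_real t)) ` {0<..<2 * pi})"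
    by (intro connected_continuous_image continuous_intros) auto
  ultimately show ?thesis
    by simp
qed

text \<open>Intended for the end pairs of the three edges of a face: the covering conditions say
  that each end is shared with another edge, which forces three distinct pairs to close up.\<close>

lemma three_pairs_triangle:
  assumes A: "\<exists>a b. a \<noteq> b \<and> A1 = {a, b}" "\<exists>a b. a \<noteq> b \<and> A2 = {a, b}" "\<exists>a b. a \<noteq> b \<and> A3 = {a, b}"
    and neq: "A1 \<noteq> A2" "A1 \<noteq> A3" "A2 \<noteq> A3"
    and cover: "A1 \<subseteq> A2 \<union> A3" "A2 \<subseteq> A1 \<union> A3" "A3 \<subseteq> A1 \<union> A2"
  obtains a b c where "a \<noteq> b" "b \<noteq> c" "a \<noteq> c" "A1 = {a, b}" "{A2, A3} = {{b, c}, {a, c}}"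
proof -
  obtain a b where a: "a \<noteq> b" "A1 = {a, b}" using A(1) by blast
  obtain p q where p: "p \<noteq> q" "A2 = {p, q}" using A(2) by blast
  obtain r s where r: "r \<noteq> s" "A3 = {r, s}" using A(3) by blast
  have "a \<in> {p, q} \<or> a \<in> {r, s}" "b \<in> {p, q} \<or> b \<in> {r, s}" "p \<in> {a, b} \<or> p \<in> {r, s}"
    "q \<in> {a, b} \<or> q \<in> {r, s}" "r \<in> {a, b} \<or> r \<in> {p, q}" "s \<in> {a, b} \<or> s \<in> {p, q}"
    using cover unfolding a(2) p(2) r(2) by blast+
  moreover have "\<not> (a = p \<and> b = q)" "\<not> (a = q \<and> b = p)" "\<not> (a = r \<and> b = s)" "\<not> (a = s \<and> b = r)"
    "\<not> (p = r \<and> q = s)" "\<not> (p = s \<and> q = r)"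
    using neq unfolding a(2) p(2) r(2) by blast+
  ultimately have "\<exists>c. a \<noteq> c \<and> b \<noteq> c \<and> ({p, q} = {b, c} \<and> {r, s} = {a, c} \<or> {p, q} = {a, c} \<and> {r, s} = {b, c})"
    using a(1) p(1) r(1) unfolding doubleton_eq_iff insert_iff empty_iff by metis
  then obtain c where c: "a \<noteq> c" "b \<noteq> c" "A2 = {b, c} \<and> A3 = {a, c} \<or> A2 = {a, c} \<and> A3 = {b, c}"
    unfolding p(2) r(2) by blast
  then have "{A2, A3} = {{b, c}, {a, c}}"
    by blast
  then show thesis
    using that[of a b c] a c(1,2) by blast
qed

section \<open>Edges and faces of a triangulation\<close>

locale triangulation =
  fixes G :: "'a embedded_graph"
  assumes triangulation: "surface_triangulation G"
begin

abbreviation "X \<equiv> surface G"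
abbreviation "V \<equiv> verts G"
abbreviation "E \<equiv> edges G"
abbreviation "K \<equiv> verts G \<union> \<Union>(edges G)"

lemma closed_surface: "closed_surface X"
  using triangulation by (simp add: surface_triangulation_def)

lemma Hausdorff: "Hausdorff_space X" and compact: "compact_space X"
  using closed_surface by (simp_all add: closed_surface_def)

lemma chart:
  assumes "x \<in> topspace X"
  obtains U where "openin X U" "x \<in> U" "subtopology X U homeomorphic_space (euclidean :: complex topology)"
  using closed_surface assms unfolding closed_surface_def by blast

lemma simple_graph: "embedded_simple_graph G"
  using triangulation by (simp add: surface_triangulation_def)

lemma finite_V: "finite V" and V_subset: "V \<subseteq> topspace X" and V_nonempty: "V \<noteq> {}" and finite_E: "finite E"
  using simple_graph by (simp_all add: embedded_simple_graph_def)

lemma edge_arc: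
  assumes "e \<in> E"
  obtains p where "embedding_map (top_of_set {0..1::real}) X p" "e = p ` {0..1}" "e \<inter> V = {p 0, p 1}"
proof -
  have "\<forall>e\<in>E. \<exists>p. embedding_map (top_of_set {0..1::real}) X p \<and> e = p ` {0..1} \<and> e \<inter> V = {p 0, p 1}"
    using simple_graph unfolding embedded_simple_graph_def by (elim conjE)
  from bspec[OF this assms] that show thesis
    by (elim exE conjE)
qed

lemma edges_Int: "e \<in> E \<Longrightarrow> e' \<in> E \<Longrightarrow> e \<noteq> e' \<Longrightarrow> e \<inter> e' \<subseteq> V"
  and edges_simple: "e \<in> E \<Longrightarrow> e' \<in> E \<Longrightarrow> e \<inter> V = e' \<inter> V \<Longrightarrow> e = e'"
proof -
  have *: "\<forall>e\<in>E. \<forall>e'\<in>E. e \<noteq> e' \<longrightarrow> e \<inter> e' \<subseteq> V \<and> e \<inter> V \<noteq> e' \<inter> V"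
    using simple_graph unfolding embedded_simple_graph_def by (elim conjE)
  show "e \<in> E \<Longrightarrow> e' \<in> E \<Longrightarrow> e \<noteq> e' \<Longrightarrow> e \<inter> e' \<subseteq> V"
    using * by simp
  show "e \<in> E \<Longrightarrow> e' \<in> E \<Longrightarrow> e \<inter> V = e' \<inter> V \<Longrightarrow> e = e'"
    using * by metis
qed

lemma two_faces: "e \<in> E \<Longrightarrow> card {F \<in> faces G. e \<subseteq> F} = 2"
  and disc: "F \<in> faces G \<Longrightarrow> triangular_disc G F"
  and faces_Int: "F \<in> faces G \<Longrightarrow> F' \<in> faces G \<Longrightarrow> F \<noteq> F' \<Longrightarrow>
        F \<inter> F' \<in> E \<or> (\<exists>v\<in>V. F \<inter> F' = {v}) \<or> F \<inter> F' = {}"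
  and connected: "connected_graph G"
  using triangulation unfolding surface_triangulation_def by simp_all

lemma arc_continuous:
  "embedding_map (top_of_set {0..1::real}) X p \<Longrightarrow> continuous_map (top_of_set {0..1}) X p"
  unfolding embedding_map_def using homeomorphic_imp_continuous_map continuous_map_in_subtopology by blast

lemma arc_inj: "embedding_map (top_of_set {0..1::real}) X p \<Longrightarrow> inj_on p {0..1}"
  unfolding embedding_map_def using homeomorphic_imp_injective_map by fastforce

lemma edge_ends: assumes "e \<in> E" shows "\<exists>a b. a \<noteq> b \<and> e \<inter> V = {a, b}"
proof -
  obtain p where p: "embedding_map (top_of_set {0..1::real}) X p" "e = p ` {0..1}" "e \<inter> V = {p 0, p 1}"
    using edge_arc[OF assms] .
  have "p 0 \<noteq> p 1"
    using arc_inj[OF p(1)] by (auto dest: inj_onD)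
  with p(3) show ?thesis by blast
qed

lemma edge_closed: assumes "e \<in> E" shows "closedin X e"
proof -
  obtain p where p: "embedding_map (top_of_set {0..1::real}) X p" "e = p ` {0..1}"
    using edge_arc[OF assms] .
  have "compactin (top_of_set {0..1::real}) {0..1}"
    by (simp add: compactin_subtopology)
  then have "compactin X (p ` {0..1})"
    using image_compactin arc_continuous[OF p(1)] by blast
  then show ?thesis
    using compactin_imp_closedin[OF Hausdorff] p(2) by simp
qed

lemma edge_subset: "e \<in> E \<Longrightarrow> e \<subseteq> topspace X"
  using edge_closed closedin_subset by blast

text \<open>The preimage of U under the arc is a nonempty relatively open part of the interval, so
  it meets the dense open interval, none of whose points is sent to a vertex.\<close>

lemma edge_limit:
  assumes e: "e \<in> E" and x: "x \<in> e" and U: "openin X U" "x \<in> U"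
  obtains y where "y \<in> e" "y \<in> U" "y \<notin> V"
proof -
  obtain p where p: "embedding_map (top_of_set {0..1::real}) X p" "e = p ` {0..1}" "e \<inter> V = {p 0, p 1}"
    using edge_arc[OF e] .
  obtain s where s: "s \<in> {0..1}" "x = p s"
    using x p(2) by blast
  have "openin (top_of_set {0..1}) {t \<in> {0..1}. p t \<in> U}"
    using openin_continuous_map_preimage[OF arc_continuous[OF p(1)] U(1)] by simp
  then obtain O' where O': "open O'" "{t \<in> {0..1}. p t \<in> U} = {0..1} \<inter> O'"
    unfolding openin_open by blast
  have "s \<in> O'"
    using O'(2) s U(2) by blast
  moreover have "s \<in> closure {0<..<1::real}"
    using s(1) by simp
  ultimately have "O' \<inter> {0<..<1} \<noteq> {}"
    using open_Int_closure_eq_empty[OF O'(1)] by blast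
  then obtain t where t: "t \<in> O'" "0 < t" "t < 1"
    by auto
  have "t \<in> {t \<in> {0..1}. p t \<in> U}"
    unfolding O'(2) using t by simp
  then have "p t \<in> U" "p t \<in> e"
    unfolding p(2) by simp_all
  moreover have "p t \<noteq> p 0" "p t \<noteq> p 1"
    using arc_inj[OF p(1)] t by (auto dest: inj_onD)
  then have "p t \<notin> V"
    using p(3) \<open>p t \<in> e\<close> by blast
  ultimately show thesis
    using that by blast
qed

lemma edge_interior_point:
  assumes "e \<in> E" obtains y where "y \<in> e" "y \<notin> V"
proof -
  obtain a where "a \<in> e"
    using edge_ends[OF assms] by blast
  then show thesis
    using edge_limit[OF assms _ openin_topspace] edge_subset[OF assms] that by blast
qed

lemma edge_subset_edge: "e \<in> E \<Longrightarrow> e' \<in> E \<Longrightarrow> x \<in> e \<Longrightarrow> x \<in> e' \<Longrightarrow> x \<notin> V \<Longrightarrow> e = e'"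
  using edges_Int by blast

lemma K_closed: "closedin X K"
proof -
  have "closedin X V"
    by (rule closedin_Hausdorff_finite[OF Hausdorff V_subset finite_V])
  moreover have "closedin X (\<Union>E)"
    using finite_E edge_closed by (intro closedin_Union) auto
  ultimately show ?thesis
    by (rule closedin_Un)
qed

lemma K_subset: "K \<subseteq> topspace X"
  using K_closed closedin_subset by blast

definition components :: "'a set set" where
  "components = connected_components_of (subtopology X (topspace X - K))"

lemma faces_eq: "faces G = (\<lambda>C. X closure_of C) ` components"
  by (simp add: faces_def components_def)

lemma faceE:
  assumes "F \<in> faces G" obtains C where "C \<in> components" "F = X closure_of C"
  using assms faces_eq by blast

lemma component_subset: "C \<in> components \<Longrightarrow> C \<subseteq> topspace X - K"
  using connected_components_of_subset unfolding components_def by fastforce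

lemma component_nonempty: "C \<in> components \<Longrightarrow> C \<noteq> {}"
  unfolding components_def by (rule nonempty_connected_components_of)

lemma component_connected: "C \<in> components \<Longrightarrow> connectedin X C"
  unfolding components_def using connectedin_connected_components_of connectedin_subtopology by blast

lemma Union_components: "\<Union>components = topspace X - K"
  unfolding components_def Union_connected_components_of by auto

text \<open>Components are closed in the complement of the graph, so taking the closure adds only
  points of the graph.\<close>

lemma closure_component:
  assumes "C \<in> components"
  shows "X closure_of C \<inter> (topspace X - K) = C"
proof -
  have "closedin (subtopology X (topspace X - K)) C"
    using assms closedin_connected_components_of unfolding components_def by blast
  then show ?thesis
    using component_subset[OF assms] by (simp add: closedin_Int_closure_of Int_commute)
qed

lemma face_closed: "F \<in> faces G \<Longrightarrow> closedin X F"
  using faces_eq by auto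

lemma face_subset: "F \<in> faces G \<Longrightarrow> F \<subseteq> topspace X"
  using face_closed closedin_subset by blast

lemma ex_face_with_edge:
  assumes "e \<in> E" obtains F F' where "F \<in> faces G" "e \<subseteq> F" "F' \<in> faces G" "e \<subseteq> F'" "F \<noteq> F'"
    "\<And>F''. F'' \<in> faces G \<Longrightarrow> e \<subseteq> F'' \<Longrightarrow> F'' = F \<or> F'' = F'"
proof -
  obtain F F' where "{F \<in> faces G. e \<subseteq> F} = {F, F'}" "F \<noteq> F'"
    using two_faces[OF assms] by (auto simp: card_2_iff)
  then show thesis
    using that[of F F'] by blast
qed

text \<open>Some face contains e. If it is not F, the two faces share a point that is not a vertex,
  so they meet in an edge, which has to be e.\<close>

lemma face_contains_edge:
  assumes F: "F \<in> faces G" and e: "e \<in> E" and x: "x \<in> e" "x \<notin> V" "x \<in> F"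
  shows "e \<subseteq> F"
proof -
  obtain F1 where F1: "F1 \<in> faces G" "e \<subseteq> F1"
    using ex_face_with_edge[OF e] by metis
  show ?thesis
  proof (cases "F = F1")
    case False
    have "x \<in> F \<inter> F1"
      using x F1 by blast
    then have "F \<inter> F1 \<in> E"
      using faces_Int[OF F F1(1) False] x(2) by (metis emptyE singletonD)
    then have "F \<inter> F1 = e"
      using edge_subset_edge[OF _ e \<open>x \<in> F \<inter> F1\<close> x(1,2)] by blast
    then show ?thesis
      by blast
  qed (use F1 in blast)
qed

text \<open>The bounding circle of the disc; it is identified with the frontier of the face in
  \<open>face_minus_bd\<close>.\<close>

definition bd :: "'a set \<Rightarrow> 'a set" where
  "bd F = \<Union>{e \<in> E. e \<subseteq> F}"

lemma discE:
  assumes "F \<in> faces G"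
  obtains h where "homeomorphic_map (top_of_set (cball (0::complex) 1)) (subtopology X F) h"
    "h ` sphere 0 1 = bd F" "F = h ` cball 0 1" "inj_on h (cball 0 1)"
proof -
  obtain h where h: "homeomorphic_map (top_of_set (cball (0::complex) 1)) (subtopology X F) h"
    "h ` sphere 0 1 = bd F"
    using disc[OF assms] unfolding triangular_disc_def bd_def by blast
  show thesis
    using that[OF h] homeomorphic_imp_surjective_map[OF h(1)] homeomorphic_imp_injective_map[OF h(1)]
      face_subset[OF assms] by (simp add: inf_absorb2)
qed

lemma card_face_edges: "F \<in> faces G \<Longrightarrow> card {e \<in> E. e \<subseteq> F} = 3"
  using disc unfolding triangular_disc_def by blast

text \<open>The map h is a homeomorphism only onto the subspace F. Near a point of the open disc its
  composition with a chart is a continuous injection from an open set of the plane to the plane,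
  hence open by invariance of domain.\<close>

lemma open_disc:
  assumes h: "homeomorphic_map (top_of_set (cball (0::complex) 1)) (subtopology X F) h"
  shows "openin X (h ` ball 0 1)"
proof (subst openin_subopen, intro ballI)
  fix x assume "x \<in> h ` ball 0 1"
  then obtain z where z: "z \<in> ball 0 1" "x = h z" by blast
  have cont: "continuous_map (top_of_set (cball 0 1)) X h"
    using homeomorphic_imp_continuous_map[OF h] continuous_map_in_subtopology by blast
  have inj: "inj_on h (cball 0 1)"
    using homeomorphic_imp_injective_map[OF h] by simp
  have "h z \<in> topspace X"
    using continuous_map_image_subset_topspace[OF cont] z(1) by auto
  then obtain U where U: "openin X U" "x \<in> U" "subtopology X U homeomorphic_space (euclidean :: complex topology)"
    using chart z(2) by blast
  then obtain k where k: "homeomorphic_map (subtopology X U) (euclidean :: complex topology) k"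
    unfolding homeomorphic_space by blast
  define W where "W = {z \<in> ball 0 1. h z \<in> U}"
  have "openin (top_of_set (cball 0 1)) {z \<in> cball 0 1. h z \<in> U}"
    using openin_continuous_map_preimage[OF cont U(1)] by simp
  then obtain O' where O': "open O'" "{z \<in> cball 0 1. h z \<in> U} = cball 0 1 \<inter> O'"
    unfolding openin_open by blast
  have "W = ball 0 1 \<inter> {z \<in> cball 0 1. h z \<in> U}"
    unfolding W_def using ball_subset_cball by blast
  also have "\<dots> = ball 0 1 \<inter> O'"
    unfolding O'(2) using ball_subset_cball by blast
  finally have "W = ball 0 1 \<inter> O'" .
  then have "open W"
    using O'(1) by auto
  have WU: "h ` W \<subseteq> topspace (subtopology X U)"
    using openin_subset[OF U(1)] unfolding W_def by auto
  have "continuous_map (top_of_set W) X h"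
    by (rule continuous_map_from_subtopology_mono[OF cont]) (auto simp: W_def)
  then have "continuous_map (top_of_set W) (subtopology X U) h"
    unfolding continuous_map_in_subtopology by (auto simp: W_def)
  then have "continuous_map (top_of_set W) euclidean (k \<circ> h)"
    using continuous_map_compose homeomorphic_imp_continuous_map[OF k] by blast
  then have "continuous_on W (k \<circ> h)"
    by simp
  moreover have "inj_on (k \<circ> h) W"
  proof (rule comp_inj_on)
    show "inj_on h W"
      by (rule inj_on_subset[OF inj]) (auto simp: W_def)
    show "inj_on k (h ` W)"
      by (rule inj_on_subset[OF homeomorphic_imp_injective_map[OF k] WU])
  qed
  ultimately have "open (k ` h ` W)"
    using invariance_of_domain[of W "k \<circ> h"] \<open>open W\<close> by (simp add: image_comp)
  then have "openin (subtopology X U) (h ` W)"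
    using homeomorphic_map_openness[OF k WU] by simp
  then have "openin X (h ` W)"
    using openin_open_subtopology[OF U(1)] by blast
  moreover have "x \<in> h ` W"
    using z U(2) unfolding W_def by blast
  moreover have "h ` W \<subseteq> h ` ball 0 1"
    unfolding W_def by blast
  ultimately show "\<exists>T. openin X T \<and> x \<in> T \<and> T \<subseteq> h ` ball 0 1"
    by blast
qed

text \<open>Without edges a connected graph is a single vertex. Either it fills the surface, and a
  point would be homeomorphic to the plane, or there is a face, and a face has three edges.\<close>

lemma edges_nonempty: "E \<noteq> {}"
proof
  assume E: "E = {}"
  obtain v where v: "v \<in> V"
    using V_nonempty by blast
  have "u = v" if "u \<in> V" for u
  proof -
    have "(u, v) \<in> {(x, y). \<exists>e\<in>E. e \<inter> V = {x, y}}\<^sup>*"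
      using connected that v unfolding connected_graph_def by blast
    then show ?thesis
      unfolding E by simp
  qed
  then have V: "V = {v}"
    using v by blast
  show False
  proof (cases "components = {}")
    case True
    then have "topspace X = {v}"
      using Union_components K_subset unfolding E V by auto
    moreover obtain U where U: "openin X U" "v \<in> U" "subtopology X U homeomorphic_space (euclidean :: complex topology)"
      using chart v V_subset by blast
    ultimately have "topspace (subtopology X U) = {v}"
      using openin_subset[OF U(1)] by auto
    moreover obtain k where "homeomorphic_map (subtopology X U) (euclidean :: complex topology) k"
      using U(3) unfolding homeomorphic_space by blast
    ultimately have "k ` {v} = (UNIV :: complex set)"
      using homeomorphic_imp_surjective_map by fastforce
    then have "(0::complex) \<in> k ` {v}" "(1::complex) \<in> k ` {v}"
      by simp_all
    then show False
      by (metis imageE singletonD zero_neq_one)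
  next
    case False
    then obtain F where "F \<in> faces G"
      using faces_eq by blast
    then show False
      using card_face_edges[of F] unfolding E by simp
  qed
qed

text \<open>Some edge has an end other than v, and a path in the graph from v to that end starts
  with an edge at v.\<close>

lemma vertex_on_edge:
  assumes "v \<in> V" obtains e where "e \<in> E" "v \<in> e"
proof -
  obtain e where e: "e \<in> E"
    using edges_nonempty by blast
  obtain a b where ab: "a \<noteq> b" "e \<inter> V = {a, b}"
    using edge_ends[OF e] by blast
  have "a \<in> V" "b \<in> V"
    using ab(2) by blast+
  then obtain u where u: "u \<in> V" "u \<noteq> v"
    using ab(1) by metis
  have "(v, u) \<in> {(x, y). \<exists>e\<in>E. e \<inter> V = {x, y}}\<^sup>*"
    using connected assms u(1) unfolding connected_graph_def by blast
  then show thesis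
  proof (cases rule: converse_rtranclE)
    case (step y)
    then show thesis using that by blast
  qed (use u in blast)
qed

text \<open>By invariance of domain, a vertex inside the disc would drag the interior of an edge at it into
  the open disc.\<close>

lemma face_Int_K: assumes F: "F \<in> faces G" shows "F \<inter> K = bd F"
proof (intro equalityI subsetI)
  fix x assume "x \<in> bd F"
  then show "x \<in> F \<inter> K"
    unfolding bd_def by blast
next
  fix x assume x: "x \<in> F \<inter> K"
  obtain h where h: "homeomorphic_map (top_of_set (cball (0::complex) 1)) (subtopology X F) h" "h ` sphere 0 1 = bd F"
    and Fh: "F = h ` cball 0 1" and inj: "inj_on h (cball 0 1)"
    using discE[OF F] .
  show "x \<in> bd F"
  proof (cases "x \<in> V")
    case False
    then obtain e where "e \<in> E" "x \<in> e"
      using x by blast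
    then have "e \<subseteq> F"
      using face_contains_edge[OF F] False x by blast
    then show ?thesis
      unfolding bd_def using \<open>e \<in> E\<close> \<open>x \<in> e\<close> by blast
  next
    case True
    show ?thesis
    proof (rule ccontr)
      assume "x \<notin> bd F"
      have "x \<in> h ` ball 0 1"
      proof -
        obtain z where z: "z \<in> cball 0 1" "x = h z"
          using x Fh by blast
        then have "z \<notin> sphere 0 1"
          using h(2) \<open>x \<notin> bd F\<close> by blast
        then have "z \<in> ball 0 1"
          using z(1) by simp
        then show ?thesis
          using z(2) by blast
      qed
      moreover obtain e where e: "e \<in> E" "x \<in> e"
        using vertex_on_edge[OF True] .
      ultimately obtain y where y: "y \<in> e" "y \<in> h ` ball 0 1" "y \<notin> V"
        using edge_limit[OF _ _ open_disc[OF h(1)]] by metis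
      have "y \<in> F"
        using y(2) Fh ball_subset_cball by blast
      then have "e \<subseteq> F"
        using face_contains_edge[OF F e(1) y(1,3)] by blast
      then have "y \<in> h ` sphere 0 1"
        unfolding h(2) bd_def using e(1) y(1) by blast
      then obtain z z' where "z \<in> ball 0 1" "z' \<in> sphere 0 1" "h z = h z'"
        using y(2) by force
      then show False
        using inj_onD[OF inj, of z z'] by simp
    qed
  qed
qed

text \<open>Removing the graph from the closure of a component gives the component back, so the
  component is F without \<open>bd F\<close>, and it is open by \<open>open_disc\<close>. The second
  face at each edge keeps boundary points out of the interior.\<close>

lemma face_minus_bd:
  assumes F: "F \<in> faces G"
  shows "F - bd F \<in> components" "openin X (F - bd F)" "F = X closure_of (F - bd F)"
    "X interior_of F = F - bd F" "X frontier_of F = bd F"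
proof -
  obtain C where C: "C \<in> components" "F = X closure_of C"
    using faceE[OF F] .
  have "F - bd F = X closure_of C \<inter> (topspace X - K)"
    using face_Int_K[OF F] face_subset[OF F] C(2) by blast
  then have FC: "F - bd F = C"
    using closure_component[OF C(1)] by simp
  show "F - bd F \<in> components" "F = X closure_of (F - bd F)"
    unfolding FC by (fact C)+
  obtain h where h: "homeomorphic_map (top_of_set (cball (0::complex) 1)) (subtopology X F) h" "h ` sphere 0 1 = bd F"
    and Fh: "F = h ` cball 0 1" and inj: "inj_on h (cball 0 1)"
    using discE[OF F] .
  have "h ` ball 0 1 = h ` (cball 0 1 - sphere 0 1)"
    by (rule arg_cong[where f = "image h"]) auto
  also have "\<dots> = F - bd F"
    unfolding Fh h(2)[symmetric, unfolded Fh] by (rule inj_on_image_set_diff[OF inj]) auto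
  finally show open_C: "openin X (F - bd F)"
    using open_disc[OF h(1)] by simp
  show int: "X interior_of F = F - bd F"
  proof
    show "F - bd F \<subseteq> X interior_of F"
      by (rule interior_of_maximal[OF _ open_C]) blast
    show "X interior_of F \<subseteq> F - bd F"
    proof
      fix x assume x: "x \<in> X interior_of F"
      have xF: "x \<in> F"
        using x interior_of_subset by (metis subsetD)
      have "x \<notin> bd F"
      proof
        assume "x \<in> bd F"
        then obtain e where e: "e \<in> E" "e \<subseteq> F" "x \<in> e"
          unfolding bd_def by blast
        \<comment> \<open>The point x is also a limit of the component of the second face at e; were
          x interior to F, the two faces would share a point off the graph.\<close>
        obtain F2 where F2: "F2 \<in> faces G" "e \<subseteq> F2" "F2 \<noteq> F"
          using ex_face_with_edge[OF e(1)] by metis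
        obtain C2 where C2: "C2 \<in> components" "F2 = X closure_of C2"
          using faceE[OF F2(1)] .
        have "x \<in> X closure_of C2"
          using e(3) F2(2) C2(2) by blast
        then have "X interior_of F \<inter> C2 \<noteq> {}"
          using x openin_interior_of[of X F] unfolding in_closure_of by blast
        then obtain z where z: "z \<in> F" "z \<in> C2"
          using interior_of_subset[of X F] by blast
        have zK: "z \<notin> K"
          using component_subset[OF C2(1)] z(2) by blast
        have zF: "z \<in> F \<inter> F2"
          using z C2 closure_of_subset[of C2 X] component_subset[OF C2(1)] by blast
        from faces_Int[OF F F2(1)] F2(3) consider "F \<inter> F2 \<in> E" | v where "v \<in> V" "F \<inter> F2 = {v}" | "F \<inter> F2 = {}"
          by metis
        then show False
        proof cases
          case 1
          then show False using zF zK by blast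
        next
          case 2
          then show False using zF zK by (metis UnI1 singletonD)
        next
          case 3
          then show False using zF by blast
        qed
      qed
      with xF show "x \<in> F - bd F" by blast
    qed
  qed
  have "bd F \<subseteq> F"
    unfolding bd_def by blast
  then show "X frontier_of F = bd F"
    unfolding frontier_of_def int closure_of_closedin[OF face_closed[OF F]] by blast
qed

lemma component_face: "C \<in> components \<Longrightarrow> X closure_of C \<in> faces G"
  using faces_eq by blast

lemma component_open: assumes "C \<in> components" shows "openin X C"
proof -
  have F: "X closure_of C \<in> faces G"
    by (rule component_face[OF assms])
  have "X closure_of C - bd (X closure_of C) = X closure_of C \<inter> (topspace X - K)"
    using face_Int_K[OF F] face_subset[OF F] by blast
  then show ?thesis
    using face_minus_bd(2)[OF F] closure_component[OF assms] by simp
qed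

text \<open>If no other edge of F passed through u, removing the other end w of e from the bounding
  circle would separate e from the remaining edges; but a circle minus a point is connected.\<close>

lemma face_edge_end_shared:
  assumes F: "F \<in> faces G" and e: "e \<in> E" "e \<subseteq> F" and u: "u \<in> e \<inter> V"
  shows "\<exists>e'\<in>E. e' \<subseteq> F \<and> e' \<noteq> e \<and> u \<in> e'"
proof (rule ccontr)
  assume contr: "\<not> ?thesis"
  obtain a b where ab: "a \<noteq> b" "e \<inter> V = {a, b}"
    using edge_ends[OF e(1)] by blast
  have "u \<in> {a, b}"
    using u unfolding ab(2) .
  then obtain w where w: "e \<inter> V = {u, w}" "w \<noteq> u"
    using ab by (metis insert_commute insertE singletonD)
  obtain h where h: "homeomorphic_map (top_of_set (cball (0::complex) 1)) (subtopology X F) h" "h ` sphere 0 1 = bd F"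
    and Fh: "F = h ` cball 0 1" and inj: "inj_on h (cball 0 1)"
    using discE[OF F] .
  have cont: "continuous_map (top_of_set (cball 0 1)) X h"
    using homeomorphic_imp_continuous_map[OF h(1)] continuous_map_in_subtopology by blast
  have "w \<in> e \<inter> V"
    unfolding w(1) by simp
  then have we: "w \<in> e" "w \<in> V"
    by blast+
  then have "w \<in> bd F"
    unfolding bd_def using e by blast
  then have "w \<in> h ` sphere 0 1"
    unfolding h(2) .
  then obtain z where z: "z \<in> sphere 0 1" "h z = w"
    by blast
  have "connectedin (top_of_set (cball 0 1)) (sphere 0 1 - {z})"
    using connected_punctured_circle[of z] z(1) by (auto simp: connectedin_subtopology)
  then have "connectedin X (h ` (sphere 0 1 - {z}))"
    by (rule connectedin_continuous_map_image[OF cont])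
  moreover have "h ` (sphere 0 1 - {z}) = bd F - {w}"
  proof -
    have "h ` (sphere 0 1 - {z}) = h ` sphere 0 1 - h ` {z}"
      by (rule inj_on_image_set_diff[OF inj]) (use z(1) in auto)
    then show ?thesis
      using h(2) z(2) by simp
  qed
  ultimately have conn: "connectedin X (bd F - {w})"
    by simp
  define R where "R = \<Union>({e' \<in> E. e' \<subseteq> F} - {e})"
  have "closedin X R"
    unfolding R_def using finite_E edge_closed by (intro closedin_Union) auto
  moreover have "closedin X e"
    by (rule edge_closed[OF e(1)])
  moreover have "bd F - {w} \<subseteq> e \<union> R"
    unfolding bd_def R_def by blast
  moreover have "e \<inter> R \<inter> (bd F - {w}) = {}"
  proof -
    have "x = w" if x: "x \<in> e" "x \<in> R" for x
    proof -
      obtain e' where e': "e' \<in> E" "e' \<subseteq> F" "e' \<noteq> e" "x \<in> e'"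
        using x(2) unfolding R_def by blast
      then have "x \<in> e \<inter> V"
        using edges_Int[OF e(1) e'(1)] x(1) by blast
      then have "x = u \<or> x = w"
        unfolding w(1) by simp
      then show "x = w"
        using contr e' by blast
    qed
    then show ?thesis by blast
  qed
  moreover have "e \<inter> (bd F - {w}) \<noteq> {}"
  proof -
    have "u \<in> e \<inter> (bd F - {w})"
      unfolding bd_def using u e w(2) by blast
    then show ?thesis by blast
  qed
  moreover have "R \<inter> (bd F - {w}) \<noteq> {}"
  proof -
    have "{e' \<in> E. e' \<subseteq> F} \<noteq> {e}"
      using card_face_edges[OF F] by (auto simp del: Collect_conj_eq)
    then obtain e' where e': "e' \<in> E" "e' \<subseteq> F" "e' \<noteq> e"
      using e by blast
    obtain y where "y \<in> e'" "y \<notin> V"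
      using edge_interior_point[OF e'(1)] .
    then have "y \<in> R \<inter> (bd F - {w})"
      unfolding R_def bd_def using e' we(2) by blast
    then show ?thesis by blast
  qed
  ultimately show False
    using conn unfolding connectedin_closedin by blast
qed

lemma face_triangle:
  assumes F: "F \<in> faces G"
  obtains a b c e1 e2 e3 where "a \<noteq> b" "b \<noteq> c" "a \<noteq> c" "F \<inter> V = {a, b, c}"
    "{e \<in> E. e \<subseteq> F} = {e1, e2, e3}" "e1 \<inter> V = {a, b}" "e2 \<inter> V = {b, c}" "e3 \<inter> V = {a, c}"
proof -
  obtain e1 e2 e3 where es: "{e \<in> E. e \<subseteq> F} = {e1, e2, e3}" "e1 \<noteq> e2" "e1 \<noteq> e3" "e2 \<noteq> e3"
    using card_face_edges[OF F] unfolding card_3_iff by blast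
  have "e1 \<in> {e \<in> E. e \<subseteq> F}" "e2 \<in> {e \<in> E. e \<subseteq> F}" "e3 \<in> {e \<in> E. e \<subseteq> F}"
    unfolding es(1) by simp_all
  then have E: "e1 \<in> E" "e1 \<subseteq> F" "e2 \<in> E" "e2 \<subseteq> F" "e3 \<in> E" "e3 \<subseteq> F"
    by simp_all
  have cover: "e \<inter> V \<subseteq> \<Union>((\<lambda>e. e \<inter> V) ` ({e1, e2, e3} - {e}))" if e: "e \<in> E" "e \<subseteq> F" for e
  proof
    fix u assume u: "u \<in> e \<inter> V"
    obtain e' where e': "e' \<in> E" "e' \<subseteq> F" "e' \<noteq> e" "u \<in> e'"
      using face_edge_end_shared[OF F e u] by blast
    have "e' \<in> {e \<in> E. e \<subseteq> F}"
      using e' by simp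
    then have "e' \<in> {e1, e2, e3} - {e}"
      unfolding es(1) using e'(3) by simp
    moreover have "u \<in> e' \<inter> V"
      using e' u by blast
    ultimately show "u \<in> \<Union>((\<lambda>e. e \<inter> V) ` ({e1, e2, e3} - {e}))"
      by (rule UN_I)
  qed
  have cov: "e1 \<inter> V \<subseteq> e2 \<inter> V \<union> e3 \<inter> V" "e2 \<inter> V \<subseteq> e1 \<inter> V \<union> e3 \<inter> V" "e3 \<inter> V \<subseteq> e1 \<inter> V \<union> e2 \<inter> V"
    using cover[OF E(1,2)] cover[OF E(3,4)] cover[OF E(5,6)] by blast+
  have neq: "e1 \<inter> V \<noteq> e2 \<inter> V" "e1 \<inter> V \<noteq> e3 \<inter> V" "e2 \<inter> V \<noteq> e3 \<inter> V"
    using es(2-4) edges_simple[OF E(1,3)] edges_simple[OF E(1,5)] edges_simple[OF E(3,5)] by metis+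
  obtain a b c where abc: "a \<noteq> b" "b \<noteq> c" "a \<noteq> c" "e1 \<inter> V = {a, b}"
    "{e2 \<inter> V, e3 \<inter> V} = {{b, c}, {a, c}}"
    by (rule three_pairs_triangle[OF edge_ends[OF E(1)] edge_ends[OF E(3)] edge_ends[OF E(5)] neq cov])
  have "F \<inter> V \<subseteq> bd F"
    using face_Int_K[OF F] by blast
  then have "F \<inter> V \<subseteq> e1 \<union> e2 \<union> e3"
    unfolding bd_def es(1) by (simp add: Un_assoc)
  then have FV: "F \<inter> V = (e1 \<inter> V) \<union> (e2 \<inter> V) \<union> (e3 \<inter> V)"
    using E by blast
  have "e2 \<inter> V = {b, c} \<and> e3 \<inter> V = {a, c} \<or> e2 \<inter> V = {a, c} \<and> e3 \<inter> V = {b, c}"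
    using abc(5) unfolding doubleton_eq_iff[of "e2 \<inter> V"] .
  then consider "e2 \<inter> V = {b, c}" "e3 \<inter> V = {a, c}" | "e2 \<inter> V = {a, c}" "e3 \<inter> V = {b, c}"
    by metis
  then show thesis
  proof cases
    case 1
    have "F \<inter> V = {a, b, c}"
      unfolding FV abc(4) 1 by auto
    from that[OF abc(1-3) this es(1) abc(4) 1] show thesis .
  next
    case 2
    have "{e \<in> E. e \<subseteq> F} = {e1, e3, e2}"
      unfolding es(1) by (simp add: insert_commute)
    moreover have "F \<inter> V = {a, b, c}"
      unfolding FV abc(4) 2 by auto
    ultimately show thesis
      using that[OF abc(1-3) _ _ abc(4) 2(2,1)] by simp
  qed
qed

lemma face_card: "F \<in> faces G \<Longrightarrow> card (F \<inter> V) = 3"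
  by (rule face_triangle[of F]) auto

lemma face_edge:
  assumes F: "F \<in> faces G" and ab: "a \<in> F \<inter> V" "b \<in> F \<inter> V" "a \<noteq> b"
  shows "\<exists>e\<in>E. e \<subseteq> F \<and> e \<inter> V = {a, b}"
proof -
  obtain x y z e1 e2 e3 where xyz: "x \<noteq> y" "y \<noteq> z" "x \<noteq> z" "F \<inter> V = {x, y, z}"
    "{e \<in> E. e \<subseteq> F} = {e1, e2, e3}" "e1 \<inter> V = {x, y}" "e2 \<inter> V = {y, z}" "e3 \<inter> V = {x, z}"
    using face_triangle[OF F] .
  have "{a, b} = {x, y} \<or> {a, b} = {y, z} \<or> {a, b} = {x, z}"
    using ab unfolding xyz(4) doubleton_eq_iff insert_iff empty_iff by metis
  moreover have "e1 \<in> {e \<in> E. e \<subseteq> F}" "e2 \<in> {e \<in> E. e \<subseteq> F}" "e3 \<in> {e \<in> E. e \<subseteq> F}"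
    unfolding xyz(5) by simp_all
  then have "e1 \<in> E \<and> e1 \<subseteq> F" "e2 \<in> E \<and> e2 \<subseteq> F" "e3 \<in> E \<and> e3 \<subseteq> F"
    by simp_all
  ultimately show ?thesis
    using xyz(6-8) by metis
qed

text \<open>Any two vertices of F are joined by an edge of F, and a simple graph has no other edge
  with these ends.\<close>

lemma incidence:
  assumes e: "e \<in> E" and F: "F \<in> faces G"
  shows "e \<subseteq> F \<longleftrightarrow> e \<inter> V \<subseteq> F"
proof
  assume sub: "e \<inter> V \<subseteq> F"
  obtain a b where ab: "a \<noteq> b" "e \<inter> V = {a, b}"
    using edge_ends[OF e] by blast
  have "a \<in> e \<inter> V" "b \<in> e \<inter> V"
    unfolding ab(2) by simp_all
  then have "a \<in> F \<inter> V" "b \<in> F \<inter> V"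
    using sub by blast+
  then obtain e' where "e' \<in> E" "e' \<subseteq> F" "e' \<inter> V = {a, b}"
    using face_edge[OF F _ _ ab(1)] by metis
  then show "e \<subseteq> F"
    using edges_simple[OF e] ab(2) by metis
qed blast

text \<open>Distinct faces meet in an edge, a vertex or not at all, so they have at most two common
  vertices.\<close>

lemma simple_faces:
  assumes "F \<in> faces G" "F' \<in> faces G" "F \<inter> V = F' \<inter> V"
  shows "F = F'"
proof (rule ccontr)
  assume neq: "F \<noteq> F'"
  obtain a b c where abc: "a \<noteq> b" "b \<noteq> c" "a \<noteq> c" "F \<inter> V = {a, b, c}"
    by (rule face_triangle[OF assms(1)])
  have "{a, b, c} \<subseteq> F \<inter> V" "{a, b, c} \<subseteq> F' \<inter> V"
    using assms(3) abc(4) by simp_all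
  then have sub: "{a, b, c} \<subseteq> F \<inter> F' \<inter> V"
    by blast
  consider "F \<inter> F' \<in> E" | v where "F \<inter> F' = {v}" | "F \<inter> F' = {}"
    using faces_Int[OF assms(1,2) neq] by metis
  then show False
  proof cases
    case 1
    then obtain x y where xy: "F \<inter> F' \<inter> V = {x, y}"
      using edge_ends by metis
    show False
      using sub abc(1-3) unfolding xy by auto
  next
    case 2
    show False
      using sub abc(1-3) unfolding 2 by auto
  next
    case 3
    show False
      using sub unfolding 3 by simp
  qed
qed

text \<open>The flag following abc comes from the second face at the edge bc; its third vertex
  differs from a because a face is determined by its vertices.\<close>

lemma graph_model:
  assumes l: "inj_on l V"
  shows "graph_model G l"
proof
  let ?T = "(\<lambda>F. l ` (F \<inter> V)) ` faces G"
  have image_eq: "l ` A = l ` B \<longleftrightarrow> A = B" if "A \<subseteq> V" "B \<subseteq> V" for A B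
    using inj_on_image_eq_iff[OF l that] .
  show "triangle_complex ?T"
    unfolding triangle_complex_def
  proof (intro conjI allI impI ballI)
    have "?T \<subseteq> Pow (l ` V)"
      by blast
    then show "finite ?T"
      using finite_V finite_subset by blast
    show "card t = 3" if t: "t \<in> ?T" for t
    proof -
      obtain F where F: "F \<in> faces G" "t = l ` (F \<inter> V)"
        using t by blast
      have "card t = card (F \<inter> V)"
        unfolding F(2) by (rule card_image) (rule inj_on_subset[OF l], blast)
      then show ?thesis
        using face_card[OF F(1)] by simp
    qed
    fix x y z assume xyz: "(x, y, z) \<in> flags ?T"
    then have "{x, y, z} \<in> ?T"
      by (simp only: flags_iff)
    then obtain F where F: "F \<in> faces G" "{x, y, z} = l ` (F \<inter> V)"
      by (rule imageE)
    have "x \<in> l ` (F \<inter> V)" "y \<in> l ` (F \<inter> V)" "z \<in> l ` (F \<inter> V)"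
      unfolding F(2)[symmetric] by simp_all
    then obtain a b c where abc: "a \<in> F \<inter> V" "b \<in> F \<inter> V" "c \<in> F \<inter> V" "x = l a" "y = l b" "z = l c"
      by blast
    have neq: "a \<noteq> b" "b \<noteq> c" "a \<noteq> c"
      using xyz abc unfolding flags_iff by blast+
    have "l ` (F \<inter> V) = l ` {a, b, c}"
      using F(2) abc by simp
    then have FV: "F \<inter> V = {a, b, c}"
      using image_eq[of "F \<inter> V" "{a, b, c}"] abc(1-3) by simp
    obtain e where e: "e \<in> E" "e \<subseteq> F" "e \<inter> V = {b, c}"
      using face_edge[OF F(1) abc(2,3) neq(2)] by blast
    obtain F' where F': "F' \<in> faces G" "e \<subseteq> F'" "F' \<noteq> F"
      "\<And>F''. F'' \<in> faces G \<Longrightarrow> e \<subseteq> F'' \<Longrightarrow> F'' = F \<or> F'' = F'"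
      using ex_face_with_edge[OF e(1)] e(2) F(1) by metis
    have "b \<in> e \<inter> V" "c \<in> e \<inter> V"
      unfolding e(3) by simp_all
    then have bc: "b \<in> F' \<inter> V" "c \<in> F' \<inter> V"
      using F'(2) by blast+
    have "card (F' \<inter> V - {b, c}) = 1"
      using face_card[OF F'(1)] bc neq(2) by (simp add: card_Diff_subset)
    then obtain d where d: "F' \<inter> V - {b, c} = {d}"
      by (auto simp: card_1_singleton_iff)
    then have "d \<in> F' \<inter> V - {b, c}"
      by simp
    then have dbc: "d \<noteq> b" "d \<noteq> c" and dV: "d \<in> V"
      by simp_all
    have "F' \<inter> V = {b, c} \<union> (F' \<inter> V - {b, c})"
      using bc by blast
    then have F'V: "F' \<inter> V = {b, c, d}"
      unfolding d by auto
    have "d \<noteq> a"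
    proof
      assume "d = a"
      then have "F' \<inter> V = F \<inter> V"
        unfolding F'V FV by (simp add: insert_commute)
      then show False
        using simple_faces[OF F'(1) F(1)] F'(3) by metis
    qed
    have l_eq: "l p = l q \<longleftrightarrow> p = q" if "p \<in> V" "q \<in> V" for p q
      using l that by (auto dest: inj_onD)
    have V: "a \<in> V" "b \<in> V" "c \<in> V"
      using abc by blast+
    show "\<exists>!w. w \<noteq> x \<and> (y, z, w) \<in> flags ?T"
    proof (rule ex1I[of _ "l d"])
      have "{l b, l c, l d} = l ` (F' \<inter> V)"
        unfolding F'V by simp
      then have "{l b, l c, l d} \<in> ?T"
        by (rule image_eqI[OF _ F'(1)])
      then show "l d \<noteq> x \<and> (y, z, l d) \<in> flags ?T"
        unfolding flags_iff abc using neq dbc \<open>d \<noteq> a\<close> l_eq V dV by metis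
      fix w assume w: "w \<noteq> x \<and> (y, z, w) \<in> flags ?T"
      then have "{y, z, w} \<in> ?T"
        by (simp only: flags_iff)
      then obtain F2 where F2: "F2 \<in> faces G" "{y, z, w} = l ` (F2 \<inter> V)"
        by (rule imageE)
      have "w \<in> l ` (F2 \<inter> V)"
        unfolding F2(2)[symmetric] by simp
      then obtain d2 where d2: "d2 \<in> F2 \<inter> V" "w = l d2"
        by blast
      have "l ` (F2 \<inter> V) = l ` {b, c, d2}"
        using F2(2) abc d2 by simp
      then have F2V: "F2 \<inter> V = {b, c, d2}"
        using image_eq[of "F2 \<inter> V" "{b, c, d2}"] abc(1-3) d2(1) by simp
      have "e \<inter> V \<subseteq> F2 \<inter> V"
        unfolding F2V e(3) by simp
      then have "e \<inter> V \<subseteq> F2"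
        by blast
      then have "e \<subseteq> F2"
        using incidence[OF e(1) F2(1)] by blast
      moreover have "F2 \<noteq> F"
      proof
        assume "F2 = F"
        then have "a \<in> {b, c, d2}"
          using F2V abc(1) by simp
        then have "a = d2"
          using neq by simp
        then show False
          using w d2(2) abc(4) by simp
      qed
      ultimately have "F2 = F'"
        using F'(4)[OF F2(1)] by blast
      moreover have "d2 \<noteq> b" "d2 \<noteq> c"
        using w d2(2) abc(5,6) by (auto simp only: flags_iff)
      moreover have "d2 \<in> F2 \<inter> V"
        by (rule d2(1))
      ultimately have "d2 = d"
        using F'V by simp
      then show "w = l d"
        using d2(2) by simp
    qed
  qed
  show "inj_on l V"
    by (rule l)
  show "\<exists>e\<in>E. e \<inter> V = {a, b}" if "F \<in> faces G" "a \<in> F \<inter> V" "b \<in> F \<inter> V" "a \<noteq> b" for F a b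
    using face_edge[OF that] by blast
qed (fact edge_ends edges_simple face_card simple_faces incidence)+

end

section \<open>The connected sum\<close>
text \<open>The union of the other members is open, so a component that meets a member cannot extend
  beyond it.\<close>

lemma connected_components_of_eqI:
  assumes op: "\<And>C. C \<in> \<C> \<Longrightarrow> openin Z C" and conn: "\<And>C. C \<in> \<C> \<Longrightarrow> connectedin Z C"
    and ne: "\<And>C. C \<in> \<C> \<Longrightarrow> C \<noteq> {}"
    and disj: "\<And>C D. C \<in> \<C> \<Longrightarrow> D \<in> \<C> \<Longrightarrow> C \<noteq> D \<Longrightarrow> C \<inter> D = {}"
    and cover: "\<Union>\<C> = topspace Z"
  shows "connected_components_of Z = \<C>"
proof -
  have eq: "D = C" if D: "D \<in> connected_components_of Z" and C: "C \<in> \<C>" and x: "x \<in> D" "x \<in> C" for D C x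
  proof
    have "\<not> disjnt D C"
      using x unfolding disjnt_iff by blast
    then show "C \<subseteq> D"
      by (rule connected_components_of_maximal[OF D conn[OF C]])
    have "openin Z (\<Union>(\<C> - {C}))"
      using op by (intro openin_Union) blast
    moreover have "D \<subseteq> C \<union> \<Union>(\<C> - {C})"
      using connected_components_of_subset[OF D] unfolding cover[symmetric] by blast
    moreover have "C \<inter> \<Union>(\<C> - {C}) \<inter> D = {}"
      using disj[OF C] by blast
    moreover have "C \<inter> D \<noteq> {}"
      using x by blast
    ultimately have "\<Union>(\<C> - {C}) \<inter> D = {}"
      using connectedin_connected_components_of[OF D] op[OF C] unfolding connectedin by metis
    then show "D \<subseteq> C"
      using \<open>D \<subseteq> C \<union> \<Union>(\<C> - {C})\<close> by blast
  qed
  show ?thesis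
  proof
    show "connected_components_of Z \<subseteq> \<C>"
    proof
      fix D assume D: "D \<in> connected_components_of Z"
      obtain x where x: "x \<in> D"
        using nonempty_connected_components_of[OF D] by blast
      then have "x \<in> \<Union>\<C>"
        using connected_components_of_subset[OF D] unfolding cover by blast
      then obtain C where "C \<in> \<C>" "x \<in> C"
        by blast
      then show "D \<in> \<C>"
        using eq[OF D _ x] by blast
    qed
    show "\<C> \<subseteq> connected_components_of Z"
    proof
      fix C assume C: "C \<in> \<C>"
      obtain x where x: "x \<in> C"
        using ne[OF C] by blast
      then have "x \<in> topspace Z"
        using C unfolding cover[symmetric] by blast
      then have "x \<in> \<Union>(connected_components_of Z)"
        unfolding Union_connected_components_of .
      then obtain D where "D \<in> connected_components_of Z" "x \<in> D"
        by blast
      then show "C \<in> connected_components_of Z"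
        using eq[OF _ C _ x] by blast
    qed
  qed
qed

lemma openin_subtopology_Diff:
  assumes "closedin X T" "A \<subseteq> topspace X"
  shows "openin (subtopology X A) (A - T)"
proof -
  have "A - T = A \<inter> (topspace X - T)"
    using assms(2) by blast
  then show ?thesis
    using openin_subtopology_Int2[of X "topspace X - T" A] assms(1) by (simp add: openin_diff)
qed

context triangulation
begin

lemma edge_minus_V_connected:
  assumes "e \<in> E"
  shows "connectedin X (e - V)"
proof -
  obtain p where p: "embedding_map (top_of_set {0..1::real}) X p" "e = p ` {0..1}" "e \<inter> V = {p 0, p 1}"
    using edge_arc[OF assms] .
  have "e - V = e - (e \<inter> V)"
    by blast
  also have "\<dots> = p ` {0..1} - p ` {0, 1}"
    unfolding p(3) unfolding p(2) by simp
  also have "\<dots> = p ` ({0..1} - {0, 1})"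
    by (rule inj_on_image_set_diff[OF arc_inj[OF p(1)], symmetric]) auto
  also have "{0..1} - {0, 1} = {0<..<1::real}"
    by auto
  finally have "e - V = p ` {0<..<1}" .
  moreover have "connectedin (top_of_set {0..1::real}) {0<..<1}"
    by (auto simp: connectedin_subtopology)
  ultimately show ?thesis
    using connectedin_continuous_map_image[OF arc_continuous[OF p(1)]] by simp
qed

lemma bd_closed: "closedin X (bd F)"
  unfolding bd_def using finite_E edge_closed by (intro closedin_Union) auto

lemma bd_subset: "bd F \<subseteq> topspace X"
  using bd_closed closedin_subset by blast

lemma bd_subset_face: "bd F \<subseteq> F"
  unfolding bd_def by blast

lemma bd_subset_K: "bd F \<subseteq> K"
  unfolding bd_def by blast

lemma face_Int_V_bd: "F \<in> faces G \<Longrightarrow> F \<inter> V \<subseteq> bd F"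
  using face_Int_K by blast

lemma edge_subset_bd: "e \<in> E \<Longrightarrow> e \<subseteq> F \<Longrightarrow> e \<subseteq> bd F"
  unfolding bd_def by blast

end

section \<open>The homeomorphism between the boundaries of two faces\<close>

locale boundary_map =
  A: triangulation G + B: triangulation G'
  for G :: "'a embedded_graph" and G' :: "'b embedded_graph" +
  fixes F :: "'a set" and F' :: "'b set" and g :: "'a \<Rightarrow> 'b"
  assumes F: "F \<in> faces G" and F': "F' \<in> faces G'"
    and special: "special_homeomorphism G F G' F' g"
begin

lemma homeo: "homeomorphic_map (subtopology (surface G) (A.bd F)) (subtopology (surface G') (B.bd F')) g"
  using special unfolding special_homeomorphism_def A.face_minus_bd(5)[OF F] B.face_minus_bd(5)[OF F'] by blast

lemma g_image: "g ` A.bd F = B.bd F'"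
  using homeomorphic_imp_surjective_map[OF homeo] A.bd_subset B.bd_subset by (simp add: inf_absorb2)

lemma g_inj: "inj_on g (A.bd F)"
  using homeomorphic_imp_injective_map[OF homeo] A.bd_subset by (simp add: inf_absorb2)

lemma g_mem: "x \<in> A.bd F \<Longrightarrow> g x \<in> B.bd F'"
  using g_image by blast

lemma g_continuous: "continuous_map (subtopology (surface G) (A.bd F)) (surface G') g"
  using homeomorphic_imp_continuous_map[OF homeo] continuous_map_in_subtopology by blast

text \<open>A special homeomorphism is only assumed to map vertices into vertices; injectivity and
  the three vertices on each side give equality.\<close>

lemma g_vertices: "g ` (F \<inter> verts G) = F' \<inter> verts G'"
proof (rule card_subset_eq)
  have sub: "F \<inter> verts G \<subseteq> A.bd F"
    by (rule A.face_Int_V_bd[OF F])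
  show "finite (F' \<inter> verts G')"
    using B.finite_V by blast
  show "g ` (F \<inter> verts G) \<subseteq> F' \<inter> verts G'"
    using special sub g_mem B.bd_subset_face unfolding special_homeomorphism_def by blast
  have "card (g ` (F \<inter> verts G)) = card (F \<inter> verts G)"
    by (rule card_image) (rule inj_on_subset[OF g_inj sub])
  then show "card (g ` (F \<inter> verts G)) = card (F' \<inter> verts G')"
    using A.face_card[OF F] B.face_card[OF F'] by simp
qed

lemma g_vertex_iff:
  assumes x: "x \<in> A.bd F"
  shows "g x \<in> verts G' \<longleftrightarrow> x \<in> verts G"
proof
  assume "x \<in> verts G"
  then have "g x \<in> g ` (F \<inter> verts G)"
    using x A.bd_subset_face by blast
  then show "g x \<in> verts G'"
    unfolding g_vertices by blast
next
  assume "g x \<in> verts G'"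
  then have "g x \<in> F' \<inter> verts G'"
    using g_mem[OF x] B.bd_subset_face by blast
  then have "g x \<in> g ` (F \<inter> verts G)"
    unfolding g_vertices .
  then obtain y where y: "y \<in> F \<inter> verts G" "g x = g y"
    by blast
  then have "x = y"
    using inj_onD[OF g_inj, of x y] x A.face_Int_V_bd[OF F] by blast
  then show "x \<in> verts G"
    using y(1) by blast
qed

text \<open>Without its ends e is connected, and its image avoids the vertices, in which alone
  different edges of F' can meet. So the image stays in one edge, and closedness of that edge adds
  the images of the two ends.\<close>

lemma edge_into_edge:
  assumes e: "e \<in> edges G" "e \<subseteq> F"
  shows "\<exists>e'\<in>edges G'. e' \<subseteq> F' \<and> g ` e \<subseteq> e'"
proof -
  have ebd: "e \<subseteq> A.bd F"
    by (rule A.edge_subset_bd[OF e])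
  obtain y where y: "y \<in> e" "y \<notin> verts G"
    using A.edge_interior_point[OF e(1)] .
  have "g y \<in> B.bd F'"
    using g_mem y ebd by blast
  then obtain e' where e': "e' \<in> edges G'" "e' \<subseteq> F'" "g y \<in> e'"
    unfolding B.bd_def by blast
  define R where "R = \<Union>({d \<in> edges G'. d \<subseteq> F'} - {e'})"
  have noV: "g x \<notin> verts G'" if "x \<in> e - verts G" for x
    using g_vertex_iff[of x] that ebd by blast
  have "connectedin (subtopology (surface G) (A.bd F)) (e - verts G)"
    unfolding connectedin_subtopology using A.edge_minus_V_connected[OF e(1)] ebd by blast
  then have conn: "connectedin (surface G') (g ` (e - verts G))"
    by (rule connectedin_continuous_map_image[OF g_continuous])
  have R_closed: "closedin (surface G') R"
    unfolding R_def using B.finite_E B.edge_closed by (intro closedin_Union) auto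
  have cover: "g ` (e - verts G) \<subseteq> e' \<union> R"
  proof -
    have "g ` (e - verts G) \<subseteq> B.bd F'"
      using g_mem ebd by blast
    then show ?thesis
      unfolding B.bd_def R_def by blast
  qed
  have disj: "e' \<inter> R \<inter> g ` (e - verts G) = {}"
  proof -
    have "e' \<inter> R \<subseteq> verts G'"
      using B.edges_Int[OF e'(1)] unfolding R_def by blast
    then show ?thesis
      using noV by blast
  qed
  have meets: "e' \<inter> g ` (e - verts G) \<noteq> {}"
    using y e'(3) by blast
  have "R \<inter> g ` (e - verts G) = {}"
    using conn B.edge_closed[OF e'(1)] R_closed cover disj meets unfolding connectedin_closedin by metis
  then have inner: "g x \<in> e'" if "x \<in> e" "x \<notin> verts G" for x
    using cover that by blast
  have "g x \<in> e'" if x: "x \<in> e" for x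
  proof (rule ccontr)
    assume nx: "g x \<notin> e'"
    have "openin (surface G') (topspace (surface G') - e')"
      using B.edge_closed[OF e'(1)] by blast
    from openin_continuous_map_preimage[OF g_continuous this]
    obtain O' where O': "openin (surface G) O'"
      "{x \<in> topspace (subtopology (surface G) (A.bd F)). g x \<in> topspace (surface G') - e'} = O' \<inter> A.bd F"
      unfolding openin_subtopology by blast
    have mem: "z \<in> O' \<longleftrightarrow> g z \<notin> e'" if "z \<in> A.bd F" for z
    proof -
      have "z \<in> O' \<inter> A.bd F \<longleftrightarrow> g z \<notin> e'"
        unfolding O'(2)[symmetric] using that g_mem[OF that] A.bd_subset B.bd_subset
        by (auto simp del: Int_iff)
      then show ?thesis
        using that by blast
    qed
    have "x \<in> O'"
      using mem[of x] x nx ebd by blast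
    then obtain z where z: "z \<in> e" "z \<in> O'" "z \<notin> verts G"
      using A.edge_limit[OF e(1) x O'(1)] by blast
    then show False
      using mem[of z] inner[of z] ebd by blast
  qed
  then show ?thesis
    using e'(1,2) by blast
qed

definition ginv :: "'b \<Rightarrow> 'a" where
  "ginv = inv_into (A.bd F) g"

lemma ginv_g: "x \<in> A.bd F \<Longrightarrow> ginv (g x) = x"
  unfolding ginv_def by (rule inv_into_f_f[OF g_inj])

lemma g_ginv: "y \<in> B.bd F' \<Longrightarrow> g (ginv y) = y"
  unfolding ginv_def by (rule f_inv_into_f) (simp add: g_image)

lemma ginv_mem: "y \<in> B.bd F' \<Longrightarrow> ginv y \<in> A.bd F"
  unfolding ginv_def by (rule inv_into_into) (simp add: g_image)

text \<open>The inverse satisfies the same assumptions, so every fact about g is available in both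
  directions.\<close>

lemma boundary_map_ginv: "boundary_map G' G F' F ginv"
proof unfold_locales
  show "F' \<in> faces G'" "F \<in> faces G"
    by (fact F' F)+
  obtain h where h: "homeomorphic_maps (subtopology (surface G) (A.bd F)) (subtopology (surface G') (B.bd F')) g h"
    using homeo unfolding homeomorphic_map_maps by blast
  have "homeomorphic_map (subtopology (surface G') (B.bd F')) (subtopology (surface G) (A.bd F)) h"
    using h homeomorphic_maps_sym homeomorphic_map_maps by blast
  moreover have "h y = ginv y" if y: "y \<in> topspace (subtopology (surface G') (B.bd F'))" for y
  proof -
    have "h (g (ginv y)) = ginv y"
      using h ginv_mem[of y] y A.bd_subset unfolding homeomorphic_maps_def by auto
    then show ?thesis
      using g_ginv y by simp
  qed
  ultimately have "homeomorphic_map (subtopology (surface G') (B.bd F')) (subtopology (surface G) (A.bd F)) ginv"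
    by (rule homeomorphic_map_eq)
  moreover have "ginv ` (F' \<inter> verts G') \<subseteq> verts G"
  proof
    fix x assume "x \<in> ginv ` (F' \<inter> verts G')"
    then obtain z where z: "z \<in> F \<inter> verts G" "x = ginv (g z)"
      unfolding g_vertices[symmetric] by blast
    then have "x = z"
      using ginv_g A.face_Int_V_bd[OF F] by blast
    then show "x \<in> verts G"
      using z(1) by blast
  qed
  ultimately show "special_homeomorphism G' F' G F ginv"
    unfolding special_homeomorphism_def A.face_minus_bd(5)[OF F] B.face_minus_bd(5)[OF F'] by blast
qed

text \<open>By \<open>edge_into_edge\<close>, g maps e into some e' and the inverse maps e' into
  some d. An interior point of e lies in d, so d = e and g maps e onto e'.\<close>

lemma g_edge:
  assumes e: "e \<in> edges G" "e \<subseteq> F"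
  shows "g ` e \<in> edges G'" "g ` e \<subseteq> F'" "g ` e \<inter> verts G' = g ` (e \<inter> verts G)"
proof -
  interpret I: boundary_map G' G F' F ginv
    by (rule boundary_map_ginv)
  have ebd: "e \<subseteq> A.bd F"
    by (rule A.edge_subset_bd[OF e])
  obtain e' where e': "e' \<in> edges G'" "e' \<subseteq> F'" "g ` e \<subseteq> e'"
    using edge_into_edge[OF e] by blast
  obtain d where d: "d \<in> edges G" "d \<subseteq> F" "ginv ` e' \<subseteq> d"
    using I.edge_into_edge[OF e'(1,2)] by blast
  obtain y where y: "y \<in> e" "y \<notin> verts G"
    using A.edge_interior_point[OF e(1)] .
  have "ginv (g y) \<in> d"
    using y(1) e'(3) d(3) by blast
  then have "y \<in> d"
    using ginv_g y(1) ebd by (metis subsetD)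
  then have "d = e"
    using A.edge_subset_edge[OF d(1) e(1) _ y(1) y(2)] by blast
  have "e' \<subseteq> g ` e"
  proof
    fix z assume z: "z \<in> e'"
    then have "g (ginv z) = z"
      using g_ginv B.edge_subset_bd[OF e'(1,2)] by blast
    moreover have "ginv z \<in> e"
      using z d(3) \<open>d = e\<close> by blast
    ultimately show "z \<in> g ` e"
      by (metis imageI)
  qed
  then have eq: "g ` e = e'"
    using e'(3) by blast
  show "g ` e \<in> edges G'" "g ` e \<subseteq> F'"
    unfolding eq by (fact e'(1,2))+
  show "g ` e \<inter> verts G' = g ` (e \<inter> verts G)"
    using g_vertex_iff ebd by blast
qed

lemma edge_from_edge:
  assumes "e' \<in> edges G'" "e' \<subseteq> F'"
  obtains e where "e \<in> edges G" "e \<subseteq> F" "g ` e = e'"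
proof -
  interpret I: boundary_map G' G F' F ginv
    by (rule boundary_map_ginv)
  have "g ` ginv ` e' = e'"
    unfolding image_image using g_ginv B.edge_subset_bd[OF assms] by (metis (no_types, lifting) image_cong image_ident subsetD)
  then show thesis
    using that I.g_edge(1,2)[OF assms] by blast
qed

section \<open>The points and the topology of the connected sum\<close>

abbreviation "S \<equiv> connected_sum G F G' F' g"

text \<open>The injection of the second surface into the chosen representatives, in which a boundary
  point takes the name of its partner in the first surface. The ranges of \<open>Inl\<close> and
  \<open>inr\<close> overlap exactly in the glued boundary.\<close>

definition inr :: "'b \<Rightarrow> 'a + 'b" where
  "inr y = (if y \<in> B.bd F' then Inl (ginv y) else Inr y)"

lemma glue_Inl: "glue G F G' F' g (Inl x) = Inl x"
  by (simp add: glue_def)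

lemma glue_Inr: "glue G F G' F' g (Inr y) = inr y"
  unfolding glue_def inr_def ginv_def A.face_minus_bd(5)[OF F] B.face_minus_bd(5)[OF F'] by simp

lemma inj_inr: "inj inr"
proof (rule injI)
  fix y z assume eq: "inr y = inr z"
  show "y = z"
  proof (cases "y \<in> B.bd F'")
    case True
    then have "z \<in> B.bd F'" "ginv y = ginv z"
      using eq by (auto simp: inr_def split: if_splits)
    then show ?thesis
      using g_ginv True by metis
  next
    case False
    then show ?thesis
      using eq by (auto simp: inr_def split: if_splits)
  qed
qed

lemma inr_eq_iff: "inr y = inr z \<longleftrightarrow> y = z"
  using inj_inr by (simp add: inj_eq)

lemma inr_mem_iff: "inr y \<in> inr ` D \<longleftrightarrow> y \<in> D"
  by (rule inj_image_mem_iff[OF inj_inr])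

lemma Inl_eq_inr: "Inl x = inr y \<longleftrightarrow> x \<in> A.bd F \<and> y = g x"
proof
  assume "Inl x = inr y"
  then have "y \<in> B.bd F'" "x = ginv y"
    by (auto simp: inr_def split: if_splits)
  then show "x \<in> A.bd F \<and> y = g x"
    using ginv_mem g_ginv by simp
next
  assume "x \<in> A.bd F \<and> y = g x"
  then show "Inl x = inr y"
    using g_mem ginv_g by (simp add: inr_def)
qed

lemma Inl_mem_inr: "Inl x \<in> inr ` D \<longleftrightarrow> x \<in> A.bd F \<and> g x \<in> D"
proof
  assume "Inl x \<in> inr ` D"
  then obtain y where "Inl x = inr y" "y \<in> D"
    by (rule imageE)
  then show "x \<in> A.bd F \<and> g x \<in> D"
    unfolding Inl_eq_inr by blast
next
  assume "x \<in> A.bd F \<and> g x \<in> D"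
  then show "Inl x \<in> inr ` D"
    using Inl_eq_inr[of x "g x"] by blast
qed

lemma inr_g: "x \<in> A.bd F \<Longrightarrow> inr (g x) = Inl x"
  using Inl_eq_inr by metis

lemma inr_g_image: "D \<subseteq> A.bd F \<Longrightarrow> inr ` g ` D = Inl ` D"
  unfolding image_image using inr_g by (intro image_cong) auto

lemma verts_S: "verts S = Inl ` verts G \<union> inr ` verts G'"
  unfolding connected_sum_def Plus_def by (simp add: image_Un image_image glue_Inl glue_Inr)

lemma edges_S: "edges S = (\<lambda>e. Inl ` e) ` edges G \<union> (\<lambda>e. inr ` e) ` edges G'"
  unfolding connected_sum_def by (simp add: image_image glue_Inl glue_Inr)

definition P :: "'a set" where "P = topspace (surface G) - (F - A.bd F)"
definition P' :: "'b set" where "P' = topspace (surface G') - (F' - B.bd F')"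

lemma minus_interior: "minus_interior (surface G) F = P" "minus_interior (surface G') F' = P'"
  unfolding minus_interior_def P_def P'_def A.face_minus_bd(4)[OF F] B.face_minus_bd(4)[OF F'] by simp_all

lemma openin_S: "openin (surface S) U \<longleftrightarrow> U \<subseteq> Inl ` P \<union> inr ` P' \<and>
  openin (subtopology (surface G) P) {x \<in> P. Inl x \<in> U} \<and>
  openin (subtopology (surface G') P') {y \<in> P'. inr y \<in> U}"
  unfolding openin_connected_sum glued_openin_def Let_def minus_interior Plus_def
  by (simp add: image_Un image_image glue_Inl glue_Inr)

lemma P_subset: "P \<subseteq> topspace (surface G)" and P'_subset: "P' \<subseteq> topspace (surface G')"
  unfolding P_def P'_def by blast+

lemma topspace_S: "topspace (surface S) = Inl ` P \<union> inr ` P'"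
proof
  show "topspace (surface S) \<subseteq> Inl ` P \<union> inr ` P'"
    using openin_S[of "topspace (surface S)"] openin_topspace by blast
  have "{x \<in> P. Inl x \<in> Inl ` P \<union> inr ` P'} = topspace (subtopology (surface G) P)"
    using P_subset by auto
  moreover have "{y \<in> P'. inr y \<in> Inl ` P \<union> inr ` P'} = topspace (subtopology (surface G') P')"
    using P'_subset by auto
  ultimately have "openin (surface S) (Inl ` P \<union> inr ` P')"
    unfolding openin_S by (simp only: openin_topspace) simp
  then show "Inl ` P \<union> inr ` P' \<subseteq> topspace (surface S)"
    by (rule openin_subset)
qed

lemma continuous_Inl: "continuous_map (subtopology (surface G) P) (surface S) Inl"
proof (rule continuous_map_openin_preimage_eq[THEN iffD2], intro conjI allI impI)
  show "Inl \<in> topspace (subtopology (surface G) P) \<rightarrow> topspace (surface S)"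
    unfolding topspace_S by auto
  fix U assume "openin (surface S) U"
  then have "openin (subtopology (surface G) P) {x \<in> P. Inl x \<in> U}"
    unfolding openin_S by blast
  moreover have "topspace (subtopology (surface G) P) \<inter> Inl -` U = {x \<in> P. Inl x \<in> U}"
    using P_subset by auto
  ultimately show "openin (subtopology (surface G) P) (topspace (subtopology (surface G) P) \<inter> Inl -` U)"
    by simp
qed

lemma continuous_inr: "continuous_map (subtopology (surface G') P') (surface S) inr"
proof (rule continuous_map_openin_preimage_eq[THEN iffD2], intro conjI allI impI)
  show "inr \<in> topspace (subtopology (surface G') P') \<rightarrow> topspace (surface S)"
    unfolding topspace_S by auto
  fix U assume "openin (surface S) U"
  then have "openin (subtopology (surface G') P') {x \<in> P'. inr x \<in> U}"
    unfolding openin_S by blast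
  moreover have "topspace (subtopology (surface G') P') \<inter> inr -` U = {x \<in> P'. inr x \<in> U}"
    using P'_subset by auto
  ultimately show "openin (subtopology (surface G') P') (topspace (subtopology (surface G') P') \<inter> inr -` U)"
    by simp
qed

lemma closedin_SI:
  assumes T: "T \<subseteq> Inl ` P \<union> inr ` P'"
    and 1: "closedin (surface G) {x \<in> P. Inl x \<in> T}" and 2: "closedin (surface G') {y \<in> P'. inr y \<in> T}"
  shows "closedin (surface S) T"
proof -
  have "{x \<in> P. Inl x \<in> topspace (surface S) - T} = P - {x \<in> P. Inl x \<in> T}"
    unfolding topspace_S by blast
  moreover have "openin (subtopology (surface G) P) (P - {x \<in> P. Inl x \<in> T})"
    by (rule openin_subtopology_Diff[OF 1 P_subset])
  moreover have "{y \<in> P'. inr y \<in> topspace (surface S) - T} = P' - {y \<in> P'. inr y \<in> T}"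
    unfolding topspace_S by blast
  moreover have "openin (subtopology (surface G') P') (P' - {y \<in> P'. inr y \<in> T})"
    by (rule openin_subtopology_Diff[OF 2 P'_subset])
  ultimately have "openin (surface S) (topspace (surface S) - T)"
    unfolding openin_S[of "topspace (surface S) - T"] by (simp add: topspace_S[symmetric])
  then show ?thesis
    using T unfolding closedin_def topspace_S by blast
qed

end

context triangulation
begin

lemma other_face:
  assumes F: "F \<in> faces G" and F1: "F1 \<in> faces G" "F1 \<noteq> F"
  shows "F1 \<subseteq> topspace X - (F - bd F)"
proof -
  have "(F - bd F) \<inter> F1 = {}"
  proof (rule ccontr)
    assume "(F - bd F) \<inter> F1 \<noteq> {}"
    then obtain x where x: "x \<in> F" "x \<notin> bd F" "x \<in> F1"
      by blast
    have "x \<notin> K"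
      using x(1,2) face_Int_K[OF F] by blast
    consider "F \<inter> F1 \<in> E" | v where "v \<in> V" "F \<inter> F1 = {v}" | "F \<inter> F1 = {}"
      using faces_Int[OF F F1(1)] F1(2) by metis
    then show False
    proof cases
      case 1
      then show False using x \<open>x \<notin> K\<close> by blast
    next
      case 2
      have "x \<in> F \<inter> F1" using x by blast
      then show False using 2 \<open>x \<notin> K\<close> by (metis UnI1 singletonD)
    next
      case 3
      have "x \<in> F \<inter> F1" using x by blast
      then show False unfolding 3 by blast
    qed
  qed
  then show ?thesis
    using face_subset[OF F1(1)] by blast
qed

lemma face_of_component_neq:
  assumes "C \<in> components"
  shows "X closure_of C = F \<Longrightarrow> C = F - bd F"
proof -
  assume eq: "X closure_of C = F"
  have F: "F \<in> faces G"
    using component_face[OF assms] eq by simp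
  have "F - bd F = F \<inter> (topspace X - K)"
    using face_Int_K[OF F] face_subset[OF F] by blast
  then show "C = F - bd F"
    using closure_component[OF assms] eq by simp
qed

lemma components_disjoint: "C \<in> components \<Longrightarrow> D \<in> components \<Longrightarrow> C \<noteq> D \<Longrightarrow> C \<inter> D = {}"
  using pairwise_disjoint_connected_components_of unfolding components_def pairwise_def disjnt_def by metis

lemma component_in_complement:
  assumes F: "F \<in> faces G" and C: "C \<in> components" "C \<noteq> F - bd F"
  shows "C \<subseteq> topspace X - (F - bd F)"
  using components_disjoint[OF C(1) face_minus_bd(1)[OF F] C(2)] component_subset[OF C(1)] by blast

end

section \<open>Components and faces of the connected sum\<close>

context boundary_map
begin

lemma component_not_bd: "C \<in> A.components \<Longrightarrow> C \<inter> A.bd F = {}"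
  using A.component_subset[of C] A.bd_subset_K[of F] by blast

lemma component_not_bd': "C \<in> B.components \<Longrightarrow> C \<inter> B.bd F' = {}"
  using B.component_subset[of C] B.bd_subset_K[of F'] by blast

lemma inr_notin_Inl_component:
  assumes "C \<in> A.components"
  shows "inr y \<notin> Inl ` C"
proof
  assume "inr y \<in> Inl ` C"
  then obtain x where x: "x \<in> C" "Inl x = inr y"
    by (metis imageE)
  then have "x \<in> A.bd F"
    unfolding Inl_eq_inr by blast
  then show False
    using component_not_bd[OF assms] x(1) by blast
qed

lemma Inl_notin_inr_component:
  assumes "C \<in> B.components"
  shows "Inl x \<notin> inr ` C"
proof
  assume "Inl x \<in> inr ` C"
  then obtain y where y: "y \<in> C" "Inl x = inr y"
    by (metis imageE)
  then have "y \<in> B.bd F'"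
    unfolding Inl_eq_inr using g_mem by blast
  then show False
    using component_not_bd'[OF assms] y(1) by blast
qed

lemma component_P: "C \<in> A.components \<Longrightarrow> C \<noteq> F - A.bd F \<Longrightarrow> C \<subseteq> P"
  unfolding P_def by (rule A.component_in_complement[OF F])

lemma component_P': "C \<in> B.components \<Longrightarrow> C \<noteq> F' - B.bd F' \<Longrightarrow> C \<subseteq> P'"
  unfolding P'_def by (rule B.component_in_complement[OF F'])

lemma face_P: "F1 \<in> faces G \<Longrightarrow> F1 \<noteq> F \<Longrightarrow> F1 \<subseteq> P"
  unfolding P_def by (rule A.other_face[OF F])

lemma face_P': "F1 \<in> faces G' \<Longrightarrow> F1 \<noteq> F' \<Longrightarrow> F1 \<subseteq> P'"
  unfolding P'_def by (rule B.other_face[OF F'])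

lemma bd_P: "A.bd F \<subseteq> P" and bd_P': "B.bd F' \<subseteq> P'"
  unfolding P_def P'_def using A.bd_subset[of F] B.bd_subset[of F'] by blast+

text \<open>An open face avoids the glued boundary, so its trace on the second surface is
  empty.\<close>

lemma open_Inl_component:
  assumes C: "C \<in> A.components" "C \<noteq> F - A.bd F"
  shows "openin (surface S) (Inl ` C)"
  unfolding openin_S
proof (intro conjI)
  have CP: "C \<subseteq> P"
    by (rule component_P[OF C])
  then show "Inl ` C \<subseteq> Inl ` P \<union> inr ` P'"
    by blast
  have eq: "{x \<in> P. Inl x \<in> Inl ` C} = P \<inter> C"
    by blast
  show "openin (subtopology (surface G) P) {x \<in> P. Inl x \<in> Inl ` C}"
    unfolding eq by (rule openin_subtopology_Int2[OF A.component_open[OF C(1)]])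
  have empty: "{y \<in> P'. inr y \<in> Inl ` C} = {}"
    using inr_notin_Inl_component[OF C(1)] by blast
  show "openin (subtopology (surface G') P') {y \<in> P'. inr y \<in> Inl ` C}"
    unfolding empty by (rule openin_empty)
qed

lemma open_inr_component:
  assumes C: "C \<in> B.components" "C \<noteq> F' - B.bd F'"
  shows "openin (surface S) (inr ` C)"
  unfolding openin_S
proof (intro conjI)
  have CP: "C \<subseteq> P'"
    by (rule component_P'[OF C])
  then show "inr ` C \<subseteq> Inl ` P \<union> inr ` P'"
    by blast
  have eq: "{y \<in> P'. inr y \<in> inr ` C} = P' \<inter> C"
    unfolding inr_mem_iff by blast
  show "openin (subtopology (surface G') P') {y \<in> P'. inr y \<in> inr ` C}"
    unfolding eq by (rule openin_subtopology_Int2[OF B.component_open[OF C(1)]])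
  have empty: "{x \<in> P. Inl x \<in> inr ` C} = {}"
    using Inl_notin_inr_component[OF C(1)] by blast
  show "openin (subtopology (surface G) P) {x \<in> P. Inl x \<in> inr ` C}"
    unfolding empty by (rule openin_empty)
qed

text \<open>All open faces of the two triangulations except the two that are removed;
  \<open>components_S\<close> identifies them with the components of the complement of the graph in
  the sum.\<close>

definition pieces :: "('a + 'b) set set" where
  "pieces = (\<lambda>C. Inl ` C) ` (A.components - {F - A.bd F}) \<union> (\<lambda>C. inr ` C) ` (B.components - {F' - B.bd F'})"

lemma piece_InlI: "C \<in> A.components \<Longrightarrow> C \<noteq> F - A.bd F \<Longrightarrow> Inl ` C \<in> pieces"
  unfolding pieces_def by (rule UnI1, rule imageI) simp

lemma piece_inrI: "C \<in> B.components \<Longrightarrow> C \<noteq> F' - B.bd F' \<Longrightarrow> inr ` C \<in> pieces"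
  unfolding pieces_def by (rule UnI2, rule imageI) simp

abbreviation "KS \<equiv> verts S \<union> \<Union>(edges S)"

lemma KS_eq: "KS = Inl ` (verts G \<union> \<Union>(edges G)) \<union> inr ` (verts G' \<union> \<Union>(edges G'))"
  unfolding verts_S edges_S Union_Un_distrib image_Un image_Union by (simp only: Un_ac)

lemma Inl_KS: "Inl x \<in> KS \<longleftrightarrow> x \<in> verts G \<union> \<Union>(edges G)"
proof
  assume "Inl x \<in> KS"
  then consider "x \<in> verts G \<union> \<Union>(edges G)" | y where "Inl x = inr y"
    unfolding KS_eq by (metis UnE imageE sum.inject(1))
  then show "x \<in> verts G \<union> \<Union>(edges G)"
  proof cases
    case 2
    then have "x \<in> A.bd F"
      unfolding Inl_eq_inr by blast
    then show ?thesis
      using A.bd_subset_K by blast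
  qed
next
  assume "x \<in> verts G \<union> \<Union>(edges G)"
  then show "Inl x \<in> KS"
    unfolding KS_eq by (rule UnI1[OF imageI])
qed

lemma inr_KS: "inr y \<in> KS \<longleftrightarrow> y \<in> verts G' \<union> \<Union>(edges G')"
proof
  assume "inr y \<in> KS"
  then consider "inr y \<in> inr ` (verts G' \<union> \<Union>(edges G'))" | x where "Inl x = inr y"
    unfolding KS_eq by (metis UnE imageE)
  then show "y \<in> verts G' \<union> \<Union>(edges G')"
  proof cases
    case 1
    then show ?thesis
      unfolding inr_mem_iff .
  next
    case 2
    then have "y \<in> B.bd F'"
      using Inl_eq_inr g_mem by metis
    then show ?thesis
      using B.bd_subset_K by blast
  qed
next
  assume "y \<in> verts G' \<union> \<Union>(edges G')"
  then show "inr y \<in> KS"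
    unfolding KS_eq by (rule UnI2[OF imageI])
qed

lemma Union_pieces: "\<Union>pieces = topspace (surface S) - KS"
proof (intro equalityI subsetI)
  fix s assume "s \<in> \<Union>pieces"
  then consider C x where "C \<in> A.components" "C \<noteq> F - A.bd F" "x \<in> C" "s = Inl x"
    | C y where "C \<in> B.components" "C \<noteq> F' - B.bd F'" "y \<in> C" "s = inr y"
    unfolding pieces_def by blast
  then show "s \<in> topspace (surface S) - KS"
  proof cases
    case 1
    then have "x \<in> P" "x \<notin> verts G \<union> \<Union>(edges G)"
      using component_P A.component_subset by blast+
    then show ?thesis
      unfolding topspace_S 1(4) using Inl_KS by blast
  next
    case 2
    then have "y \<in> P'" "y \<notin> verts G' \<union> \<Union>(edges G')"
      using component_P' B.component_subset by blast+
    then show ?thesis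
      unfolding topspace_S 2(4) using inr_KS by blast
  qed
next
  fix s assume s: "s \<in> topspace (surface S) - KS"
  have notin: "s \<notin> KS"
    using s unfolding Diff_iff by (rule conjunct2)
  have "s \<in> Inl ` P \<union> inr ` P'"
    using s unfolding topspace_S by (rule DiffD1)
  then consider x where "s = Inl x" "x \<in> P" | y where "s = inr y" "y \<in> P'"
    by (metis UnE imageE)
  then show "s \<in> \<Union>pieces"
  proof cases
    case 1
    have "x \<notin> verts G \<union> \<Union>(edges G)"
      using notin Inl_KS unfolding 1(1) by metis
    then have "x \<in> \<Union>A.components"
      unfolding A.Union_components using P_subset 1(2) by blast
    then obtain C where C: "C \<in> A.components" "x \<in> C"
      by blast
    have neq: "C \<noteq> F - A.bd F"
      using C(2) 1(2) unfolding P_def by blast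
    show ?thesis
      unfolding 1(1) by (rule UnionI[OF piece_InlI[OF C(1) neq] imageI[OF C(2)]])
  next
    case 2
    have "y \<notin> verts G' \<union> \<Union>(edges G')"
      using notin inr_KS unfolding 2(1) by metis
    then have "y \<in> \<Union>B.components"
      unfolding B.Union_components using P'_subset 2(2) by blast
    then obtain C where C: "C \<in> B.components" "y \<in> C"
      by blast
    have neq: "C \<noteq> F' - B.bd F'"
      using C(2) 2(2) unfolding P'_def by blast
    show ?thesis
      unfolding 2(1) by (rule UnionI[OF piece_inrI[OF C(1) neq] imageI[OF C(2)]])
  qed
qed

lemma pieceE:
  assumes "D \<in> pieces"
  obtains (left) C where "C \<in> A.components" "C \<noteq> F - A.bd F" "D = Inl ` C"
    | (right) C where "C \<in> B.components" "C \<noteq> F' - B.bd F'" "D = inr ` C"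
  using assms unfolding pieces_def by blast

lemma Inl_inr_component_disjoint:
  assumes "C \<in> A.components"
  shows "Inl ` C \<inter> inr ` C' = {}"
  using inr_notin_Inl_component[OF assms] by (metis disjoint_iff imageE)

lemma components_S: "connected_components_of (subtopology (surface S) (topspace (surface S) - KS)) = pieces"
proof (rule connected_components_of_eqI)
  show "\<Union>pieces = topspace (subtopology (surface S) (topspace (surface S) - KS))"
    unfolding Union_pieces topspace_subtopology by blast
  fix D assume D: "D \<in> pieces"
  have sub: "D \<subseteq> topspace (surface S) - KS"
    unfolding Union_pieces[symmetric] using D by blast
  have "openin (surface S) D"
    using D open_Inl_component open_inr_component by (cases rule: pieceE) simp_all
  then show "openin (subtopology (surface S) (topspace (surface S) - KS)) D"
    using sub openin_subtopology_Int2[of "surface S" D "topspace (surface S) - KS"] by (simp add: inf_absorb2)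
  have "connectedin (surface S) D"
    using D
  proof (cases rule: pieceE)
    case (left C)
    have "connectedin (subtopology (surface G) P) C"
      unfolding connectedin_subtopology using A.component_connected[OF left(1)] component_P[OF left(1,2)] by blast
    then show ?thesis
      unfolding left(3) by (rule connectedin_continuous_map_image[OF continuous_Inl])
  next
    case (right C)
    have "connectedin (subtopology (surface G') P') C"
      unfolding connectedin_subtopology using B.component_connected[OF right(1)] component_P'[OF right(1,2)] by blast
    then show ?thesis
      unfolding right(3) by (rule connectedin_continuous_map_image[OF continuous_inr])
  qed
  then show "connectedin (subtopology (surface S) (topspace (surface S) - KS)) D"
    unfolding connectedin_subtopology using sub by blast
  show "D \<noteq> {}"
    using D A.component_nonempty B.component_nonempty by (cases rule: pieceE) simp_all
  fix D' assume D': "D' \<in> pieces" "D \<noteq> D'"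
  show "D \<inter> D' = {}"
    using D
  proof (cases rule: pieceE)
    case (left C)
    note C = this
    show ?thesis
      using D'(1)
    proof (cases rule: pieceE)
      case (left C')
      have "C \<noteq> C'"
        using D'(2) C(3) left(3) by blast
      then have "C \<inter> C' = {}"
        by (rule A.components_disjoint[OF C(1) left(1)])
      then show ?thesis
        unfolding C(3) left(3) by blast
    next
      case (right C')
      show ?thesis
        unfolding C(3) right(3) by (rule Inl_inr_component_disjoint[OF C(1)])
    qed
  next
    case (right C)
    note C = this
    show ?thesis
      using D'(1)
    proof (cases rule: pieceE)
      case (left C')
      show ?thesis
        unfolding C(3) left(3) using Inl_inr_component_disjoint[OF left(1)] by blast
    next
      case (right C')
      have "C \<noteq> C'"
        using D'(2) C(3) right(3) by blast
      then have "C \<inter> C' = {}"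
        by (rule B.components_disjoint[OF C(1) right(1)])
      then show ?thesis
        unfolding C(3) right(3) image_Int[OF inj_inr, symmetric] by simp
    qed
  qed
qed

text \<open>A closed face may touch the glued boundary. Its trace on the second surface is then the
  image under g of a closed part of \<open>bd F\<close>, which is closed because g is a
  homeomorphism onto a closed set.\<close>

lemma closed_Inl_face:
  assumes F1: "F1 \<in> faces G" "F1 \<noteq> F"
  shows "closedin (surface S) (Inl ` F1)"
proof (rule closedin_SI)
  have FP: "F1 \<subseteq> P"
    by (rule face_P[OF F1])
  then show "Inl ` F1 \<subseteq> Inl ` P \<union> inr ` P'"
    by blast
  have eq: "{x \<in> P. Inl x \<in> Inl ` F1} = F1"
    using FP by blast
  show "closedin (surface G) {x \<in> P. Inl x \<in> Inl ` F1}"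
    unfolding eq by (rule A.face_closed[OF F1(1)])
  have eq': "{y \<in> P'. inr y \<in> Inl ` F1} = g ` (A.bd F \<inter> F1)"
  proof (intro equalityI subsetI)
    fix y assume "y \<in> {y \<in> P'. inr y \<in> Inl ` F1}"
    then have "inr y \<in> Inl ` F1"
      unfolding mem_Collect_eq by (rule conjunct2)
    then obtain x where x: "inr y = Inl x" "x \<in> F1"
      by (rule imageE)
    have "x \<in> A.bd F" "y = g x"
      using x(1)[symmetric] unfolding Inl_eq_inr by blast+
    then show "y \<in> g ` (A.bd F \<inter> F1)"
      using x(2) by blast
  next
    fix y assume "y \<in> g ` (A.bd F \<inter> F1)"
    then obtain x where x: "x \<in> A.bd F" "x \<in> F1" "y = g x"
      by blast
    have "y \<in> P'"
      unfolding x(3) using g_mem[OF x(1)] bd_P' by blast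
    moreover have "inr y \<in> Inl ` F1"
      unfolding x(3) inr_g[OF x(1)] by (rule imageI[OF x(2)])
    ultimately show "y \<in> {y \<in> P'. inr y \<in> Inl ` F1}"
      by (intro CollectI conjI)
  qed
  have "closedin (subtopology (surface G) (A.bd F)) (A.bd F \<inter> F1)"
    using A.face_closed[OF F1(1)] by (rule closedin_subtopology_Int_closed)
  then have "closedin (subtopology (surface G') (B.bd F')) (g ` (A.bd F \<inter> F1))"
    using homeomorphic_map_closedness_eq[OF homeo] by blast
  then show "closedin (surface G') {y \<in> P'. inr y \<in> Inl ` F1}"
    unfolding eq' using closedin_trans_full B.bd_closed by blast
qed

lemma closed_inr_face:
  assumes F1: "F1 \<in> faces G'" "F1 \<noteq> F'"
  shows "closedin (surface S) (inr ` F1)"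
proof (rule closedin_SI)
  have FP: "F1 \<subseteq> P'"
    by (rule face_P'[OF F1])
  then show "inr ` F1 \<subseteq> Inl ` P \<union> inr ` P'"
    by blast
  have eq: "{x \<in> P'. inr x \<in> inr ` F1} = F1"
    unfolding inr_mem_iff using FP by blast
  show "closedin (surface G') {x \<in> P'. inr x \<in> inr ` F1}"
    unfolding eq by (rule B.face_closed[OF F1(1)])
  have "{x \<in> P. Inl x \<in> inr ` F1} = {x \<in> topspace (subtopology (surface G) (A.bd F)). g x \<in> F1}"
    using bd_P A.bd_subset[of F] by (auto simp: image_iff Inl_eq_inr)
  moreover have "closedin (subtopology (surface G) (A.bd F)) {x \<in> topspace (subtopology (surface G) (A.bd F)). g x \<in> F1}"
    by (rule closedin_continuous_map_preimage[OF g_continuous B.face_closed[OF F1(1)]])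
  ultimately show "closedin (surface G) {x \<in> P. Inl x \<in> inr ` F1}"
    using closedin_trans_full A.bd_closed by metis
qed

text \<open>One inclusion holds because the image of the old face is closed in the sum, the other
  because \<open>Inl\<close> is continuous on P, which contains the whole face.\<close>

lemma closure_Inl_component:
  assumes C: "C \<in> A.components" "C \<noteq> F - A.bd F"
  shows "surface S closure_of (Inl ` C) = Inl ` (surface G closure_of C)"
proof
  have F1: "surface G closure_of C \<in> faces G" "surface G closure_of C \<noteq> F"
    using A.component_face[OF C(1)] A.face_of_component_neq[OF C(1)] C(2) by blast+
  have sub: "C \<subseteq> surface G closure_of C"
    using A.component_subset[OF C(1)] by (intro closure_of_subset) blast
  show "surface S closure_of (Inl ` C) \<subseteq> Inl ` (surface G closure_of C)"
    by (rule closure_of_minimal[OF _ closed_Inl_face[OF F1]]) (use sub in blast)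
  have "subtopology (surface G) P closure_of C = P \<inter> surface G closure_of C"
    by (rule closure_of_subtopology_open) (use component_P[OF C] in blast)
  also have "\<dots> = surface G closure_of C"
    using face_P[OF F1] by blast
  finally show "Inl ` (surface G closure_of C) \<subseteq> surface S closure_of (Inl ` C)"
    using continuous_map_image_closure_subset[OF continuous_Inl, of C] by simp
qed

lemma closure_inr_component:
  assumes C: "C \<in> B.components" "C \<noteq> F' - B.bd F'"
  shows "surface S closure_of (inr ` C) = inr ` (surface G' closure_of C)"
proof
  have F1: "surface G' closure_of C \<in> faces G'" "surface G' closure_of C \<noteq> F'"
    using B.component_face[OF C(1)] B.face_of_component_neq[OF C(1)] C(2) by blast+
  have sub: "C \<subseteq> surface G' closure_of C"
    using B.component_subset[OF C(1)] by (intro closure_of_subset) blast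
  show "surface S closure_of (inr ` C) \<subseteq> inr ` (surface G' closure_of C)"
    by (rule closure_of_minimal[OF _ closed_inr_face[OF F1]]) (use sub in blast)
  have "subtopology (surface G') P' closure_of C = P' \<inter> surface G' closure_of C"
    by (rule closure_of_subtopology_open) (use component_P'[OF C] in blast)
  also have "\<dots> = surface G' closure_of C"
    using face_P'[OF F1] by blast
  finally show "inr ` (surface G' closure_of C) \<subseteq> surface S closure_of (inr ` C)"
    using continuous_map_image_closure_subset[OF continuous_inr, of C] by simp
qed

end

lemma (in triangulation) other_faces_eq:
  assumes F: "F \<in> faces G"
  shows "faces G - {F} = (\<lambda>C. X closure_of C) ` (components - {F - bd F})"
proof (intro equalityI subsetI)
  fix F1 assume F1: "F1 \<in> faces G - {F}"
  then obtain C where C: "C \<in> components" "F1 = X closure_of C"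
    using faceE by blast
  moreover have "C \<noteq> F - bd F"
    using C(2) F1 face_minus_bd(3)[OF F] by (metis DiffD2 singletonI)
  ultimately show "F1 \<in> (\<lambda>C. X closure_of C) ` (components - {F - bd F})"
    by blast
next
  fix F1 assume "F1 \<in> (\<lambda>C. X closure_of C) ` (components - {F - bd F})"
  then obtain C where C: "C \<in> components" "C \<noteq> F - bd F" "F1 = X closure_of C"
    by blast
  then have "F1 \<noteq> F"
    using face_of_component_neq[OF C(1)] by blast
  then show "F1 \<in> faces G - {F}"
    using component_face[OF C(1)] C(3) by blast
qed

context boundary_map
begin

theorem faces_S: "faces S = (\<lambda>F1. Inl ` F1) ` (faces G - {F}) \<union> (\<lambda>F1. inr ` F1) ` (faces G' - {F'})"
proof -
  have "faces S = (\<lambda>D. surface S closure_of D) ` pieces"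
    unfolding faces_def components_S ..
  also have "\<dots> = (\<lambda>C. surface S closure_of (Inl ` C)) ` (A.components - {F - A.bd F}) \<union>
      (\<lambda>C. surface S closure_of (inr ` C)) ` (B.components - {F' - B.bd F'})"
    unfolding pieces_def image_Un image_image ..
  also have "(\<lambda>C. surface S closure_of (Inl ` C)) ` (A.components - {F - A.bd F}) =
      (\<lambda>C. Inl ` (surface G closure_of C)) ` (A.components - {F - A.bd F})"
    by (intro image_cong) (use closure_Inl_component in auto)
  also have "(\<lambda>C. surface S closure_of (inr ` C)) ` (B.components - {F' - B.bd F'}) =
      (\<lambda>C. inr ` (surface G' closure_of C)) ` (B.components - {F' - B.bd F'})"
    by (intro image_cong) (use closure_inr_component in auto)
  finally show ?thesis
    unfolding A.other_faces_eq[OF F] B.other_faces_eq[OF F'] image_image .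
qed

lemma Inl_verts: "Inl ` D \<inter> verts S = Inl ` (D \<inter> verts G)"
proof -
  have "Inl x \<in> verts S \<longleftrightarrow> x \<in> verts G" for x
  proof
    assume "Inl x \<in> verts S"
    then consider "x \<in> verts G" | y where "y \<in> verts G'" "Inl x = inr y"
      unfolding verts_S by (metis UnE imageE sum.inject(1))
    then show "x \<in> verts G"
    proof cases
      case 2
      then show ?thesis
        unfolding Inl_eq_inr using g_vertex_iff by metis
    qed
  qed (simp add: verts_S)
  then show ?thesis
    by (auto simp del: Un_iff)
qed

lemma inr_verts: "inr ` D \<inter> verts S = inr ` (D \<inter> verts G')"
proof -
  have "inr y \<in> verts S \<longleftrightarrow> y \<in> verts G'" for y
  proof
    assume "inr y \<in> verts S"
    then consider "inr y \<in> inr ` verts G'" | x where "x \<in> verts G" "Inl x = inr y"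
      unfolding verts_S by (metis UnE imageE)
    then show "y \<in> verts G'"
    proof cases
      case 1
      then show ?thesis
        unfolding inr_mem_iff .
    next
      case 2
      then show ?thesis
        unfolding Inl_eq_inr using g_vertex_iff by metis
    qed
  qed (simp add: verts_S)
  then show ?thesis
    by (auto simp del: Un_iff)
qed

text \<open>An edge of the first graph whose ends also lie on the second side has its ends in F, so
  by incidence it is an edge of F and is glued to an edge of F'.\<close>

lemma shared_edge:
  assumes e: "e \<in> edges G" and sub: "Inl ` (e \<inter> verts G) \<subseteq> inr ` D"
  shows "e \<subseteq> F" "Inl ` e = inr ` g ` e" "g ` e \<in> edges G'" "g ` e \<inter> verts G' \<subseteq> D"
    "g ` e \<inter> verts G' = g ` (e \<inter> verts G)"
proof -
  have *: "x \<in> A.bd F \<and> g x \<in> D" if "x \<in> e \<inter> verts G" for x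
    unfolding Inl_mem_inr[symmetric] using sub that by blast
  then have "e \<inter> verts G \<subseteq> F"
    using A.bd_subset_face by blast
  then show eF: "e \<subseteq> F"
    using A.incidence[OF e F] by blast
  show "Inl ` e = inr ` g ` e"
    using inr_g_image A.edge_subset_bd[OF e eF] by metis
  show "g ` e \<in> edges G'" "g ` e \<inter> verts G' = g ` (e \<inter> verts G)"
    by (fact g_edge[OF e eF])+
  show "g ` e \<inter> verts G' \<subseteq> D"
    unfolding g_edge(3)[OF e eF] using * by blast
qed

lemma shared_edge':
  assumes e: "e' \<in> edges G'" and sub: "inr ` (e' \<inter> verts G') \<subseteq> Inl ` D"
  obtains e where "e \<in> edges G" "Inl ` e = inr ` e'"
proof -
  have *: "y \<in> B.bd F'" if y: "y \<in> e' \<inter> verts G'" for y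
  proof -
    obtain x where "Inl x = inr y"
      using sub y by (metis imageE image_subset_iff)
    then show ?thesis
      using Inl_eq_inr g_mem by metis
  qed
  then have "e' \<inter> verts G' \<subseteq> F'"
    using B.bd_subset_face by blast
  then have "e' \<subseteq> F'"
    using B.incidence[OF e F'] by blast
  then obtain e where "e \<in> edges G" "e \<subseteq> F" "g ` e = e'"
    using edge_from_edge[OF e] by blast
  moreover have "inr ` g ` e = Inl ` e"
    by (rule inr_g_image[OF A.edge_subset_bd]) (fact calculation)+
  ultimately show thesis
    using that by metis
qed

lemma edge_SE:
  assumes "e \<in> edges S"
  obtains (left) d where "d \<in> edges G" "e = Inl ` d" | (right) d where "d \<in> edges G'" "e = inr ` d"
  using assms unfolding edges_S by blast

lemma face_SE:
  assumes "F1 \<in> faces S"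
  obtains (left) D where "D \<in> faces G" "D \<noteq> F" "F1 = Inl ` D"
    | (right) D where "D \<in> faces G'" "D \<noteq> F'" "F1 = inr ` D"
  using assms unfolding faces_S by blast

lemma inr_image_eq_iff: "inr ` D = inr ` D' \<longleftrightarrow> D = D'"
  by (rule inj_image_eq_iff[OF inj_inr])

lemma inr_image_subset_iff: "inr ` D \<subseteq> inr ` D' \<longleftrightarrow> D \<subseteq> D'"
  by (rule inj_image_subset_iff[OF inj_inr])

lemma Inl_image_eq_iff: "Inl ` D = Inl ` D' \<longleftrightarrow> D = D'"
  by (rule inj_image_eq_iff) simp

lemma Inl_image_subset_iff: "Inl ` D \<subseteq> Inl ` D' \<longleftrightarrow> D \<subseteq> D'"
  by (rule inj_image_subset_iff) simp

text \<open>Vertices common to both sides lie on the glued boundary, which has only three of them; D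
  and D' therefore have the vertices of the removed faces.\<close>

lemma faces_vertices_neq:
  assumes "D \<in> faces G" "D' \<in> faces G'" "Inl ` (D \<inter> verts G) = inr ` (D' \<inter> verts G')"
  shows "D = F" "D' = F'"
proof -
  have *: "x \<in> A.bd F \<and> g x \<in> D' \<inter> verts G'" if "x \<in> D \<inter> verts G" for x
  proof -
    have "Inl x \<in> inr ` (D' \<inter> verts G')"
      unfolding assms(3)[symmetric] using that by blast
    then show ?thesis
      unfolding Inl_mem_inr .
  qed
  then have "D \<inter> verts G \<subseteq> F \<inter> verts G"
    using A.bd_subset_face by blast
  then have eq: "D \<inter> verts G = F \<inter> verts G"
    using card_subset_eq[of "F \<inter> verts G" "D \<inter> verts G"] A.face_card assms(1) F A.finite_V by simp
  then show "D = F"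
    by (rule A.simple_faces[OF assms(1) F])
  have "inr ` (D' \<inter> verts G') = inr ` g ` (F \<inter> verts G)"
    using inr_g_image[OF A.face_Int_V_bd[OF F]] assms(3) eq by simp
  then have "D' \<inter> verts G' = F' \<inter> verts G'"
    unfolding inr_image_eq_iff g_vertices .
  then show "D' = F'"
    by (rule B.simple_faces[OF assms(2) F'])
qed

section \<open>The connected sum as a sum of triangle complexes\<close>

abbreviation "T1 \<equiv> (\<lambda>F1. Inl ` (F1 \<inter> verts G)) ` faces G :: ('a + 'b) set set"
abbreviation "T2 \<equiv> (\<lambda>F1. inr ` (F1 \<inter> verts G')) ` faces G'"
abbreviation "t \<equiv> Inl ` (F \<inter> verts G) :: ('a + 'b) set"

lemma model_G: "graph_model G (Inl :: 'a \<Rightarrow> 'a + 'b)"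
  by (rule A.graph_model) simp

lemma model_G': "graph_model G' inr"
  by (rule B.graph_model) (rule inj_on_subset[OF inj_inr subset_UNIV])

lemma t_eq: "inr ` (F' \<inter> verts G') = t"
  unfolding g_vertices[symmetric] by (rule inr_g_image[OF A.face_Int_V_bd[OF F]])

lemma glued_complexes: "glued_complexes T1 T2 t"
proof
  show "triangle_complex T1"
    by (rule graph_model.complex[OF model_G])
  show "triangle_complex T2"
    by (rule graph_model.complex[OF model_G'])
  have t1: "t \<in> T1"
    by (rule imageI[OF F])
  have t2: "t \<in> T2"
    unfolding t_eq[symmetric] by (rule imageI[OF F'])
  show "T1 \<inter> T2 = {t}"
  proof (intro equalityI subsetI)
    fix s assume "s \<in> T1 \<inter> T2"
    then have "s \<in> T1" "s \<in> T2"
      by (rule IntD1, rule IntD2)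
    then obtain D D' where D: "s = Inl ` (D \<inter> verts G)" "D \<in> faces G" "s = inr ` (D' \<inter> verts G')" "D' \<in> faces G'"
      by (elim imageE)
    have "D = F"
      by (rule faces_vertices_neq(1)[OF D(2,4)]) (simp only: D(1)[symmetric] D(3)[symmetric])
    then show "s \<in> {t}"
      using D(1) by simp
  next
    fix s assume "s \<in> {t}"
    then show "s \<in> T1 \<inter> T2"
      using t1 t2 by simp
  qed
  show "\<Union>T1 \<inter> \<Union>T2 = t"
  proof (intro equalityI subsetI)
    fix s assume s: "s \<in> \<Union>T1 \<inter> \<Union>T2"
    obtain D where D: "s \<in> Inl ` (D \<inter> verts G)"
      using IntD1[OF s] by (rule UN_E)
    obtain D' where D': "s \<in> inr ` (D' \<inter> verts G')"
      using IntD2[OF s] by (rule UN_E)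
    obtain x where x: "s = Inl x" "x \<in> D \<inter> verts G"
      using D by (rule imageE)
    have "x \<in> A.bd F"
      using D' unfolding x(1) Inl_mem_inr by (rule conjunct1)
    then show "s \<in> t"
      using x A.bd_subset_face by blast
  next
    fix s assume "s \<in> t"
    then show "s \<in> \<Union>T1 \<inter> \<Union>T2"
      using t1 t2 by (intro IntI UnionI)
  qed
qed

lemma T_S: "(\<lambda>F1. id ` (F1 \<inter> verts S)) ` faces S = (T1 \<union> T2) - {t}"
proof -
  have "inj_on (\<lambda>F1. Inl ` (F1 \<inter> verts G) :: ('a + 'b) set) (faces G)"
    by (rule inj_onI) (use A.simple_faces in \<open>simp only: Inl_image_eq_iff\<close>)
  then have 1: "(\<lambda>F1. Inl ` (F1 \<inter> verts G)) ` (faces G - {F}) = T1 - {t}"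
    using inj_on_image_set_diff[of _ "faces G" "faces G" "{F}"] F by simp
  have "inj_on (\<lambda>F1. inr ` (F1 \<inter> verts G')) (faces G')"
    by (rule inj_onI) (use B.simple_faces in \<open>simp only: inr_image_eq_iff\<close>)
  then have 2: "(\<lambda>F1. inr ` (F1 \<inter> verts G')) ` (faces G' - {F'}) = T2 - {t}"
    unfolding t_eq[symmetric] using inj_on_image_set_diff[of _ "faces G'" "faces G'" "{F'}"] F' by simp
  have "(\<lambda>F1. id ` (F1 \<inter> verts S)) ` faces S =
    (\<lambda>F1. Inl ` (F1 \<inter> verts G)) ` (faces G - {F}) \<union> (\<lambda>F1. inr ` (F1 \<inter> verts G')) ` (faces G' - {F'})"
    unfolding faces_S image_Un image_image Inl_verts inr_verts by simp
  then show ?thesis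
    unfolding 1 2 Un_Diff .
qed

text \<open>The vertices of the sum already live in the sum type, so the labelling is the identity.
  Cases within one summand are inherited; mixed ones are impossible or concern the glued boundary,
  where an edge can be regarded as belonging to either side.\<close>

theorem model_S: "graph_model S id"
proof
  interpret glued_complexes T1 T2 t
    by (rule glued_complexes)
  show "triangle_complex ((\<lambda>F1. id ` (F1 \<inter> verts S)) ` faces S)"
    unfolding T_S by (rule complex_sum)
  show "inj_on id (verts S)"
    by simp
  fix e assume e: "e \<in> edges S"
  show "\<exists>a b. a \<noteq> b \<and> e \<inter> verts S = {a, b}"
    using e
  proof (cases rule: edge_SE)
    case (left d)
    obtain a b where "a \<noteq> b" "d \<inter> verts G = {a, b}"
      using A.edge_ends[OF left(1)] by metis
    then show ?thesis
      unfolding left(2) Inl_verts by (intro exI[of _ "Inl a"] exI[of _ "Inl b"]) simp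
  next
    case (right d)
    obtain a b where "a \<noteq> b" "d \<inter> verts G' = {a, b}"
      using B.edge_ends[OF right(1)] by metis
    then show ?thesis
      unfolding right(2) inr_verts using inr_eq_iff by (intro exI[of _ "inr a"] exI[of _ "inr b"]) simp
  qed
  \<comment> \<open>Edges from different sides with the same ends both lie on the glued boundary,
    where they have been identified.\<close>
  have cross: "Inl ` d = inr ` d'"
    if d: "d \<in> edges G" "d' \<in> edges G'" and eq: "Inl ` (d \<inter> verts G) = inr ` (d' \<inter> verts G')" for d d'
  proof -
    have sub: "Inl ` (d \<inter> verts G) \<subseteq> inr ` (d' \<inter> verts G')"
      using eq by (rule equalityD1)
    note sh = shared_edge[OF d(1) sub]
    have "inr ` g ` (d \<inter> verts G) = Inl ` (d \<inter> verts G)"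
      using inr_g_image A.edge_subset_bd[OF d(1) sh(1)] by (metis Int_lower1 subset_trans)
    then have "g ` d \<inter> verts G' = d' \<inter> verts G'"
      unfolding sh(5) using eq inr_image_eq_iff by metis
    then have "g ` d = d'"
      by (rule B.edges_simple[OF sh(3) d(2)])
    then show ?thesis
      using sh(2) by simp
  qed
  show "e = e'" if e': "e' \<in> edges S" and eq: "e \<inter> verts S = e' \<inter> verts S" for e'
    using e
  proof (cases rule: edge_SE)
    case (left d)
    note d = this
    show ?thesis
      using e'
    proof (cases rule: edge_SE)
      case (left d')
      then show ?thesis
        using eq A.edges_simple[OF d(1) left(1)] unfolding d(2) left(2) Inl_verts Inl_image_eq_iff by blast
    next
      case (right d')
      then show ?thesis
        using eq cross[OF d(1) right(1)] unfolding d(2) right(2) Inl_verts inr_verts by blast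
    qed
  next
    case (right d)
    note d = this
    show ?thesis
      using e'
    proof (cases rule: edge_SE)
      case (left d')
      then show ?thesis
        using eq cross[OF left(1) d(1)] unfolding d(2) left(2) Inl_verts inr_verts by metis
    next
      case (right d')
      then show ?thesis
        using eq B.edges_simple[OF d(1) right(1)] unfolding d(2) right(2) inr_verts inr_image_eq_iff by blast
    qed
  qed
next
  fix F1 assume F1: "F1 \<in> faces S"
  show "card (F1 \<inter> verts S) = 3"
    using F1
  proof (cases rule: face_SE)
    case (left D)
    then show ?thesis
      unfolding left(3) Inl_verts using A.face_card[OF left(1)] by (simp add: card_image)
  next
    case (right D)
    then show ?thesis
      unfolding right(3) inr_verts using B.face_card[OF right(1)] inj_on_subset[OF inj_inr subset_UNIV]
      by (simp add: card_image)
  qed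
  show "\<exists>e\<in>edges S. e \<inter> verts S = {a, b}" if a: "a \<in> F1 \<inter> verts S" and b: "b \<in> F1 \<inter> verts S" and ab: "a \<noteq> b" for a b
    using F1
  proof (cases rule: face_SE)
    case (left D)
    obtain x y where xy: "x \<in> D \<inter> verts G" "a = Inl x" "y \<in> D \<inter> verts G" "b = Inl y"
      using a b unfolding left(3) Inl_verts by blast
    moreover have "x \<noteq> y"
      using ab xy(2,4) by metis
    ultimately obtain e where "e \<in> edges G" "e \<inter> verts G = {x, y}"
      using A.face_edge[OF left(1) xy(1,3)] by metis
    then show ?thesis
      unfolding xy(2,4) edges_S by (intro bexI[of _ "Inl ` e"]) (simp_all add: Inl_verts)
  next
    case (right D)
    obtain x y where xy: "x \<in> D \<inter> verts G'" "a = inr x" "y \<in> D \<inter> verts G'" "b = inr y"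
      using a b unfolding right(3) inr_verts by blast
    moreover have "x \<noteq> y"
      using ab xy(2,4) by metis
    ultimately obtain e where "e \<in> edges G'" "e \<inter> verts G' = {x, y}"
      using B.face_edge[OF right(1) xy(1,3)] by metis
    then show ?thesis
      unfolding xy(2,4) edges_S by (intro bexI[of _ "inr ` e"]) (simp_all add: inr_verts)
  qed
  show "F1 = F2" if F2: "F2 \<in> faces S" and eq: "F1 \<inter> verts S = F2 \<inter> verts S" for F2
    using F1
  proof (cases rule: face_SE)
    case (left D)
    note D = this
    show ?thesis
      using F2
    proof (cases rule: face_SE)
      case (left D')
      then show ?thesis
        using eq A.simple_faces[OF D(1) left(1)] unfolding D(3) left(3) Inl_verts Inl_image_eq_iff by blast
    next
      case (right D')
      then show ?thesis
        using eq faces_vertices_neq(1)[OF D(1) right(1)] D(2) unfolding D(3) right(3) Inl_verts inr_verts by blast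
    qed
  next
    case (right D)
    note D = this
    show ?thesis
      using F2
    proof (cases rule: face_SE)
      case (left D')
      then show ?thesis
        using eq faces_vertices_neq(2)[OF left(1) D(1)] D(2) unfolding D(3) left(3) Inl_verts inr_verts by metis
    next
      case (right D')
      then show ?thesis
        using eq B.simple_faces[OF D(1) right(1)] unfolding D(3) right(3) inr_verts inr_image_eq_iff by blast
    qed
  qed
  show "e \<subseteq> F1 \<longleftrightarrow> e \<inter> verts S \<subseteq> F1" if e: "e \<in> edges S" for e
  proof
    assume sub: "e \<inter> verts S \<subseteq> F1"
    have sub': "e \<inter> verts S \<subseteq> F1 \<inter> verts S"
      using sub by blast
    have ll: "Inl ` d \<subseteq> F1" if "d \<in> edges G" "D \<in> faces G" "F1 = Inl ` D" "Inl ` d \<inter> verts S \<subseteq> F1" for d D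
      using A.incidence[OF that(1,2)] that(4) unfolding that(3) Inl_verts Inl_image_subset_iff by blast
    have rr: "inr ` d \<subseteq> F1" if "d \<in> edges G'" "D \<in> faces G'" "F1 = inr ` D" "inr ` d \<inter> verts S \<subseteq> F1" for d D
      using B.incidence[OF that(1,2)] that(4) unfolding that(3) inr_verts inr_image_subset_iff by blast
    show "e \<subseteq> F1"
      using e
    proof (cases rule: edge_SE)
      case (left d)
      note d = this
      show ?thesis
        using F1
      proof (cases rule: face_SE)
        case (left D)
        then show ?thesis
          using ll d sub by blast
      next
        case (right D)
        have "Inl ` (d \<inter> verts G) \<subseteq> inr ` D"
          using sub unfolding d(2) right(3) Inl_verts .
        note sh = shared_edge[OF d(1) this]
        have "e = inr ` g ` d"
          using d(2) sh(2) by simp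
        then show ?thesis
          using rr[OF sh(3) right(1,3)] sub by simp
      qed
    next
      case (right d)
      note d = this
      show ?thesis
        using F1
      proof (cases rule: face_SE)
        case (left D)
        have "inr ` (d \<inter> verts G') \<subseteq> Inl ` D"
          using sub unfolding d(2) left(3) inr_verts .
        then obtain d' where d': "d' \<in> edges G" "Inl ` d' = inr ` d"
          using shared_edge'[OF d(1)] by blast
        then have "e = Inl ` d'"
          using d(2) by simp
        then show ?thesis
          using ll[OF d'(1) left(1,3)] sub by simp
      next
        case (right D)
        then show ?thesis
          using rr d sub by blast
      qed
    qed
  qed blast
qed

end

section \<open>Special homeomorphisms with prescribed vertices\<close>
text \<open>The pieces meet only in prescribed points, on which the given maps agree, so they paste
  to a continuous bijection; from a compact space to a Hausdorff space this is a homeomorphism. The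
  condition on overlaps of the images gives injectivity.\<close>

lemma homeomorphic_map_pasting:
  assumes I: "finite I" and X: "compact_space X" and Y: "Hausdorff_space Y"
    and A: "\<And>i. i \<in> I \<Longrightarrow> closedin X (A i)" and B: "\<And>i. i \<in> I \<Longrightarrow> B i \<subseteq> topspace Y"
    and k: "\<And>i. i \<in> I \<Longrightarrow> homeomorphic_map (subtopology X (A i)) (subtopology Y (B i)) (k i)"
    and AA: "\<And>i j x. i \<in> I \<Longrightarrow> j \<in> I \<Longrightarrow> i \<noteq> j \<Longrightarrow> x \<in> A i \<Longrightarrow> x \<in> A j \<Longrightarrow> x = w i j"
    and BB: "\<And>i j x. i \<in> I \<Longrightarrow> j \<in> I \<Longrightarrow> i \<noteq> j \<Longrightarrow> x \<in> B i \<Longrightarrow> x \<in> B j \<Longrightarrow> x = w' i j"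
    and w: "\<And>i j. i \<in> I \<Longrightarrow> j \<in> I \<Longrightarrow> i \<noteq> j \<Longrightarrow> w i j \<in> A i \<and> k i (w i j) = w' i j"
    and sym: "\<And>i j. w i j = w j i" "\<And>i j. w' i j = w' j i"
  shows "\<exists>g. homeomorphic_map (subtopology X (\<Union>i\<in>I. A i)) (subtopology Y (\<Union>i\<in>I. B i)) g \<and>
    (\<forall>i\<in>I. \<forall>x\<in>A i. g x = k i x)"
proof -
  let ?X = "subtopology X (\<Union>i\<in>I. A i)" and ?Y = "subtopology Y (\<Union>i\<in>I. B i)"
  have A_top: "A i \<subseteq> topspace X" if "i \<in> I" for i
    using closedin_subset[OF A[OF that]] .
  have topX: "topspace ?X = (\<Union>i\<in>I. A i)"
    unfolding topspace_subtopology using A_top by blast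
  have topY: "topspace ?Y = (\<Union>i\<in>I. B i)"
    unfolding topspace_subtopology using B by blast
  have k_image: "k i ` A i = B i" and k_inj: "inj_on (k i) (A i)" if "i \<in> I" for i
    using homeomorphic_imp_surjective_map[OF k[OF that]] homeomorphic_imp_injective_map[OF k[OF that]]
      A_top[OF that] B[OF that] by (simp_all add: inf_absorb2)
  obtain g where g: "continuous_map ?X ?Y g" "\<And>x i. i \<in> I \<Longrightarrow> x \<in> topspace ?X \<inter> A i \<Longrightarrow> g x = k i x"
  proof (rule pasting_lemma_exists_closed[of I ?X A ?Y k])
    show "topspace ?X \<subseteq> \<Union>(A ` I)"
      unfolding topX by simp
    show "closedin ?X (A i)" if "i \<in> I" for i
      using A[OF that] that by (intro closedin_subset_topspace) auto
    show "continuous_map (subtopology ?X (A i)) ?Y (k i)" if "i \<in> I" for i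
    proof -
      have "subtopology ?X (A i) = subtopology X (A i)"
        using that by (simp add: subtopology_subtopology inf_absorb2 UN_upper)
      moreover have "continuous_map (subtopology X (A i)) (subtopology Y (B i)) (k i)"
        by (rule homeomorphic_imp_continuous_map[OF k[OF that]])
      then have "continuous_map (subtopology X (A i)) ?Y (k i)"
        unfolding continuous_map_in_subtopology using that by auto
      ultimately show ?thesis
        by simp
    qed
    show "k i x = k j x" if "i \<in> I" "j \<in> I" "x \<in> topspace ?X \<inter> A i \<inter> A j" for i j x
    proof (cases "i = j")
      case False
      then have "x = w i j"
        using AA that by blast
      then show ?thesis
        using w[OF that(1,2) False] w[OF that(2,1)] False sym by metis
    qed simp
  qed (use I in auto)
  have gk: "g x = k i x" if "i \<in> I" "x \<in> A i" for i x
    by (rule g(2)[OF that(1)]) (use that topX in blast)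
  have "homeomorphic_map ?X ?Y g"
  proof (rule continuous_imp_homeomorphic_map[OF g(1)])
    have "closedin X (\<Union>i\<in>I. A i)"
      using I A by (intro closedin_Union) auto
    then show "compact_space ?X"
      using X closedin_compact_space compact_space_subtopology by blast
    show "Hausdorff_space ?Y"
      using Y Hausdorff_space_subtopology by blast
    have "g ` A i = B i" if "i \<in> I" for i
      using k_image[OF that] gk[OF that] by (metis image_cong)
    then show "g ` topspace ?X = topspace ?Y"
      unfolding topX topY image_UN by simp
    show "inj_on g (topspace ?X)"
      unfolding topX
    proof (rule inj_onI)
      fix x y assume x: "x \<in> (\<Union>i\<in>I. A i)" and y: "y \<in> (\<Union>i\<in>I. A i)" and eq: "g x = g y"
      obtain i where i: "i \<in> I" "x \<in> A i"
        using x by (rule UN_E)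
      obtain j where j: "j \<in> I" "y \<in> A j"
        using y by (rule UN_E)
      have kk: "k i x = k j y"
        using gk[OF i] gk[OF j] eq by simp
      show "x = y"
      proof (cases "i = j")
        case True
        then show ?thesis
          using inj_onD[OF k_inj[OF i(1)]] i j kk by simp
      next
        case False
        have "k i x \<in> B i"
          using k_image[OF i(1)] i(2) by blast
        moreover have "k i x \<in> B j"
          unfolding kk using k_image[OF j(1)] j(2) by blast
        ultimately have "k i x = w' i j"
          by (rule BB[OF i(1) j(1) False])
        \<comment> \<open>A value common to two images is w' i j, which each of the two maps attains
          only at the common point of the pieces.\<close>
        then have "x = w i j" "y = w j i"
          using inj_onD[OF k_inj[OF i(1)], of x "w i j"] inj_onD[OF k_inj[OF j(1)], of y "w j i"]
            w[OF i(1) j(1) False] w[OF j(1) i(1)] False i(2) j(2) kk sym(2) by metis+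
        then show ?thesis
          using sym(1) by metis
      qed
    qed
  qed
  then show ?thesis
    using gk by blast
qed

context triangulation
begin

lemma oriented_arc:
  assumes e: "e \<in> E" "e \<inter> V = {a, b}" "a \<noteq> b"
  obtains p where "homeomorphic_map (top_of_set {0..1::real}) (subtopology X e) p" "p 0 = a" "p 1 = b"
proof -
  obtain p where p: "embedding_map (top_of_set {0..1::real}) X p" "e = p ` {0..1}" "e \<inter> V = {p 0, p 1}"
    using edge_arc[OF e(1)] .
  have h: "homeomorphic_map (top_of_set {0..1::real}) (subtopology X e) p"
    using p(1) unfolding embedding_map_def p(2) by simp
  have "{p 0, p 1} = {a, b}"
    using p(3) e(2) by simp
  then consider "p 0 = a" "p 1 = b" | "p 0 = b" "p 1 = a"
    unfolding doubleton_eq_iff by blast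
  then show thesis
  proof cases
    case 1
    then show thesis using that h by blast
  next
    case 2
    have "homeomorphic_maps (top_of_set {0..1::real}) (top_of_set {0..1}) (\<lambda>t. 1 - t) (\<lambda>t. 1 - t)"
      unfolding homeomorphic_maps_def
      by (auto simp: continuous_map_in_subtopology intro!: continuous_intros)
    then have "homeomorphic_map (top_of_set {0..1::real}) (top_of_set {0..1}) (\<lambda>t. 1 - t)"
      unfolding homeomorphic_map_maps by blast
    then have "homeomorphic_map (top_of_set {0..1::real}) (subtopology X e) (p \<circ> (\<lambda>t. 1 - t))"
      by (rule homeomorphic_map_compose[OF _ h])
    then show thesis
      using that[of "p \<circ> (\<lambda>t. 1 - t)"] 2 by simp
  qed
qed

lemma labelled_face_edges:
  assumes F: "F \<in> faces G" and face: "labelled_face G F a b c"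
  obtains e0 e1 e2 where "e0 \<in> E" "e1 \<in> E" "e2 \<in> E" "e0 \<inter> V = {a, b}" "e1 \<inter> V = {b, c}" "e2 \<inter> V = {a, c}"
    "bd F = e0 \<union> e1 \<union> e2" "e0 \<noteq> e1" "e0 \<noteq> e2" "e1 \<noteq> e2"
proof -
  interpret labelled_face G F a b c by (rule face)
  have V: "a \<in> F \<inter> V" "b \<in> F \<inter> V" "c \<in> F \<inter> V"
    unfolding abc by simp_all
  obtain e0 where e0: "e0 \<in> E" "e0 \<subseteq> F" "e0 \<inter> V = {a, b}"
    using face_edge[OF F V(1,2) ab] by metis
  obtain e1 where e1: "e1 \<in> E" "e1 \<subseteq> F" "e1 \<inter> V = {b, c}"
    using face_edge[OF F V(2,3) bc] by metis
  obtain e2 where e2: "e2 \<in> E" "e2 \<subseteq> F" "e2 \<inter> V = {a, c}"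
    using face_edge[OF F V(1,3) ac] by metis
  have neq: "e0 \<noteq> e1" "e0 \<noteq> e2" "e1 \<noteq> e2"
    using e0(3) e1(3) e2(3) ab bc ac by (auto simp: doubleton_eq_iff)
  have "{e0, e1, e2} = {e \<in> E. e \<subseteq> F}"
  proof (rule card_subset_eq)
    show "finite {e \<in> E. e \<subseteq> F}"
      using finite_E by simp
    show "{e0, e1, e2} \<subseteq> {e \<in> E. e \<subseteq> F}"
      using e0(1,2) e1(1,2) e2(1,2) by simp
    show "card {e0, e1, e2} = card {e \<in> E. e \<subseteq> F}"
      unfolding card_face_edges[OF F] using neq by simp
  qed
  then have "bd F = e0 \<union> e1 \<union> e2"
    unfolding bd_def by (metis Union_insert Union_empty Un_assoc Un_empty_right)
  then show thesis
    using that e0 e1 e2 neq by metis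
qed

lemma ex_labelled_face:
  assumes "F \<in> faces G" obtains a b c where "labelled_face G F a b c"
  by (rule face_triangle[OF assms]) (auto simp: labelled_face_def intro: that)

end

lemma edge_homeomorphism:
  assumes "triangulation G" "e \<in> edges G" "e \<inter> verts G = {a, b}" "a \<noteq> b"
    and "triangulation G'" "e' \<in> edges G'" "e' \<inter> verts G' = {a', b'}" "a' \<noteq> b'"
  shows "\<exists>k. homeomorphic_map (subtopology (surface G) e) (subtopology (surface G') e') k \<and> k a = a' \<and> k b = b'"
proof -
  obtain p where p: "homeomorphic_map (top_of_set {0..1::real}) (subtopology (surface G) e) p" "p 0 = a" "p 1 = b"
    using triangulation.oriented_arc[OF assms(1-4)] .
  obtain p' where p': "homeomorphic_map (top_of_set {0..1::real}) (subtopology (surface G') e') p'" "p' 0 = a'" "p' 1 = b'"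
    using triangulation.oriented_arc[OF assms(5-8)] .
  obtain q where q: "homeomorphic_maps (top_of_set {0..1::real}) (subtopology (surface G) e) p q"
    using p(1) unfolding homeomorphic_map_maps by blast
  have "homeomorphic_map (subtopology (surface G) e) (top_of_set {0..1}) q"
    using q homeomorphic_maps_sym homeomorphic_map_maps by blast
  then have "homeomorphic_map (subtopology (surface G) e) (subtopology (surface G') e') (p' \<circ> q)"
    by (rule homeomorphic_map_compose[OF _ p'(1)])
  moreover have "q a = 0" "q b = 1"
    using q p(2,3) unfolding homeomorphic_maps_def by auto
  ultimately show ?thesis
    using p'(2,3) by (intro exI[of _ "p' \<circ> q"]) simp
qed

text \<open>Each edge is mapped to its counterpart by comparing the two arcs, oriented according to
  the labels, and the three maps are pasted at the vertices.\<close>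

lemma ex_special_homeomorphism:
  assumes G: "triangulation G" and G': "triangulation G'" and F: "F \<in> faces G" and F': "F' \<in> faces G'"
    and face: "labelled_face G F a b c" and face': "labelled_face G' F' a' b' c'"
  obtains g where "special_homeomorphism G F G' F' g" "g a = a'" "g b = b'" "g c = c'"
proof -
  interpret A: triangulation G by (rule G)
  interpret B: triangulation G' by (rule G')
  interpret LA: labelled_face G F a b c by (rule face)
  interpret LB: labelled_face G' F' a' b' c' by (rule face')
  obtain e0 e1 e2 where e: "e0 \<in> A.E" "e1 \<in> A.E" "e2 \<in> A.E"
    "e0 \<inter> A.V = {a, b}" "e1 \<inter> A.V = {b, c}" "e2 \<inter> A.V = {a, c}"
    "A.bd F = e0 \<union> e1 \<union> e2" "e0 \<noteq> e1" "e0 \<noteq> e2" "e1 \<noteq> e2"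
    using A.labelled_face_edges[OF F face] .
  obtain d0 d1 d2 where d: "d0 \<in> B.E" "d1 \<in> B.E" "d2 \<in> B.E"
    "d0 \<inter> B.V = {a', b'}" "d1 \<inter> B.V = {b', c'}" "d2 \<inter> B.V = {a', c'}"
    "B.bd F' = d0 \<union> d1 \<union> d2" "d0 \<noteq> d1" "d0 \<noteq> d2" "d1 \<noteq> d2"
    using B.labelled_face_edges[OF F' face'] .
  obtain k0 where k0: "homeomorphic_map (subtopology A.X e0) (subtopology B.X d0) k0" "k0 a = a'" "k0 b = b'"
    using edge_homeomorphism[OF G e(1,4) LA.ab G' d(1,4) LB.ab] by blast
  obtain k1 where k1: "homeomorphic_map (subtopology A.X e1) (subtopology B.X d1) k1" "k1 b = b'" "k1 c = c'"
    using edge_homeomorphism[OF G e(2,5) LA.bc G' d(2,5) LB.bc] by blast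
  obtain k2 where k2: "homeomorphic_map (subtopology A.X e2) (subtopology B.X d2) k2" "k2 a = a'" "k2 c = c'"
    using edge_homeomorphism[OF G e(3,6) LA.ac G' d(3,6) LB.ac] by blast
  define I where "I = {0, 1, 2::nat}"
  define A where "A i = (if i = 0 then e0 else if i = 1 then e1 else e2)" for i :: nat
  define D where "D i = (if i = 0 then d0 else if i = 1 then d1 else d2)" for i :: nat
  define k where "k i = (if i = 0 then k0 else if i = 1 then k1 else k2)" for i :: nat
  \<comment> \<open>The sum i + j encodes the pair of edges, numbered 0 for ab, 1 for bc, 2 for ac:
    sum 1 means the common end b, sum 2 means a, and sum 3 means c.\<close>
  define w where "w i j = (if i + j = 1 then b else if i + j = 2 then a else c)" for i j :: nat
  define w' where "w' i j = (if i + j = 1 then b' else if i + j = 2 then a' else c')" for i j :: nat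
  have V: "a \<in> e0" "b \<in> e0" "b \<in> e1" "c \<in> e1" "a \<in> e2" "c \<in> e2"
    using e(4-6) by blast+
  have Aint: "e0 \<inter> e1 \<subseteq> {b}" "e0 \<inter> e2 \<subseteq> {a}" "e1 \<inter> e2 \<subseteq> {c}"
  proof -
    have "e0 \<inter> e1 \<subseteq> (e0 \<inter> A.V) \<inter> (e1 \<inter> A.V)" "e0 \<inter> e2 \<subseteq> (e0 \<inter> A.V) \<inter> (e2 \<inter> A.V)"
      "e1 \<inter> e2 \<subseteq> (e1 \<inter> A.V) \<inter> (e2 \<inter> A.V)"
      using A.edges_Int[OF e(1,2,8)] A.edges_Int[OF e(1,3,9)] A.edges_Int[OF e(2,3,10)] by blast+
    then show "e0 \<inter> e1 \<subseteq> {b}" "e0 \<inter> e2 \<subseteq> {a}" "e1 \<inter> e2 \<subseteq> {c}"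
      unfolding e(4-6) using LA.ab LA.bc LA.ac by auto
  qed
  have Dint: "d0 \<inter> d1 \<subseteq> {b'}" "d0 \<inter> d2 \<subseteq> {a'}" "d1 \<inter> d2 \<subseteq> {c'}"
  proof -
    have "d0 \<inter> d1 \<subseteq> (d0 \<inter> B.V) \<inter> (d1 \<inter> B.V)" "d0 \<inter> d2 \<subseteq> (d0 \<inter> B.V) \<inter> (d2 \<inter> B.V)"
      "d1 \<inter> d2 \<subseteq> (d1 \<inter> B.V) \<inter> (d2 \<inter> B.V)"
      using B.edges_Int[OF d(1,2,8)] B.edges_Int[OF d(1,3,9)] B.edges_Int[OF d(2,3,10)] by blast+
    then show "d0 \<inter> d1 \<subseteq> {b'}" "d0 \<inter> d2 \<subseteq> {a'}" "d1 \<inter> d2 \<subseteq> {c'}"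
      unfolding d(4-6) using LB.ab LB.bc LB.ac by auto
  qed
  have "\<exists>g. homeomorphic_map (subtopology A.X (\<Union>i\<in>I. A i)) (subtopology B.X (\<Union>i\<in>I. D i)) g \<and>
    (\<forall>i\<in>I. \<forall>x\<in>A i. g x = k i x)"
  proof (rule homeomorphic_map_pasting[of I A.X B.X A D k w w'])
    show "finite I" "compact_space A.X" "Hausdorff_space B.X"
      by (simp_all add: I_def A.compact B.Hausdorff)
    show "closedin A.X (A i)" for i
      using A.edge_closed e(1-3) by (simp add: A_def)
    show "D i \<subseteq> topspace B.X" for i
      using B.edge_subset[OF d(1)] B.edge_subset[OF d(2)] B.edge_subset[OF d(3)] by (simp add: D_def)
    show "homeomorphic_map (subtopology A.X (A i)) (subtopology B.X (D i)) (k i)" for i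
      using k0(1) k1(1) k2(1) by (simp add: A_def D_def k_def)
    show "x = w i j" if "i \<in> I" "j \<in> I" "i \<noteq> j" "x \<in> A i" "x \<in> A j" for i j x
      using that Aint unfolding I_def insert_iff empty_iff by (elim disjE) (auto simp: A_def w_def)
    show "x = w' i j" if "i \<in> I" "j \<in> I" "i \<noteq> j" "x \<in> D i" "x \<in> D j" for i j x
      using that Dint unfolding I_def insert_iff empty_iff by (elim disjE) (auto simp: D_def w'_def)
    show "w i j \<in> A i \<and> k i (w i j) = w' i j" if "i \<in> I" "j \<in> I" "i \<noteq> j" for i j
      using that V k0(2,3) k1(2,3) k2(2,3) unfolding I_def insert_iff empty_iff
      by (elim disjE) (auto simp: A_def k_def w_def w'_def)
    show "w i j = w j i" "w' i j = w' j i" for i j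
      by (simp_all add: w_def w'_def add.commute)
  qed
  then obtain g where g: "homeomorphic_map (subtopology A.X (\<Union>i\<in>I. A i)) (subtopology B.X (\<Union>i\<in>I. D i)) g"
    "\<And>i x. i \<in> I \<Longrightarrow> x \<in> A i \<Longrightarrow> g x = k i x"
    by blast
  have UA: "(\<Union>i\<in>I. A i) = A.bd F" and UD: "(\<Union>i\<in>I. D i) = B.bd F'"
    unfolding I_def e(7) d(7) by (simp_all add: A_def D_def Un_ac)
  have gabc: "g a = a'" "g b = b'" "g c = c'"
    using g(2)[of 0 a] g(2)[of 0 b] g(2)[of 1 c] V k0(2,3) k1(3) by (simp_all add: I_def A_def k_def)
  have "a' \<in> F' \<inter> B.V" "b' \<in> F' \<inter> B.V" "c' \<in> F' \<inter> B.V"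
    unfolding LB.abc by simp_all
  then have "g ` (F \<inter> A.V) \<subseteq> B.V"
    unfolding LA.abc using gabc by simp
  then have "special_homeomorphism G F G' F' g"
    unfolding special_homeomorphism_def A.face_minus_bd(5)[OF F] B.face_minus_bd(5)[OF F']
    using g(1) unfolding UA UD by blast
  then show thesis
    using that gabc by blast
qed

section \<open>Knottedness of connected sums of triangulations\<close>

context boundary_map
begin

lemma z_knotted_S: "z_knotted S \<longleftrightarrow> knotted (flags ((T1 \<union> T2) - {t})) (advance ((T1 \<union> T2) - {t})) reverse"
  using graph_model.z_knotted_iff[OF model_S] unfolding T_S .

lemma flags_t:
  assumes "labelled_face G F a b c"
  shows "(Inl a, Inl b, Inl c) \<in> flags {t}"
proof -
  interpret labelled_face G F a b c by (rule assms)
  show ?thesis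
    unfolding flags_iff abc using ab bc ac by simp
qed

lemma labelled_face_of_flag:
  assumes "y \<in> flags {t}"
  obtains a' b' c' where "labelled_face G' F' a' b' c'" "y = (inr a', inr b', inr c')"
proof -
  obtain p q r where y: "y = (p, q, r)"
    by (metis prod_cases3)
  have pqr: "p \<noteq> q" "q \<noteq> r" "p \<noteq> r" "{p, q, r} = inr ` (F' \<inter> verts G')"
    using assms unfolding y flags_iff t_eq by simp_all
  have "p \<in> inr ` (F' \<inter> verts G')" "q \<in> inr ` (F' \<inter> verts G')" "r \<in> inr ` (F' \<inter> verts G')"
    unfolding pqr(4)[symmetric] by simp_all
  then obtain a' b' c' where abc: "p = inr a'" "q = inr b'" "r = inr c'"
    by (elim imageE)
  have "inr ` (F' \<inter> verts G') = inr ` {a', b', c'}"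
    unfolding pqr(4)[symmetric] abc by simp
  then have "F' \<inter> verts G' = {a', b', c'}"
    unfolding inr_image_eq_iff .
  moreover have "a' \<noteq> b'" "b' \<noteq> c'" "a' \<noteq> c'"
    using pqr(1-3) unfolding abc inr_eq_iff .
  ultimately have "labelled_face G' F' a' b' c'"
    unfolding labelled_face_def by blast
  then show thesis
    using that y abc by blast
qed

lemma labelled_face_image:
  assumes "labelled_face G F a b c"
  shows "labelled_face G' F' (g a) (g b) (g c)" "inr (g a) = Inl a" "inr (g b) = Inl b" "inr (g c) = Inl c"
proof -
  interpret labelled_face G F a b c by (rule assms)
  have "a \<in> F \<inter> verts G" "b \<in> F \<inter> verts G" "c \<in> F \<inter> verts G"
    unfolding abc by simp_all
  then have bd: "a \<in> A.bd F" "b \<in> A.bd F" "c \<in> A.bd F"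
    using A.face_Int_V_bd[OF F] by blast+
  show "inr (g a) = Inl a" "inr (g b) = Inl b" "inr (g c) = Inl c"
    by (rule inr_g; fact bd)+
  have "F' \<inter> verts G' = {g a, g b, g c}"
    unfolding g_vertices[symmetric] abc by simp
  moreover have "g a \<noteq> g b" "g b \<noteq> g c" "g a \<noteq> g c"
    using inj_onD[OF g_inj] bd ab bc ac by blast+
  ultimately show "labelled_face G' F' (g a) (g b) (g c)"
    unfolding labelled_face_def by blast
qed

lemma labelled_face_preimage:
  assumes "labelled_face G' F' a' b' c'"
  obtains a b c where "labelled_face G F a b c" "inr a' = Inl a" "inr b' = Inl b" "inr c' = Inl c"
proof -
  interpret I: boundary_map G' G F' F ginv
    by (rule boundary_map_ginv)
  interpret labelled_face G' F' a' b' c' by (rule assms)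
  have "a' \<in> F' \<inter> verts G'" "b' \<in> F' \<inter> verts G'" "c' \<in> F' \<inter> verts G'"
    unfolding abc by simp_all
  then have "a' \<in> B.bd F'" "b' \<in> B.bd F'" "c' \<in> B.bd F'"
    using B.face_Int_V_bd[OF F'] by blast+
  then show thesis
    using that[OF I.labelled_face_image(1)[OF assms]] by (simp add: inr_def)
qed

lemma z_knotted_G: "z_knotted G \<longleftrightarrow> knotted (flags T1) (advance T1) reverse"
  by (rule graph_model.z_knotted_iff[OF model_G])

lemma z_knotted_G': "z_knotted G' \<longleftrightarrow> knotted (flags T2) (advance T2) reverse"
  by (rule graph_model.z_knotted_iff[OF model_G'])

lemma acts_G:
  assumes "z_knotted G" "labelled_face G F a b c" "list_all (\<lambda>i. L ! i < 6) [0..<6]"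
  shows "face_acts_as G F (a, b, c) L \<longleftrightarrow> acts_as (Inl a, Inl b, Inl c) (monodromy T1 t) L"
  using graph_model.face_acts_as_iff[OF model_G _ F assms(2,3)] assms(1) z_knotted_G by blast

lemma acts_G':
  assumes "z_knotted G'" "labelled_face G' F' a b c" "list_all (\<lambda>i. L ! i < 6) [0..<6]"
  shows "face_acts_as G' F' (a, b, c) L \<longleftrightarrow> acts_as (inr a, inr b, inr c) (monodromy T2 t) L"
  unfolding t_eq[symmetric]
  using graph_model.face_acts_as_iff[OF model_G' _ F' assms(2,3)] assms(1) z_knotted_G' by blast

lemma bounds6: "list_all (\<lambda>i. rot6 ! i < 6) [0..<6]" "list_all (\<lambda>i. id6 ! i < 6) [0..<6]"
  "list_all (\<lambda>i. M3_6 ! i < 6) [0..<6]" "list_all (\<lambda>i. M4_6 ! i < 6) [0..<6]"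
  by code_simp+

lemma z_knotted_sum_rotation:
  assumes K: "z_knotted G" "z_knotted G'" and M: "z_monodromy G F = face_rotation G F"
  shows "z_knotted S"
proof -
  obtain a b c where face: "labelled_face G F a b c"
    using A.ex_labelled_face[OF F] .
  have "acts_as (Inl a, Inl b, Inl c) (monodromy T1 t) rot6"
    using labelled_face.face_rotation_iff[OF face] M acts_G[OF K(1) face bounds6(1)] by blast
  then show ?thesis
    unfolding z_knotted_S
    using glued_complexes.knotted_sum_rotation[OF glued_complexes] K flags_t[OF face] z_knotted_G z_knotted_G' by blast
qed

lemma z_knotted_sum_identity:
  assumes K: "z_knotted G" "z_knotted G'" and M: "z_monodromy G F = id"
  shows "z_knotted S \<longleftrightarrow> z_monodromy G' F' = face_rotation G' F' \<or> type_M3 G' F'"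
proof
  obtain a b c where face: "labelled_face G F a b c"
    using A.ex_labelled_face[OF F] .
  note image = labelled_face_image[OF face]
  have id: "acts_as (Inl x, Inl y, Inl z) (monodromy T1 t) id6" if "labelled_face G F x y z" for x y z
    using labelled_face.face_acts_as_id[OF that M] acts_G[OF K(1) that bounds6(2)] by blast
  have rot: "z_monodromy G' F' = face_rotation G' F' \<longleftrightarrow> acts_as (Inl a, Inl b, Inl c) (monodromy T2 t) rot6"
    using labelled_face.face_rotation_iff[OF image(1)] acts_G'[OF K(2) image(1) bounds6(1)]
    unfolding image(2-4) by blast
  {
    assume "z_knotted S"
    then consider "acts_as (Inl a, Inl b, Inl c) (monodromy T2 t) rot6"
      | y where "y \<in> flags {t}" "acts_as y (monodromy T2 t) M3_6"
      using glued_complexes.knotted_sum_identity[OF glued_complexes] K flags_t[OF face] id[OF face]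
      unfolding z_knotted_S z_knotted_G z_knotted_G' by blast
    then show "z_monodromy G' F' = face_rotation G' F' \<or> type_M3 G' F'"
    proof cases
      case 1
      then show ?thesis
        using rot by blast
    next
      case 2
      obtain a' b' c' where face': "labelled_face G' F' a' b' c'" "y = (inr a', inr b', inr c')"
        using labelled_face_of_flag[OF 2(1)] .
      then have "face_acts_as G' F' (a', b', c') M3_6"
        using acts_G'[OF K(2) face'(1) bounds6(3)] 2(2) by blast
      then show ?thesis
        using labelled_face.type_M3I[OF face'(1)] by blast
    qed
  next
    assume "z_monodromy G' F' = face_rotation G' F' \<or> type_M3 G' F'"
    then show "z_knotted S"
    proof
      assume "z_monodromy G' F' = face_rotation G' F'"
      then show ?thesis
        unfolding z_knotted_S
        using glued_complexes.knotted_sum_aligned[OF glued_complexes, of _ id6 rot6] K flags_t[OF face] id[OF face] rot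
        unfolding z_knotted_G z_knotted_G' by blast
    next
      assume "type_M3 G' F'"
      then obtain a' b' c' where face': "labelled_face G' F' a' b' c'" "face_acts_as G' F' (a', b', c') M3_6"
        using graph_model.type_M3E[OF model_G' F'] by blast
      then have M3: "acts_as (inr a', inr b', inr c') (monodromy T2 t) M3_6"
        using acts_G'[OF K(2) face'(1) bounds6(3)] by blast
      \<comment> \<open>The labels exhibiting type (M3) are chosen in F' and pulled back along g;
        the identity has the same form for all labellings of F, which is why every g works.\<close>
      obtain x y z where xyz: "labelled_face G F x y z" "inr a' = Inl x" "inr b' = Inl y" "inr c' = Inl z"
        using labelled_face_preimage[OF face'(1)] .
      show ?thesis
        unfolding z_knotted_S
        using glued_complexes.knotted_sum_aligned[OF glued_complexes, of _ id6 M3_6] K flags_t[OF xyz(1)] id[OF xyz(1)]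
          M3[unfolded xyz(2-4)]
        unfolding z_knotted_G z_knotted_G' by blast
    qed
  }
qed

lemma z_knotted_sum_M3_M3:
  assumes K: "z_knotted G" "z_knotted G'" and face: "labelled_face G F a b c"
    and M: "face_acts_as G F (a, b, c) M3_6" "face_acts_as G' F' (g a, g b, g c) M3_6"
  shows "z_knotted S"
proof -
  note image = labelled_face_image[OF face]
  have "acts_as (Inl a, Inl b, Inl c) (monodromy T1 t) M3_6" "acts_as (Inl a, Inl b, Inl c) (monodromy T2 t) M3_6"
    using M acts_G[OF K(1) face bounds6(3)] acts_G'[OF K(2) image(1) bounds6(3)] unfolding image(2-4) by blast+
  then show ?thesis
    unfolding z_knotted_S
    using glued_complexes.knotted_sum_aligned[OF glued_complexes, of _ M3_6 M3_6] K flags_t[OF face]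
    unfolding z_knotted_G z_knotted_G' by blast
qed

lemma z_knotted_sum_swapped:
  assumes K: "z_knotted G" "z_knotted G'" and face: "labelled_face G F a b c"
    and M: "face_acts_as G F (a, b, c) L1" "face_acts_as G' F' (g a, g c, g b) L2"
    and L: "(L1, L2) \<in> {(M3_6, M4_6), (M4_6, M3_6), (M4_6, M4_6)}"
  shows "z_knotted S"
proof -
  have face_swap: "labelled_face G F a c b"
    using face unfolding labelled_face_def by (auto simp: insert_commute)
  note image = labelled_face_image[OF face_swap]
  have bounds: "list_all (\<lambda>i. L1 ! i < 6) [0..<6]" "list_all (\<lambda>i. L2 ! i < 6) [0..<6]"
    using L bounds6(3,4) by auto
  have "acts_as (Inl a, Inl b, Inl c) (monodromy T1 t) L1" "acts_as (Inl a, Inl c, Inl b) (monodromy T2 t) L2"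
    using M acts_G[OF K(1) face bounds(1)] acts_G'[OF K(2) image(1) bounds(2)] unfolding image(2-4) by blast+
  then show ?thesis
    unfolding z_knotted_S
    using glued_complexes.knotted_sum_swapped[OF glued_complexes] K flags_t[OF face] L
    unfolding z_knotted_G z_knotted_G' by blast
qed

end

theorem theorem4:
  fixes \<Gamma> :: "'a embedded_graph" and \<Gamma>' :: "'b embedded_graph"
  assumes "surface_triangulation \<Gamma>" and "z_knotted \<Gamma>"
    and "surface_triangulation \<Gamma>'" and "z_knotted \<Gamma>'"
  shows "(\<forall>F\<in>faces \<Gamma>. z_monodromy \<Gamma> F = face_rotation \<Gamma> F \<longrightarrow>
            (\<forall>F'\<in>faces \<Gamma>'. \<forall>g. special_homeomorphism \<Gamma> F \<Gamma>' F' g \<longrightarrow>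
               z_knotted (connected_sum \<Gamma> F \<Gamma>' F' g)))
       \<and> (\<forall>F\<in>faces \<Gamma>. z_monodromy \<Gamma> F = id \<longrightarrow>
            (\<forall>F'\<in>faces \<Gamma>'.
               ((\<exists>g. special_homeomorphism \<Gamma> F \<Gamma>' F' g \<and>
                     z_knotted (connected_sum \<Gamma> F \<Gamma>' F' g)) \<longrightarrow>
                  z_monodromy \<Gamma>' F' = face_rotation \<Gamma>' F' \<or> type_M3 \<Gamma>' F') \<and>
               (z_monodromy \<Gamma>' F' = face_rotation \<Gamma>' F' \<or> type_M3 \<Gamma>' F' \<longrightarrow>
                  (\<forall>g. special_homeomorphism \<Gamma> F \<Gamma>' F' g \<longrightarrow>
                     z_knotted (connected_sum \<Gamma> F \<Gamma>' F' g)))))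
       \<and> (\<forall>F\<in>faces \<Gamma>. \<forall>F'\<in>faces \<Gamma>'.
            (type_M3 \<Gamma> F \<or> type_M4 \<Gamma> F) \<and> (type_M3 \<Gamma>' F' \<or> type_M4 \<Gamma>' F') \<longrightarrow>
            (\<exists>g. special_homeomorphism \<Gamma> F \<Gamma>' F' g \<and>
                 z_knotted (connected_sum \<Gamma> F \<Gamma>' F' g)))"
proof -
  have tri: "triangulation \<Gamma>" "triangulation \<Gamma>'"
    using assms by (simp_all add: triangulation_def)
  have bm: "boundary_map \<Gamma> \<Gamma>' F F' g"
    if "F \<in> faces \<Gamma>" "F' \<in> faces \<Gamma>'" "special_homeomorphism \<Gamma> F \<Gamma>' F' g" for F F' g
    using tri that by (simp add: boundary_map_def boundary_map_axioms_def)
  have model: "graph_model \<Gamma> id" "graph_model \<Gamma>' id"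
    by (rule triangulation.graph_model[OF tri(1)], simp, rule triangulation.graph_model[OF tri(2)], simp)
  have "\<exists>g. special_homeomorphism \<Gamma> F \<Gamma>' F' g \<and> z_knotted (connected_sum \<Gamma> F \<Gamma>' F' g)"
    if F: "F \<in> faces \<Gamma>" "F' \<in> faces \<Gamma>'" and M: "type_M3 \<Gamma> F \<or> type_M4 \<Gamma> F" "type_M3 \<Gamma>' F' \<or> type_M4 \<Gamma>' F'"
    for F F'
  proof -
    obtain a b c L1 where 1: "labelled_face \<Gamma> F a b c" "face_acts_as \<Gamma> F (a, b, c) L1" "L1 \<in> {M3_6, M4_6}"
      using M(1) graph_model.type_M3E[OF model(1) F(1)] graph_model.type_M4E[OF model(1) F(1)]
      by (metis insert_iff)
    obtain a' b' c' L2 where 2: "labelled_face \<Gamma>' F' a' b' c'" "face_acts_as \<Gamma>' F' (a', b', c') L2" "L2 \<in> {M3_6, M4_6}"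
      using M(2) graph_model.type_M3E[OF model(2) F(2)] graph_model.type_M4E[OF model(2) F(2)]
      by (metis insert_iff)
    show ?thesis
    \<comment> \<open>Two faces of type (M3) are glued with matching labels; if type (M4) occurs, g
      exchanges the roles of the last two labels.\<close>
    proof (cases "L1 = M3_6 \<and> L2 = M3_6")
      case True
      obtain g where g: "special_homeomorphism \<Gamma> F \<Gamma>' F' g" "g a = a'" "g b = b'" "g c = c'"
        using ex_special_homeomorphism[OF tri F 1(1) 2(1)] .
      have "z_knotted (connected_sum \<Gamma> F \<Gamma>' F' g)"
        by (rule boundary_map.z_knotted_sum_M3_M3[OF bm[OF F g(1)] assms(2,4) 1(1)]) (use 1(2) 2(2) True g in auto)
      with g(1) show ?thesis by blast
    next
      case False
      have "labelled_face \<Gamma>' F' a' c' b'"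
        using 2(1) unfolding labelled_face_def by (auto simp: insert_commute)
      then obtain g where g: "special_homeomorphism \<Gamma> F \<Gamma>' F' g" "g a = a'" "g b = c'" "g c = b'"
        using ex_special_homeomorphism[OF tri F 1(1)] by metis
      have "z_knotted (connected_sum \<Gamma> F \<Gamma>' F' g)"
        by (rule boundary_map.z_knotted_sum_swapped[OF bm[OF F g(1)] assms(2,4) 1(1,2), of L2])
          (use 2(2) g False 1(3) 2(3) in auto)
      with g(1) show ?thesis by blast
    qed
  qed
  then show ?thesis
    using boundary_map.z_knotted_sum_rotation[OF bm] boundary_map.z_knotted_sum_identity[OF bm] assms(2,4)
    by (intro conjI ballI allI impI) blast+
qed

end
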